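(* Let $c>0$ and $\gamma\in\mathbb R\setminus\{0\}$. Let $n\to\infty$ with $k=k(n)\to\infty$, $\frac kn\to c$, and let $q=q(n)=1-\frac\gamma n$. For each $n$ let $\lambda$ be a random Young diagram in the $n\times k$ rectangle distributed according to one of the two probability measures (A) $\displaystyle \mu_{n,k}(\lambda|q)=\frac{s_\lambda(1,q,\dots,q^{n-1})\,s_{\bar\lambda'}(1,q,\dots,q^{k-1})}{\prod_{i=1}^n\prod_{j=1}^k(q^{i-1}+q^{j-1})}$, (B) $\displaystyle \mu_{n,k}(\lambda|q,q^{-1})=\frac{s_\lambda(1,q,\dots,q^{n-1})\,s_{\bar\lambda'}(1,q^{-1},\dots,q^{1-k})}{\prod_{i=1}^n\prod_{j=1}^k(q^{i-1}+q^{1-j})}$, and let $f_n$ be the upper boundary of the rotated and scaled diagram $\lambda$. Then the limit shape of $f_n$ is $$f(x)=1+\int_0^x(1-2\rho(t))\,dt,\qquad x\in[0,c+1],$$ where the limit density $\rho(t)$, $0<t<c+1$, equals in case (A) $$\rho(t)=\frac1\pi\arccos\left(\mathrm{sgn}(-\gamma)\frac{e^{\gamma-\frac{\gamma t}2}}{2}\frac{1-e^{\gamma(c-1)}}{\sqrt{(1-e^{\gamma t})(1-e^{\gamma(c+1-t)})}}\right),$$ and in case (B) $$\rho(t)=\frac1\pi\arccos\left(\mathrm{sgn}(-\gamma)\frac{e^{\frac\gamma2(t-c)}}{2}\frac{1-e^{\gamma c}-e^{\gamma(c-t)}+e^{\gamma(c+1-t)}}{\sqrt{(1-e^{\gamma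 t})(1-e^{\gamma(c+1-t)})}}\right).$$ Here convergence to the limit shape is weak convergence: for every continuous compactly supported function $g:(0,c+1)\to\mathbb R$, $$\int g(x)f_n'(x)\,dx\longrightarrow\int g(x)f'(x)\,dx\quad\text{in probability as } n\to\infty .$$
   Context: $s_\mu$ denotes the Schur polynomial. For $\lambda$ with at most $n$ rows and at most $k$ columns, $\bar\lambda$ is the complement in the $n\times k$ rectangle, $\bar\lambda_i=k-\lambda_{n+1-i}$, and $\bar\lambda'$ is its conjugate (transposed) diagram. Upper boundary: put $a_i=\lambda_i+n-i\in\{0,\dots,n+k-1\}$, $i=1,\dots,n$. Rotating the diagram by $45^\circ$ and scaling by $\frac1n$, its upper boundary is the continuous piecewise-linear function $f_n$ on $[0,\frac{n+k}n]$ with $f_n(0)=1$, slope $-1$ on each interval $[\frac{a_i}n,\frac{a_i+1}n]$, $i=1,\dots,n$, and slope $+1$ on each of the remaining intervals $[\frac jn,\frac{j+1}n]$, $j\in\{0,\dots,n+k-1\}\setminus\{a_1,\dots,a_n\}$. Convention: if the argument of $\arccos$ in the formula for $\rho(t)$ is greater than $1$, then $\rho(t)=0$; if it is less than $-1$, then $\rho(t)=1$. *)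

theory Defs
  imports "HOL-Analysis.Analysis"
begin

section \<open>Young diagrams and Schur polynomials\<close>

text \<open>
  A Young diagram is the function giving its row lengths, with rows and columns indexed from 0.
  All rows from some index on are empty, so each diagram has exactly one representation.
\<close>

definition young_rect :: "nat \<Rightarrow> nat \<Rightarrow> (nat \<Rightarrow> nat) set" where
  "young_rect n k = {\<nu>. antimono \<nu> \<and> (\<forall>i. \<nu> i \<le> k) \<and> (\<forall>i\<ge>n. \<nu> i = 0)}"

definition cells :: "(nat \<Rightarrow> nat) \<Rightarrow> (nat \<times> nat) set" where
  "cells \<nu> = {(i, j). j < \<nu> i}"

definition conjugate :: "(nat \<Rightarrow> nat) \<Rightarrow> nat \<Rightarrow> nat" where
  "conjugate \<nu> j = card {i. j < \<nu> i}"

definition rect_complement :: "nat \<Rightarrow> nat \<Rightarrow> (nat \<Rightarrow> nat) \<Rightarrow> nat \<Rightarrow> nat" where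
  "rect_complement n k \<nu> i = (if i < n then k - \<nu> (n - Suc i) else 0)"

text \<open>
  Semistandard tableaux of shape \<open>\<nu>\<close> with entries in \<open>{0, \<dots>, m - 1}\<close>: rows weakly increase
  and columns strictly increase.
\<close>

definition ssyt :: "nat \<Rightarrow> (nat \<Rightarrow> nat) \<Rightarrow> (nat \<times> nat \<Rightarrow> nat) set" where
  "ssyt m \<nu> = {T \<in> cells \<nu> \<rightarrow>\<^sub>E {..<m}.
     (\<forall>i j. (i, Suc j) \<in> cells \<nu> \<longrightarrow> T (i, j) \<le> T (i, Suc j)) \<and>
     (\<forall>i j. (Suc i, j) \<in> cells \<nu> \<longrightarrow> T (i, j) < T (Suc i, j))}"

text \<open>The Schur polynomial \<open>s\<^sub>\<nu>(x\<^sub>0, \<dots>, x\<^sub>m\<^sub>-\<^sub>1)\<close>.\<close>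

definition schur :: "nat \<Rightarrow> (nat \<Rightarrow> nat) \<Rightarrow> (nat \<Rightarrow> 'a::comm_semiring_1) \<Rightarrow> 'a" where
  "schur m \<nu> x = (\<Sum>T\<in>ssyt m \<nu>. \<Prod>b\<in>cells \<nu>. x (T b))"

lemma finite_young_rect: "finite (young_rect n k)"
proof -
  let ?r = "\<lambda>\<nu>. restrict \<nu> {..<n}"
  have "?r ` young_rect n k \<subseteq> {..<n} \<rightarrow>\<^sub>E {..k}"
    by (auto simp: young_rect_def split: if_splits)
  then have "finite (?r ` young_rect n k)"
    by (rule finite_subset) (simp add: finite_PiE)
  moreover have "inj_on ?r (young_rect n k)"
  proof (rule inj_onI, rule ext)
    fix \<nu> \<kappa> :: "nat \<Rightarrow> nat" and i
    assume "\<nu> \<in> young_rect n k" "\<kappa> \<in> young_rect n k" and eq: "?r \<nu> = ?r \<kappa>"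
    then have "n \<le> i \<Longrightarrow> \<nu> i = \<kappa> i"
      by (simp add: young_rect_def)
    moreover have "i < n \<Longrightarrow> \<nu> i = \<kappa> i"
      using fun_cong[OF eq, of i] by simp
    ultimately show "\<nu> i = \<kappa> i"
      by linarith
  qed
  ultimately show ?thesis
    by (rule finite_imageD)
qed

lemma finite_cells:
  assumes "\<nu> \<in> young_rect n k"
  shows "finite (cells \<nu>)"
proof (rule finite_subset)
  show "cells \<nu> \<subseteq> {..<n} \<times> {..<k}"
  proof clarify
    fix i j assume "(i, j) \<in> cells \<nu>"
    then have j: "j < \<nu> i" by (simp add: cells_def)
    have "\<nu> i \<le> k" "n \<le> i \<Longrightarrow> \<nu> i = 0"
      using assms by (auto simp: young_rect_def)
    with j show "i \<in> {..<n} \<and> j \<in> {..<k}"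
      by (cases "n \<le> i") auto
  qed
qed simp

lemma finite_ssyt: "\<nu> \<in> young_rect n k \<Longrightarrow> finite (ssyt m \<nu>)"
  by (simp add: ssyt_def finite_PiE finite_cells)

section \<open>Random diagrams in a rectangle\<close>

definition diagram_weight ::
    "nat \<Rightarrow> nat \<Rightarrow> (nat \<Rightarrow> real) \<Rightarrow> (nat \<Rightarrow> real) \<Rightarrow> (nat \<Rightarrow> nat) \<Rightarrow> real" where
  "diagram_weight n k x y \<nu> =
     schur n \<nu> x * schur k (conjugate (rect_complement n k \<nu>)) y / (\<Prod>i<n. \<Prod>j<k. x i + y j)"

text \<open>
  For positive \<open>x\<close> and \<open>y\<close> the weights are nonnegative, and by the dual Cauchy identity they add
  up to 1. The conversion to \<open>ennreal\<close> truncates negative weights, which do not occur then.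
\<close>

definition diagram_measure ::
    "nat \<Rightarrow> nat \<Rightarrow> (nat \<Rightarrow> real) \<Rightarrow> (nat \<Rightarrow> real) \<Rightarrow> (nat \<Rightarrow> nat) measure" where
  "diagram_measure n k x y =
     point_measure (young_rect n k) (\<lambda>\<nu>. ennreal (diagram_weight n k x y \<nu>))"

definition measure_A :: "real \<Rightarrow> nat \<Rightarrow> nat \<Rightarrow> (nat \<Rightarrow> nat) measure" where
  "measure_A q n k = diagram_measure n k (\<lambda>i. q ^ i) (\<lambda>j. q ^ j)"

definition measure_B :: "real \<Rightarrow> nat \<Rightarrow> nat \<Rightarrow> (nat \<Rightarrow> nat) measure" where
  "measure_B q n k = diagram_measure n k (\<lambda>i. q ^ i) (\<lambda>j. inverse q ^ j)"

section \<open>Upper boundary\<close>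

definition particles :: "nat \<Rightarrow> (nat \<Rightarrow> nat) \<Rightarrow> nat set" where
  "particles n \<nu> = (\<lambda>i. \<nu> i + (n - Suc i)) ` {..<n}"

definition boundary_slope :: "nat \<Rightarrow> (nat \<Rightarrow> nat) \<Rightarrow> real \<Rightarrow> real" where
  "boundary_slope n \<nu> t =
     (if \<exists>a\<in>particles n \<nu>. real a / real n \<le> t \<and> t < (real a + 1) / real n then -1 else 1)"

text \<open>Only the values for \<open>x\<close> between 0 and \<open>(n + k) / n\<close> are meaningful.\<close>

definition upper_boundary :: "nat \<Rightarrow> (nat \<Rightarrow> nat) \<Rightarrow> real \<Rightarrow> real" where
  "upper_boundary n \<nu> x = 1 + integral {0..x} (boundary_slope n \<nu>)"

lemma boundary_slope_on:
  assumes "n > 0" "real j / real n \<le> t" "t < (real j + 1) / real n"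
  shows "boundary_slope n \<nu> t = (if j \<in> particles n \<nu> then -1 else 1)"
proof -
  have eq: "a = j" if "real a / real n \<le> t" "t < (real a + 1) / real n" for a
  proof -
    have "real a < real j + 1" "real j < real a + 1"
      using assms that by (simp_all add: field_simps)
    then show ?thesis by linarith
  qed
  have "(\<exists>a\<in>particles n \<nu>. real a / real n \<le> t \<and> t < (real a + 1) / real n) \<longleftrightarrow>
      j \<in> particles n \<nu>"
    using eq assms(2,3) by blast
  then show ?thesis
    unfolding boundary_slope_def by (rule if_cong) (rule refl)+
qed

lemma boundary_slope_has_integral:
  assumes "n > 0" "real j / real n \<le> x" "x \<le> (real j + 1) / real n"
  shows "(boundary_slope n \<nu> has_integral
           (if j \<in> particles n \<nu> then -1 else 1) * (x - real j / real n)) {real j / real n..x}"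
proof -
  let ?s = "if j \<in> particles n \<nu> then -1 else 1 :: real"
  have "((\<lambda>t. ?s) has_integral ?s * (x - real j / real n)) {real j / real n..x}"
    using has_integral_const_real[of ?s "real j / real n" x] assms by (simp add: mult.commute)
  then show ?thesis
  proof (rule has_integral_spike_finite[where S = "{x}", rotated 2])
    fix t assume "t \<in> {real j / real n..x} - {x}"
    then show "boundary_slope n \<nu> t = ?s"
      using assms by (intro boundary_slope_on) auto
  qed simp
qed

lemma boundary_slope_integrable:
  assumes "n > 0"
  shows "boundary_slope n \<nu> integrable_on {0..real j / real n}"
proof (induction j)
  case (Suc j)
  have le: "real j / real n \<le> real (Suc j) / real n"
    by (intro divide_right_mono) auto
  have eq: "real (Suc j) = real j + 1"
    by simp
  have "boundary_slope n \<nu> integrable_on {real j / real n..real (Suc j) / real n}"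
    by (rule has_integral_integrable[OF boundary_slope_has_integral[OF assms le]])
      (simp only: eq order_refl)
  from Henstock_Kurzweil_Integration.integrable_combine[OF _ le Suc this] show ?case
    by simp
next
  case 0
  show ?case
    using integrable_on_refl[of "boundary_slope n \<nu>" 0] by simp
qed

text \<open>\<open>upper_boundary\<close> starts at 1 and is affine, with the intended slope, on each unit step.\<close>

lemma upper_boundary_0: "upper_boundary n \<nu> 0 = 1"
  by (simp add: upper_boundary_def)

lemma upper_boundary_step:
  assumes "n > 0" "real j / real n \<le> x" "x \<le> (real j + 1) / real n"
  shows "upper_boundary n \<nu> x = upper_boundary n \<nu> (real j / real n) +
           (if j \<in> particles n \<nu> then -1 else 1) * (x - real j / real n)"
proof -
  note I = boundary_slope_has_integral[OF assms, of \<nu>]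
  have j: "0 \<le> real j / real n"
    by simp
  have "boundary_slope n \<nu> integrable_on {0..x}"
    by (rule Henstock_Kurzweil_Integration.integrable_combine[OF j assms(2)
          boundary_slope_integrable[OF assms(1)] has_integral_integrable[OF I]])
  from Henstock_Kurzweil_Integration.integral_combine[OF j assms(2) this]
  have "integral {0..real j / real n} (boundary_slope n \<nu>) +
      integral {real j / real n..x} (boundary_slope n \<nu>) = integral {0..x} (boundary_slope n \<nu>)" .
  with integral_unique[OF I] show ?thesis
    by (simp add: upper_boundary_def)
qed

section \<open>Limit shape\<close>

text \<open>\<open>arccos\<close> extended by its boundary values; the library \<open>arccos\<close> is unspecified outside [-1, 1].\<close>

definition arccos_ext :: "real \<Rightarrow> real" where
  "arccos_ext y = (if y > 1 then 0 else if y < -1 then pi else arccos y)"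

definition rho_A :: "real \<Rightarrow> real \<Rightarrow> real \<Rightarrow> real" where
  "rho_A c \<gamma> t = 1 / pi * arccos_ext (sgn (- \<gamma>) * (exp (\<gamma> - \<gamma> * t / 2) / 2) *
     ((1 - exp (\<gamma> * (c - 1))) / sqrt ((1 - exp (\<gamma> * t)) * (1 - exp (\<gamma> * (c + 1 - t))))))"

definition rho_B :: "real \<Rightarrow> real \<Rightarrow> real \<Rightarrow> real" where
  "rho_B c \<gamma> t = 1 / pi * arccos_ext (sgn (- \<gamma>) * (exp (\<gamma> / 2 * (t - c)) / 2) *
     ((1 - exp (\<gamma> * c) - exp (\<gamma> * (c - t)) + exp (\<gamma> * (c + 1 - t))) /
      sqrt ((1 - exp (\<gamma> * t)) * (1 - exp (\<gamma> * (c + 1 - t))))))"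

definition limit_shape :: "(real \<Rightarrow> real) \<Rightarrow> real \<Rightarrow> real" where
  "limit_shape \<rho> x = 1 + integral {0..x} (\<lambda>t. 1 - 2 * \<rho> t)"

definition compactly_supported_on :: "real set \<Rightarrow> (real \<Rightarrow> real) \<Rightarrow> bool" where
  "compactly_supported_on U g \<longleftrightarrow> (\<exists>K. compact K \<and> K \<subseteq> U \<and> (\<forall>x\<in>U - K. g x = 0))"

text \<open>
  Weak convergence in probability of the boundaries of random diagrams, the \<open>n\<close>-th distributed
  according to \<open>M n\<close>, to the function \<open>F\<close> on \<open>(0, L)\<close>. If the boundaries are defined on intervals
  \<open>[0, L\<^sub>n]\<close> with \<open>L\<^sub>n\<close> tending to \<open>L\<close>, the support of \<open>g\<close> lies in \<open>[0, L\<^sub>n]\<close> for large \<open>n\<close>.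
\<close>

definition has_limit_shape :: "(nat \<Rightarrow> (nat \<Rightarrow> nat) measure) \<Rightarrow> real \<Rightarrow> (real \<Rightarrow> real) \<Rightarrow> bool" where
  "has_limit_shape M L F \<longleftrightarrow>
     (\<forall>g. continuous_on {0<..<L} g \<and> compactly_supported_on {0<..<L} g \<longrightarrow>
       (\<forall>\<epsilon>>0. (\<lambda>n. measure (M n) {\<nu> \<in> space (M n).
           \<bar>(LBINT x:{0<..<L}. g x * deriv (upper_boundary n \<nu>) x) -
            (LBINT x:{0<..<L}. g x * deriv F x)\<bar> > \<epsilon>}) \<longlonglongrightarrow> 0))"

end

theory Submission
  imports Defs "Jordan_Normal_Form.Determinant" "HOL-Complex_Analysis.Complex_Analysis"
begin

text \<open>
  A diagram in the rectangle is encoded by the set of its \<open>n\<close> particles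
  \<open>a\<^sub>1 > \<dots> > a\<^sub>n\<close> in \<open>{0..<n + k}\<close>, the positions of
  the steps of slope \<open>- 1\<close>; the other positions are the holes. The random measure
  with mass \<open>1 / n\<close> at each \<open>a / n\<close> has to be shown to converge to the
  density \<open>\<rho>\<close>. With \<open>q = 1 - \<gamma> / n\<close>, the number
  \<open>q\<^sup>a\<close> is close to \<open>exp (- \<gamma> a / n)\<close>, so it is enough to
  find the limits of the normalized power sums \<open>(\<Sum>\<^sub>a q\<^bsup>m a\<^esup>) /
  n\<close> for all \<open>m \<ge> 1\<close>, to show that they concentrate, and to recognize
  the limits as the integrals of \<open>exp (- \<gamma> m t) \<rho>(t)\<close>. Weierstrass
  approximation in the variable \<open>exp (- \<gamma> t)\<close> and Chebyshev's inequality do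
  the rest (\<open>q_pair_limit_shape\<close>).

  Exact moments. By \<open>schur_bialternant\<close> the two Schur polynomials are alternants,
  with the particles and the holes as exponents. Their product is therefore the group of terms,
  in the expansion of one determinant of size \<open>n + k\<close> with the entries
  \<open>z\<^sup>c\<close>, in which the first \<open>n\<close> rows use the particles as
  columns; the nodes \<open>z\<close> are the numbers \<open>x i\<close> and \<open>- y
  j\<close>. Summing over diagrams gives all terms (\<open>schur_pair_sum\<close>). Without
  further weight this is the dual Cauchy identity. With the weight \<open>\<Sum>\<^sub>a
  t\<^sup>a\<close> it amounts to scaling one of the first \<open>n\<close> nodes by
  \<open>t\<close>, so the mean is a sum of values of Lagrange polynomials
  (\<open>expect_power_sum\<close>). In the same way the second moment comes from scaling two
  nodes. The variance is bounded by the mean of \<open>\<Sum>\<^sub>a t\<^sup>2\<^sup>a\<close>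
  because the kernel of the particles is symmetric up to positive weights
  (\<open>trace_square_nonneg\<close>), and this is concentration.

  Geometric progressions. Both measures have \<open>x i = q ^ i\<close> and, in one order or the
  other, \<open>y j = \<mu> q\<^sup>j\<close>, with \<open>\<mu> = 1\<close> in the first and
  \<open>\<mu> = q\<^bsup>1 - k\<^esup>\<close> in the second case. For \<open>t =
  q\<^sup>m\<close> a scaled node is again a node with \<open>m\<close> exceptions, so only
  \<open>m\<close> Lagrange terms remain. They form a divided difference at \<open>m\<close>
  points that all tend to \<open>\<alpha> = exp (- \<gamma>)\<close>
  (\<open>expect_geometric_moment\<close>).

  Limit of the moments. A divided difference is a contour integral, which is continuous also
  where the points coincide. The limit is an integral of \<open>F(z)\<^sup>m / z\<close> around
  \<open>\<alpha>\<close> with \<open>F(z) = \<kappa> (z - 1) (z + \<mu>) / ((z - \<alpha>) (z +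
  \<nu>))\<close>. A Moebius coordinate \<open>\<eta>\<close> turns \<open>F\<close> into
  \<open>U \<eta> = p / \<eta> + mid + r \<eta>\<close>. Up to terms without residue the
  integrand is a Laurent polynomial in \<open>\<eta>\<close>, and the contour may be moved to
  the circle on which \<open>U\<close> is real. This yields a real integral over the angle
  \<open>\<phi>\<close> on the upper half circle (\<open>moment_limit\<close>).

  The density. Substitute \<open>exp (- \<gamma> t) = U \<eta>\<close> and integrate by parts:
  the differential \<open>dz / z\<close> has the primitive \<open>ln ((\<eta> - A) / (1 +
  \<eta>))\<close>, whose imaginary part becomes \<open>pi * \<rho>(t)\<close>, the argument of
  \<open>(1 + \<eta>) / (1 - \<eta> / A)\<close> (\<open>density_moment\<close>). Adding the
  arguments of numerator and denominator gives an arc cosine of a single expression, which is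
  the stated density in either case (\<open>rho_A_angle_sum\<close>,
  \<open>rho_B_angle_sum\<close>). The extension of the arc cosine by \<open>0\<close> and
  \<open>pi\<close> accounts for the straight parts of the limit shape, where \<open>exp (-
  \<gamma> t)\<close> is not a value of \<open>U\<close> on the circle.
\<close>

section \<open>Determinants of arrays\<close>

definition array_det :: "nat \<Rightarrow> (nat \<Rightarrow> nat \<Rightarrow> real) \<Rightarrow> real" where
  "array_det n A = Determinant.det (Matrix.mat n n (\<lambda>(i, j). A i j))"

lemma array_det_leibniz:
  "array_det n A = (\<Sum>p | p permutes {..<n}. of_int (sign p) * (\<Prod>i<n. A i (p i)))"
proof -
  have "(\<Prod>i=0..<n. Matrix.mat n n (\<lambda>(i, j). A i j) $$ (i, p i)) = (\<Prod>i=0..<n. A i (p i))"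
    if "p permutes {0..<n}" for p
    using permutes_in_image[OF that] by (intro prod.cong) auto
  then show ?thesis
    unfolding array_det_def Determinant.det_def'[OF mat_carrier]
    by (auto simp: atLeast0LessThan intro!: sum.cong)
qed

lemma array_det_cong:
  "(\<And>i j. i < n \<Longrightarrow> j < n \<Longrightarrow> A i j = B i j) \<Longrightarrow> array_det n A = array_det n B"
  unfolding array_det_def by (intro arg_cong[where f = Determinant.det] eq_matI) auto

lemma array_det_0 [simp]: "array_det 0 A = 1"
  by (simp add: array_det_leibniz)

lemma array_det_mult:
  "array_det n (\<lambda>i j. \<Sum>l<n. A i l * B l j) = array_det n A * array_det n B"
proof -
  let ?A = "Matrix.mat n n (\<lambda>(i, j). A i j)" and ?B = "Matrix.mat n n (\<lambda>(i, j). B i j)"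
  have "Matrix.mat n n (\<lambda>(i, j). \<Sum>l<n. A i l * B l j) = ?A * ?B"
    by (intro eq_matI) (auto simp: scalar_prod_def atLeast0LessThan)
  then show ?thesis
    unfolding array_det_def using Determinant.det_mult[of ?A n ?B] by simp
qed

lemma array_det_block:
  assumes "\<And>i j. i < n \<Longrightarrow> n \<le> j \<Longrightarrow> j < n + k \<Longrightarrow> A i j = 0"
  shows "array_det (n + k) A = array_det n A * array_det k (\<lambda>i j. A (n + i) (n + j))"
proof -
  let ?M = "\<lambda>a b f. Matrix.mat a b (\<lambda>(i, j). f i j)"
  have "?M (n + k) (n + k) A = four_block_mat (?M n n A) (0\<^sub>m n k)
      (?M k n (\<lambda>i j. A (n + i) j)) (?M k k (\<lambda>i j. A (n + i) (n + j)))"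
    by (intro eq_matI) (auto simp: assms)
  then show ?thesis
    unfolding array_det_def by (simp add: det_four_block_mat_upper_right_zero[of _ n _ k])
qed

lemma array_det_last_column:
  assumes "\<And>i. i < n \<Longrightarrow> A i n = 0"
  shows "array_det (Suc n) A = array_det n A * A n n"
proof -
  have "{p. p permutes {..<Suc 0}} = {id}"
    by (auto simp: lessThan_Suc)
  moreover have "sign (id::nat \<Rightarrow> nat) = 1" by (rule sign_id)
  ultimately have "array_det (Suc 0) B = B 0 0" for B
    by (simp only: array_det_leibniz) simp
  then show ?thesis
    using array_det_block[of n 1 A] assms by (force simp: less_Suc_eq_le)
qed

lemma array_det_unitriangular:
  assumes "\<And>i j. i < n \<Longrightarrow> j < i \<Longrightarrow> A i j = 0" "\<And>i. i < n \<Longrightarrow> A i i = 1"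
  shows "array_det n A = 1"
proof -
  let ?M = "Matrix.mat n n (\<lambda>(i, j). A i j)"
  have "Determinant.det ?M = prod_list (diag_mat ?M)"
    by (rule det_upper_triangular[of _ n]) (auto simp: upper_triangular_def assms)
  also have "\<dots> = 1"
    by (simp add: prod_list_diag_prod assms)
  finally show ?thesis by (simp add: array_det_def)
qed

lemma array_det_permute_rows:
  assumes "p permutes {..<n}"
  shows "array_det n (\<lambda>i. A (p i)) = of_int (sign p) * array_det n A"
proof -
  let ?M = "Matrix.mat n n (\<lambda>(i, j). A i j)"
  have "Matrix.mat n n (\<lambda>(i, j). A (p i) j) = Matrix.mat n n (\<lambda>(i, j). ?M $$ (p i, j))"
    using permutes_in_image[OF assms] by (intro eq_matI) auto
  then show ?thesis
    using det_permute_rows[of ?M n p] assms by (simp add: array_det_def atLeast0LessThan)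
qed

lemma array_det_transpose: "array_det n (\<lambda>i j. A j i) = array_det n A"
proof -
  have "Matrix.mat n n (\<lambda>(i, j). A j i) = transpose_mat (Matrix.mat n n (\<lambda>(i, j). A i j))"
    by (intro eq_matI) auto
  then show ?thesis
    unfolding array_det_def by (simp add: det_transpose[of _ n])
qed

lemma array_det_sum_rows:
  assumes "\<And>i. i < n \<Longrightarrow> finite (S i)"
  shows "array_det n (\<lambda>i j. \<Sum>b\<in>S i. g i j b) = (\<Sum>b\<in>PiE {..<n} S. array_det n (\<lambda>i j. g i j (b i)))"
proof -
  have "array_det n (\<lambda>i j. \<Sum>b\<in>S i. g i j b) =
      (\<Sum>p | p permutes {..<n}. of_int (sign p) * (\<Sum>b\<in>PiE {..<n} S. \<Prod>i<n. g i (p i) (b i)))"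
    unfolding array_det_leibniz using assms by (subst prod_sum_PiE) auto
  also have "\<dots> = (\<Sum>b\<in>PiE {..<n} S. array_det n (\<lambda>i j. g i j (b i)))"
    unfolding array_det_leibniz sum_distrib_left by (rule sum.swap)
  finally show ?thesis .
qed

lemma array_det_scale_rows:
  "array_det n (\<lambda>i j. c i * A i j) = (\<Prod>i<n. c i) * array_det n A"
  unfolding array_det_leibniz sum_distrib_left
  by (intro sum.cong) (auto simp: prod.distrib)

lemma array_det_scale_columns:
  "array_det n (\<lambda>i j. c j * A i j) = (\<Prod>j<n. c j) * array_det n A"
  using array_det_scale_rows[of n c "\<lambda>i j. A j i"] array_det_transpose[of n A]
    array_det_transpose[of n "\<lambda>i j. c j * A i j"] by simp

text \<open>
  A permutation that moves an index outside \<open>R\<close> picks a zero of the identity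
  matrix, so only the minor with rows and columns in \<open>R\<close> survives.
\<close>

lemma array_det_identity_except:
  assumes "R \<subseteq> {..<n}"
  shows "array_det n (\<lambda>i j. if i \<in> R then B i j else if i = j then 1 else 0) =
    (\<Sum>p | p permutes R. of_int (sign p) * (\<Prod>i\<in>R. B i (p i)))"
proof -
  have fin: "finite R" using assms finite_subset by blast
  let ?E = "\<lambda>i j. if i \<in> R then B i j else if i = j then 1 else (0::real)"
  have sub: "{p. p permutes R} \<subseteq> {p. p permutes {..<n}}"
    using assms permutes_subset by blast
  have zero: "of_int (sign p) * (\<Prod>i<n. ?E i (p i)) = 0"
    if p: "p \<in> {p. p permutes {..<n}} - {p. p permutes R}" for p
  proof -
    have "\<exists>i\<in>{..<n} - R. p i \<noteq> i"
      using p permutes_superset[of p "{..<n}" R] by auto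
    then obtain i where "i < n" "i \<notin> R" "p i \<noteq> i" by auto
    then have "(\<Prod>i<n. ?E i (p i)) = 0"
      by (intro prod_zero) auto
    then show ?thesis by simp
  qed
  have "array_det n ?E = (\<Sum>p | p permutes R. of_int (sign p) * (\<Prod>i<n. ?E i (p i)))"
    unfolding array_det_leibniz
    by (intro sum.mono_neutral_right sub finite_permutations) (use zero in auto)
  also have "\<dots> = (\<Sum>p | p permutes R. of_int (sign p) * (\<Prod>i\<in>R. B i (p i)))"
  proof (intro sum.cong refl)
    fix p assume "p \<in> {p. p permutes R}"
    then have "(\<Prod>i<n. ?E i (p i)) = (\<Prod>i\<in>R. ?E i (p i))"
      by (intro prod.mono_neutral_right) (use assms in \<open>auto simp: permutes_def\<close>)
    then show "of_int (sign p) * (\<Prod>i<n. ?E i (p i)) = of_int (sign p) * (\<Prod>i\<in>R. B i (p i))"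
      by simp
  qed
  finally show ?thesis .
qed

text \<open>
  Replacing rows by combinations of all rows is multiplication from the left by a matrix that is
  the identity outside \<open>R\<close>. With one or two replaced rows this is Cramer's rule and
  its second order analogue, which give the first two moments below.
\<close>

lemma array_det_replace_rows:
  assumes "R \<subseteq> {..<n}"
  shows "array_det n (\<lambda>i j. if i \<in> R then \<Sum>l<n. B i l * A l j else A i j) =
    (\<Sum>p | p permutes R. of_int (sign p) * (\<Prod>i\<in>R. B i (p i))) * array_det n A"
proof -
  have "array_det n (\<lambda>i j. if i \<in> R then \<Sum>l<n. B i l * A l j else A i j) =
     array_det n (\<lambda>i j. \<Sum>l<n. (if i \<in> R then B i l else if i = l then 1 else 0) * A l j)"
  proof (rule array_det_cong)
    fix i j assume "i < n"
    then have "(\<Sum>l<n. (if i = l then 1 else 0) * A l j) = A i j"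
      by (subst sum.cong[OF refl, of _ _ "\<lambda>l. if i = l then A l j else 0"]) auto
    then show "(if i \<in> R then \<Sum>l<n. B i l * A l j else A i j) =
        (\<Sum>l<n. (if i \<in> R then B i l else if i = l then 1 else 0) * A l j)"
      by auto
  qed
  then show ?thesis
    by (simp add: array_det_mult array_det_identity_except[OF assms])
qed

lemma permutes_doubleton:
  assumes "a \<noteq> b"
  shows "{p. p permutes {a, b}} = {id, Transposition.transpose a b}"
proof -
  have "{p. p permutes {a, b}} = (\<lambda>(c, p). Transposition.transpose a c \<circ> p) ` {(c, p). c \<in> {a, b} \<and> p \<in> {p. p permutes {b}}}"
    by (rule permutes_insert)
  also have "{(c, p). c \<in> {a, b} \<and> p \<in> {p. p permutes {b}}} = {(a, id), (b, id)}"
    by auto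
  finally show ?thesis by simp
qed

lemma array_det_replace_row:
  assumes "a < n"
  shows "array_det n (\<lambda>i j. if i = a then \<Sum>l<n. B l * A l j else A i j) = B a * array_det n A"
  using array_det_replace_rows[of "{a}" n "\<lambda>_. B" A] assms by (simp add: sign_id)

lemma array_det_replace_two_rows:
  assumes "a < n" "b < n" "a \<noteq> b"
  shows "array_det n (\<lambda>i j. if i \<in> {a, b} then \<Sum>l<n. B i l * A l j else A i j) =
    (B a a * B b b - B a b * B b a) * array_det n A"
proof -
  have "(\<Sum>p | p permutes {a, b}. of_int (sign p) * (\<Prod>i\<in>{a, b}. B i (p i))) =
      B a a * B b b - B a b * B b a"
  proof -
    have "id \<noteq> Transposition.transpose a b"
      using assms(3) by (metis id_apply transpose_apply_first)
    then show ?thesis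
      unfolding permutes_doubleton[OF assms(3)] using assms(3)
      by (simp add: sign_id sign_swap_id)
  qed
  then show ?thesis
    using array_det_replace_rows[of "{a, b}" n B A] assms by simp
qed

section \<open>Schur polynomials as quotients of alternants\<close>

text \<open>
  The shapes left when the largest entry is removed from a tableau: the removed cells form a
  horizontal strip.
\<close>

definition interlacing :: "nat \<Rightarrow> (nat \<Rightarrow> nat) \<Rightarrow> (nat \<Rightarrow> nat) set" where
  "interlacing m \<nu> = {\<mu>. (\<forall>i<m. \<nu> (Suc i) \<le> \<mu> i \<and> \<mu> i \<le> \<nu> i) \<and> (\<forall>i\<ge>m. \<mu> i = 0)}"

lemma ssyt_entry_ge_row:
  assumes "antimono \<nu>" "T \<in> ssyt m \<nu>" "(i, j) \<in> cells \<nu>"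
  shows "i \<le> T (i, j)"
  using assms(3)
proof (induction i)
  case (Suc i)
  have "\<nu> (Suc i) \<le> \<nu> i" using assms(1) by (simp add: antimonoD)
  then have "(i, j) \<in> cells \<nu>" using Suc.prems by (simp add: cells_def)
  moreover have "T (i, j) < T (Suc i, j)"
    using assms(2) Suc.prems by (auto simp: ssyt_def)
  ultimately show ?case using Suc.IH by linarith
qed simp

lemma ssyt_row_mono:
  assumes "T \<in> ssyt m \<nu>" "j \<le> j'" "(i, j') \<in> cells \<nu>"
  shows "T (i, j) \<le> T (i, j')"
  using assms(2,3)
proof (induction j' rule: dec_induct)
  case (step j')
  then have "(i, j') \<in> cells \<nu>" by (simp add: cells_def)
  moreover have "T (i, j') \<le> T (i, Suc j')"
    using assms(1) step.prems by (auto simp: ssyt_def)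
  ultimately show ?case using step.IH by linarith
qed simp

definition small_part :: "nat \<Rightarrow> (nat \<Rightarrow> nat) \<Rightarrow> (nat \<times> nat \<Rightarrow> nat) \<Rightarrow> nat \<Rightarrow> nat" where
  "small_part m \<nu> T i = card {j. j < \<nu> i \<and> T (i, j) < m}"

lemma down_closed_eq_lessThan:
  fixes S :: "nat set"
  assumes "finite S" "\<And>i j. j \<in> S \<Longrightarrow> i \<le> j \<Longrightarrow> i \<in> S"
  shows "S = {..<card S}"
proof -
  have "S = {..Max S}" if "S \<noteq> {}"
    using assms(2)[OF Max_in[OF assms(1) that]] Max_ge[OF assms(1)] by auto
  then show ?thesis
    by (metis card_atMost card.empty lessThan_0 lessThan_Suc_atMost)
qed

text \<open>
  Rows increase weakly, so the entries below \<open>m\<close> fill an initial piece of each row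
  and counting them loses nothing.
\<close>

lemma cells_small_part:
  assumes "T \<in> ssyt (Suc m) \<nu>"
  shows "cells (small_part m \<nu> T) = {(i, j) \<in> cells \<nu>. T (i, j) < m}"
proof -
  have "{j. j < \<nu> i \<and> T (i, j) < m} = {..<small_part m \<nu> T i}" for i
    unfolding small_part_def
  proof (rule down_closed_eq_lessThan)
    fix j j' assume "j' \<in> {j. j < \<nu> i \<and> T (i, j) < m}" "j \<le> j'"
    then show "j \<in> {j. j < \<nu> i \<and> T (i, j) < m}"
      using ssyt_row_mono[OF assms, of j j' i] by (auto simp: cells_def)
  qed simp
  then show ?thesis
    unfolding cells_def by (auto simp: set_eq_iff)
qed

text \<open>
  Each cell of row \<open>i + 1\<close> has a strictly smaller entry above it, so that entry is
  below \<open>m\<close>; and row \<open>m\<close> has no entry below \<open>m\<close>, because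
  columns increase strictly.
\<close>

lemma small_part_interlacing:
  assumes "antimono \<nu>" "\<And>i. m < i \<Longrightarrow> \<nu> i = 0" "T \<in> ssyt (Suc m) \<nu>"
  shows "small_part m \<nu> T \<in> interlacing m \<nu>"
proof -
  have le: "small_part m \<nu> T i \<le> \<nu> i" for i
    unfolding small_part_def using card_mono[of "{..<\<nu> i}" "{j. j < \<nu> i \<and> T (i, j) < m}"] by auto
  moreover have "\<nu> (Suc i) \<le> small_part m \<nu> T i" for i
  proof -
    have "{..<\<nu> (Suc i)} \<subseteq> {j. j < \<nu> i \<and> T (i, j) < m}"
    proof
      fix j assume "j \<in> {..<\<nu> (Suc i)}"
      then have c: "(Suc i, j) \<in> cells \<nu>" by (simp add: cells_def)
      then have "T (i, j) < T (Suc i, j)" "T (Suc i, j) < Suc m"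
        using assms(3) by (auto simp: ssyt_def)
      moreover have "\<nu> (Suc i) \<le> \<nu> i" using assms(1) by (simp add: antimonoD)
      ultimately show "j \<in> {j. j < \<nu> i \<and> T (i, j) < m}"
        using c by (auto simp: cells_def)
    qed
    from card_mono[OF _ this] show ?thesis by (simp add: small_part_def)
  qed
  moreover have "small_part m \<nu> T i = 0" if "m \<le> i" for i
  proof (rule ccontr)
    assume "small_part m \<nu> T i \<noteq> 0"
    then have "(i, 0) \<in> cells (small_part m \<nu> T)" by (simp add: cells_def)
    then have "(i, 0) \<in> cells \<nu>" "T (i, 0) < m"
      using cells_small_part[OF assms(3)] by auto
    then show False using ssyt_entry_ge_row[OF assms(1,3)] that by fastforce
  qed
  ultimately show ?thesis by (auto simp: interlacing_def)
qed

lemma interlacing_antimono: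
  assumes "\<mu> \<in> interlacing m \<nu>"
  shows "antimono \<mu>"
proof (rule decseq_SucI)
  fix i show "\<mu> (Suc i) \<le> \<mu> i"
  proof (cases "Suc i < m")
    case True
    then have "\<mu> (Suc i) \<le> \<nu> (Suc i)" "\<nu> (Suc i) \<le> \<mu> i"
      using assms by (auto simp: interlacing_def)
    then show ?thesis by simp
  qed (use assms in \<open>auto simp: interlacing_def\<close>)
qed

lemma interlacing_le: "\<mu> \<in> interlacing m \<nu> \<Longrightarrow> \<mu> i \<le> \<nu> i"
  by (cases "i < m") (auto simp: interlacing_def)

lemma cells_mono: "\<mu> \<in> interlacing m \<nu> \<Longrightarrow> cells \<mu> \<subseteq> cells \<nu>"
  using interlacing_le less_le_trans unfolding cells_def by blast

lemma finite_cells_rows: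
  assumes "\<And>i. m \<le> i \<Longrightarrow> \<nu> i = 0"
  shows "finite (cells \<nu>)" "card (cells \<nu>) = (\<Sum>i<m. \<nu> i)"
proof -
  have eq: "cells \<nu> = (SIGMA i:{..<m}. {..<\<nu> i})"
  proof -
    have "(i, j) \<in> cells \<nu> \<longleftrightarrow> (i, j) \<in> (SIGMA i:{..<m}. {..<\<nu> i})" for i j
      using assms[of i] by (cases "i < m") (auto simp: cells_def)
    then show ?thesis by (simp only: set_eq_iff split_paired_All) blast
  qed
  show "finite (cells \<nu>)" "card (cells \<nu>) = (\<Sum>i<m. \<nu> i)" unfolding eq by auto
qed

lemma finite_interlacing: "finite (interlacing m \<nu>)"
proof -
  have "(\<lambda>\<mu>. restrict \<mu> {..<m}) ` interlacing m \<nu> \<subseteq> PiE {..<m} (\<lambda>i. {..\<nu> i})"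
    by (auto simp: interlacing_def split: if_splits)
  then have "finite ((\<lambda>\<mu>. restrict \<mu> {..<m}) ` interlacing m \<nu>)"
    by (rule finite_subset) (simp add: finite_PiE)
  moreover have "inj_on (\<lambda>\<mu>. restrict \<mu> {..<m}) (interlacing m \<nu>)"
  proof (rule inj_onI, rule ext)
    fix \<mu> \<mu>' i assume "\<mu> \<in> interlacing m \<nu>" "\<mu>' \<in> interlacing m \<nu>" "restrict \<mu> {..<m} = restrict \<mu>' {..<m}"
    then show "\<mu> i = \<mu>' i"
      by (cases "i < m") (auto simp: interlacing_def dest: fun_cong[of _ _ i])
  qed
  ultimately show ?thesis by (rule finite_imageD)
qed

definition extend_tableau :: "nat \<Rightarrow> (nat \<Rightarrow> nat) \<Rightarrow> (nat \<Rightarrow> nat) \<Rightarrow> (nat \<times> nat \<Rightarrow> nat) \<Rightarrow> nat \<times> nat \<Rightarrow> nat" where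
  "extend_tableau m \<nu> \<mu> T = (\<lambda>b\<in>cells \<nu>. if b \<in> cells \<mu> then T b else m)"

lemma extend_tableau_ssyt:
  assumes \<mu>: "\<mu> \<in> interlacing m \<nu>" and T: "T \<in> ssyt m \<mu>" and \<nu>: "\<And>i. m < i \<Longrightarrow> \<nu> i = 0"
  shows "extend_tableau m \<nu> \<mu> T \<in> ssyt (Suc m) \<nu>"
proof -
  have lt: "T b < m" if "b \<in> cells \<mu>" for b
    using T that by (auto simp: ssyt_def)
  have up: "(i, j) \<in> cells \<mu>" if "(Suc i, j) \<in> cells \<nu>" for i j
  proof -
    have "i < m" using \<nu>[of "Suc i"] that by (cases "i < m") (auto simp: cells_def)
    then show ?thesis using \<mu> that less_le_trans by (fastforce simp: interlacing_def cells_def)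
  qed
  have left: "(i, j) \<in> cells \<kappa>" if "(i, Suc j) \<in> cells \<kappa>" for i j \<kappa>
    using that by (simp add: cells_def)
  have sub: "cells \<mu> \<subseteq> cells \<nu>" using cells_mono[OF \<mu>] .
  have "extend_tableau m \<nu> \<mu> T (i, j) \<le> extend_tableau m \<nu> \<mu> T (i, Suc j)"
    if "(i, Suc j) \<in> cells \<nu>" for i j
    using T that left[of i j \<mu>] left[of i j \<nu>] lt[of "(i, j)"]
    by (auto simp: extend_tableau_def ssyt_def)
  moreover have "extend_tableau m \<nu> \<mu> T (i, j) < extend_tableau m \<nu> \<mu> T (Suc i, j)"
    if "(Suc i, j) \<in> cells \<nu>" for i j
    using T that up[OF that] lt[of "(i, j)"] sub
    by (auto simp: extend_tableau_def ssyt_def)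
  moreover have "extend_tableau m \<nu> \<mu> T \<in> cells \<nu> \<rightarrow>\<^sub>E {..<Suc m}"
    unfolding extend_tableau_def using less_SucI[OF lt] by (intro restrict_PiE_iff[THEN iffD2]) auto
  ultimately show ?thesis by (simp add: ssyt_def)
qed

lemma small_part_extend_tableau:
  assumes \<mu>: "\<mu> \<in> interlacing m \<nu>" and T: "T \<in> ssyt m \<mu>"
  shows "small_part m \<nu> (extend_tableau m \<nu> \<mu> T) = \<mu>"
proof
  fix i
  have "T b < m" if "b \<in> cells \<mu>" for b
    using T that by (auto simp: ssyt_def)
  then have "{j. j < \<nu> i \<and> extend_tableau m \<nu> \<mu> T (i, j) < m} = {..<\<mu> i}"
    using interlacing_le[OF \<mu>, of i] by (auto simp: extend_tableau_def cells_def)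
  then show "small_part m \<nu> (extend_tableau m \<nu> \<mu> T) i = \<mu> i"
    by (simp add: small_part_def)
qed

lemma restrict_ssyt:
  assumes \<nu>: "antimono \<nu>" and T0: "T \<in> ssyt (Suc m) \<nu>"
  shows "restrict T (cells (small_part m \<nu> T)) \<in> ssyt m (small_part m \<nu> T)"
proof -
  note c = cells_small_part[OF T0]
  let ?c = "cells (small_part m \<nu> T)"
  have T: "T \<in> cells \<nu> \<rightarrow>\<^sub>E {..<Suc m}"
    "\<And>i j. (i, Suc j) \<in> cells \<nu> \<Longrightarrow> T (i, j) \<le> T (i, Suc j)"
    "\<And>i j. (Suc i, j) \<in> cells \<nu> \<Longrightarrow> T (i, j) < T (Suc i, j)"
    using T0 by (auto simp: ssyt_def)
  have mem: "b \<in> ?c \<longleftrightarrow> b \<in> cells \<nu> \<and> T b < m" for b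
    unfolding c by (cases b) auto
  have "restrict T ?c \<in> ?c \<rightarrow>\<^sub>E {..<m}" by (auto simp: mem)
  moreover have "restrict T ?c (i, j) \<le> restrict T ?c (i, Suc j)" if "(i, Suc j) \<in> ?c" for i j
  proof -
    have "(i, j) \<in> ?c" using that by (simp add: cells_def)
    moreover have "T (i, j) \<le> T (i, Suc j)" using T(2) that mem by blast
    ultimately show ?thesis using that by simp
  qed
  moreover have "restrict T ?c (i, j) < restrict T ?c (Suc i, j)" if "(Suc i, j) \<in> ?c" for i j
  proof -
    have lt: "T (i, j) < T (Suc i, j)" using T(3) that mem by blast
    have "\<nu> (Suc i) \<le> \<nu> i" using \<nu> by (simp add: antimonoD)
    moreover have "(Suc i, j) \<in> cells \<nu>" "T (Suc i, j) < m" using that mem by auto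
    ultimately have "(i, j) \<in> ?c" using lt unfolding mem by (simp add: cells_def)
    then show ?thesis using that lt by simp
  qed
  ultimately show ?thesis unfolding ssyt_def by blast
qed

text \<open>
  Removing the cells with the largest entry \<open>m\<close> is a bijection from tableaux of
  shape \<open>\<nu>\<close> to pairs of an interlacing shape and a tableau on it, with
  \<open>extend_tableau\<close> as inverse. Each removed cell contributes a factor \<open>x
  m\<close>.
\<close>

lemma schur_branching:
  assumes \<nu>: "antimono \<nu>" "\<And>i. m < i \<Longrightarrow> \<nu> i = 0"
  shows "schur (Suc m) \<nu> x =
    (\<Sum>\<mu>\<in>interlacing m \<nu>. schur m \<mu> x * x m ^ ((\<Sum>i\<le>m. \<nu> i) - (\<Sum>i<m. \<mu> i)))"
proof -
  let ?w = "\<lambda>(\<mu>, T). (\<Prod>b\<in>cells \<mu>. x (T b)) * x m ^ ((\<Sum>i\<le>m. \<nu> i) - (\<Sum>i<m. \<mu> i))"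
  have fin\<nu>: "finite (cells \<nu>)" "card (cells \<nu>) = (\<Sum>i\<le>m. \<nu> i)"
    using finite_cells_rows[of "Suc m" \<nu>] \<nu>(2) by (auto simp: lessThan_Suc_atMost)
  have finT: "finite (ssyt m \<mu>)" if "\<mu> \<in> interlacing m \<nu>" for \<mu>
  proof -
    have "finite (cells \<mu>)" using finite_subset[OF cells_mono[OF that]] fin\<nu> by blast
    then show ?thesis by (simp add: ssyt_def finite_PiE)
  qed
  have "schur (Suc m) \<nu> x = sum ?w (SIGMA \<mu>:interlacing m \<nu>. ssyt m \<mu>)"
    unfolding schur_def
  proof (rule sum.reindex_bij_witness[where
        j = "\<lambda>T. (small_part m \<nu> T, restrict T (cells (small_part m \<nu> T)))" and
        i = "\<lambda>(\<mu>, T). extend_tableau m \<nu> \<mu> T"])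
    fix T assume T: "T \<in> ssyt (Suc m) \<nu>"
    note c = cells_small_part[OF T]
    have lt: "T b < Suc m" if "b \<in> cells \<nu>" for b using T that by (auto simp: ssyt_def)
    let ?\<mu> = "small_part m \<nu> T"
    have i\<mu>: "?\<mu> \<in> interlacing m \<nu>" using small_part_interlacing[OF \<nu> T] .
    have T_m: "T b = m" if "b \<in> cells \<nu> - cells ?\<mu>" for b
      using lt[of b] that unfolding c by (cases b) auto
    have "extend_tableau m \<nu> ?\<mu> (restrict T (cells ?\<mu>)) b = T b" for b
      using T_m[of b] T by (auto simp: extend_tableau_def ssyt_def)
    then show "(case (?\<mu>, restrict T (cells ?\<mu>)) of (\<mu>, T) \<Rightarrow> extend_tableau m \<nu> \<mu> T) = T"
      by auto
    show "(?\<mu>, restrict T (cells ?\<mu>)) \<in> (SIGMA \<mu>:interlacing m \<nu>. ssyt m \<mu>)"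
      using i\<mu> restrict_ssyt[OF \<nu>(1) T] by auto
    have sub: "cells ?\<mu> \<subseteq> cells \<nu>" using cells_mono[OF i\<mu>] .
    have card\<mu>: "card (cells ?\<mu>) = (\<Sum>i<m. ?\<mu> i)"
      using finite_cells_rows[of m ?\<mu>] i\<mu> by (auto simp: interlacing_def)
    have "(\<Prod>b\<in>cells \<nu>. x (T b)) = (\<Prod>b\<in>cells \<nu> - cells ?\<mu>. x (T b)) * (\<Prod>b\<in>cells ?\<mu>. x (T b))"
      by (rule prod.subset_diff[OF sub fin\<nu>(1)])
    also have "(\<Prod>b\<in>cells \<nu> - cells ?\<mu>. x (T b)) = (\<Prod>b\<in>cells \<nu> - cells ?\<mu>. x m)"
      using T_m by (intro prod.cong) auto
    also have "\<dots> = x m ^ ((\<Sum>i\<le>m. \<nu> i) - (\<Sum>i<m. ?\<mu> i))"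
      using sub fin\<nu> card\<mu> by (simp add: card_Diff_subset finite_subset)
    finally show "(case (?\<mu>, restrict T (cells ?\<mu>)) of (\<mu>, T) \<Rightarrow>
        (\<Prod>b\<in>cells \<mu>. x (T b)) * x m ^ ((\<Sum>i\<le>m. \<nu> i) - (\<Sum>i<m. \<mu> i))) = (\<Prod>b\<in>cells \<nu>. x (T b))"
      by (simp add: mult.commute)
  next
    fix b assume b: "b \<in> (SIGMA \<mu>:interlacing m \<nu>. ssyt m \<mu>)"
    obtain \<mu> T where [simp]: "b = (\<mu>, T)" by (cases b)
    have \<mu>: "\<mu> \<in> interlacing m \<nu>" and T: "T \<in> ssyt m \<mu>" using b by auto
    note sub = cells_mono[OF \<mu>]
    show "(case b of (\<mu>, T) \<Rightarrow> extend_tableau m \<nu> \<mu> T) \<in> ssyt (Suc m) \<nu>"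
      using extend_tableau_ssyt[OF \<mu> T \<nu>(2)] by simp
    have "restrict (extend_tableau m \<nu> \<mu> T) (cells \<mu>) b = T b" for b
    proof (cases "b \<in> cells \<mu>")
      case True
      then have "b \<in> cells \<nu>" using sub by blast
      then show ?thesis using True by (simp add: extend_tableau_def)
    next
      case False
      have "T \<in> cells \<mu> \<rightarrow>\<^sub>E {..<m}" using T by (simp add: ssyt_def)
      from PiE_arb[OF this False] False show ?thesis by simp
    qed
    then have "restrict (extend_tableau m \<nu> \<mu> T) (cells \<mu>) = T" by blast
    then show "(small_part m \<nu> (case b of (\<mu>, T) \<Rightarrow> extend_tableau m \<nu> \<mu> T),
        restrict (case b of (\<mu>, T) \<Rightarrow> extend_tableau m \<nu> \<mu> T)
         (cells (small_part m \<nu> (case b of (\<mu>, T) \<Rightarrow> extend_tableau m \<nu> \<mu> T)))) = b"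
      by (simp add: small_part_extend_tableau[OF \<mu> T])
  qed
  also have "\<dots> = (\<Sum>\<mu>\<in>interlacing m \<nu>. schur m \<mu> x * x m ^ ((\<Sum>i\<le>m. \<nu> i) - (\<Sum>i<m. \<mu> i)))"
    unfolding schur_def sum_distrib_right
    by (subst sum.Sigma[symmetric]) (use finT in \<open>auto simp: finite_interlacing\<close>)
  finally show ?thesis .
qed

definition vandermonde :: "nat \<Rightarrow> (nat \<Rightarrow> real) \<Rightarrow> real" where
  "vandermonde m x = (\<Prod>j<m. \<Prod>i<j. x i - x j)"

definition alternant :: "nat \<Rightarrow> (nat \<Rightarrow> nat) \<Rightarrow> (nat \<Rightarrow> real) \<Rightarrow> real" where
  "alternant m a x = array_det m (\<lambda>i j. x j ^ a i)"

lemma geometric_interval: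
  fixes x y :: real
  assumes "c \<le> a"
  shows "(x - y) * (\<Sum>b\<in>{c..<a}. x ^ b * y ^ (a - Suc b)) = x ^ a - y ^ (a - c) * x ^ c"
  using assms
proof (induction a rule: dec_induct)
  case (step a)
  let ?S = "\<Sum>b\<in>{c..<a}. x ^ b * y ^ (a - Suc b)"
  have "(\<Sum>b\<in>{c..<a}. x ^ b * y ^ (a - b)) = y * ?S"
    unfolding sum_distrib_left
  proof (intro sum.cong refl)
    fix b assume "b \<in> {c..<a}"
    then have "a - b = Suc (a - Suc b)" by auto
    then show "x ^ b * y ^ (a - b) = y * (x ^ b * y ^ (a - Suc b))" by simp
  qed
  then have "(x - y) * (\<Sum>b\<in>{c..<Suc a}. x ^ b * y ^ (Suc a - Suc b)) = (x - y) * (y * ?S + x ^ a)"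
    using step.hyps by (simp add: sum.atLeastLessThan_Suc)
  also have "\<dots> = y * ((x - y) * ?S) + (x - y) * x ^ a"
    by (simp add: algebra_simps)
  also have "\<dots> = x ^ Suc a - y ^ (Suc a - c) * x ^ c"
    unfolding step.IH using step.hyps by (simp add: algebra_simps Suc_diff_le)
  finally show ?case .
qed simp

text \<open>
  The recursion that the Schur polynomials satisfy, for alternants. Subtracting from each row
  the right multiple of the next one annihilates the last column above its last entry; in column
  \<open>j\<close> the factor \<open>x j - x m\<close> splits off, and the remaining geometric
  sum over the exponents between two successive ones is expanded row by row.
\<close>

lemma alternant_branching:
  assumes dec: "\<And>i. i < m \<Longrightarrow> a (Suc i) \<le> a i"
  shows "alternant (Suc m) a x = (\<Prod>i<m. x i - x m) * x m ^ a m *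
    (\<Sum>b\<in>PiE {..<m} (\<lambda>i. {a (Suc i)..<a i}). alternant m b x * x m ^ (\<Sum>i<m. a i - Suc (b i)))"
proof -
  (* The row operation: row i minus x m ^ (a i - a (i + 1)) times row i + 1. *)
  let ?U = "\<lambda>i l. if i = l then 1 else if l = Suc i then - (x m ^ (a i - a (Suc i))) else (0::real)"
  let ?A = "\<lambda>i j. x j ^ a i"
  let ?S = "\<lambda>i j. \<Sum>b\<in>{a (Suc i)..<a i}. x j ^ b * x m ^ (a i - Suc b)"
  have U: "array_det (Suc m) ?U = 1"
    by (rule array_det_unitriangular) auto
  have UA: "(\<Sum>l<Suc m. ?U i l * ?A l j) =
      (if i < m then (x j - x m) * ?S i j else x j ^ a m)" if "i < Suc m" for i j
  proof (cases "i < m")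
    case True
    have "(\<Sum>l<Suc m. ?U i l * ?A l j) = (\<Sum>l\<in>{i, Suc i}. ?U i l * ?A l j)"
      by (rule sum.mono_neutral_right) (use True in auto)
    also have "\<dots> = x j ^ a i - x m ^ (a i - a (Suc i)) * x j ^ a (Suc i)" by simp
    also have "\<dots> = (x j - x m) * ?S i j" using geometric_interval[OF dec[OF True]] by simp
    finally show ?thesis using True by simp
  next
    case False
    then have [simp]: "i = m" using that by simp
    have "(\<Sum>l<Suc m. ?U i l * ?A l j) = (\<Sum>l\<in>{m}. ?U i l * ?A l j)"
      by (rule sum.mono_neutral_right) auto
    then show ?thesis by simp
  qed
  have "alternant (Suc m) a x = array_det (Suc m) (\<lambda>i j. \<Sum>l<Suc m. ?U i l * ?A l j)"
    unfolding array_det_mult U by (simp add: alternant_def)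
  also have "\<dots> = array_det (Suc m) (\<lambda>i j. if i < m then (x j - x m) * ?S i j else x j ^ a m)"
    by (rule array_det_cong) (rule UA)
  also have "\<dots> = array_det m (\<lambda>i j. (x j - x m) * ?S i j) * x m ^ a m"
    by (subst array_det_last_column) (auto intro: array_det_cong)
  also have "array_det m (\<lambda>i j. (x j - x m) * ?S i j) =
      (\<Prod>j<m. x j - x m) * array_det m ?S"
    by (rule array_det_scale_columns)
  also have "array_det m ?S = (\<Sum>b\<in>PiE {..<m} (\<lambda>i. {a (Suc i)..<a i}).
      array_det m (\<lambda>i j. x j ^ b i * x m ^ (a i - Suc (b i))))"
    by (rule array_det_sum_rows) simp
  also have "\<dots> = (\<Sum>b\<in>PiE {..<m} (\<lambda>i. {a (Suc i)..<a i}).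
      alternant m b x * x m ^ (\<Sum>i<m. a i - Suc (b i)))"
    using array_det_scale_rows[of m "\<lambda>i. x m ^ (a i - Suc (b i))" "\<lambda>i j. x j ^ b i" for b]
    by (simp add: alternant_def power_sum mult.commute)
  finally show ?thesis by (simp add: mult_ac)
qed

text \<open>
  Tableau sums and alternants obey the same recursion in the number of variables: shifting the
  parts of interlacing shapes by the staircase gives exactly the exponents that occur in
  \<open>alternant_branching\<close>.
\<close>

theorem schur_bialternant:
  assumes "antimono \<nu>" "\<And>i. m \<le> i \<Longrightarrow> \<nu> i = 0"
  shows "schur m \<nu> x * vandermonde m x = alternant m (\<lambda>i. \<nu> i + (m - Suc i)) x"
  using assms
proof (induction m arbitrary: \<nu>)
  case 0
  then have "cells \<nu> = {}" by (auto simp: cells_def)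
  then show ?case by (simp add: schur_def ssyt_def vandermonde_def alternant_def)
next
  case (Suc m)
  let ?a = "\<lambda>i. \<nu> i + (m - i)"
  have anti: "\<nu> (Suc i) \<le> \<nu> i" for i using Suc.prems(1) by (simp add: antimonoD)
  have "schur (Suc m) \<nu> x * vandermonde (Suc m) x = (\<Prod>i<m. x i - x m) *
      (\<Sum>\<mu>\<in>interlacing m \<nu>. schur m \<mu> x * vandermonde m x * x m ^ ((\<Sum>i\<le>m. \<nu> i) - (\<Sum>i<m. \<mu> i)))"
    using Suc.prems
    by (subst schur_branching) (auto simp: vandermonde_def sum_distrib_left sum_distrib_right mult_ac)
  also have "(\<Sum>\<mu>\<in>interlacing m \<nu>. schur m \<mu> x * vandermonde m x * x m ^ ((\<Sum>i\<le>m. \<nu> i) - (\<Sum>i<m. \<mu> i))) =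
     (\<Sum>b\<in>PiE {..<m} (\<lambda>i. {?a (Suc i)..<?a i}).
       x m ^ ?a m * (alternant m b x * x m ^ (\<Sum>i<m. ?a i - Suc (b i))))"
  proof (rule sum.reindex_bij_witness[where
        j = "\<lambda>\<mu>. \<lambda>i\<in>{..<m}. \<mu> i + (m - Suc i)" and
        i = "\<lambda>b i. if i < m then b i - (m - Suc i) else 0"])
    fix \<mu> assume \<mu>: "\<mu> \<in> interlacing m \<nu>"
    then have bd: "\<nu> (Suc i) \<le> \<mu> i" "\<mu> i \<le> \<nu> i" if "i < m" for i
      using that by (auto simp: interlacing_def)
    have z: "\<mu> i = 0" if "m \<le> i" for i using \<mu> that by (auto simp: interlacing_def)
    show "(\<lambda>i. if i < m then (\<lambda>i\<in>{..<m}. \<mu> i + (m - Suc i)) i - (m - Suc i) else 0) = \<mu>"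
      using z by auto
    show "(\<lambda>i\<in>{..<m}. \<mu> i + (m - Suc i)) \<in> PiE {..<m} (\<lambda>i. {?a (Suc i)..<?a i})"
    proof (rule PiE_I)
      fix i assume "i \<in> {..<m}"
      then show "(\<lambda>i\<in>{..<m}. \<mu> i + (m - Suc i)) i \<in> {?a (Suc i)..<?a i}"
        using bd[of i] by auto
    qed auto
    have al: "alternant m (\<lambda>i\<in>{..<m}. \<mu> i + (m - Suc i)) x = schur m \<mu> x * vandermonde m x"
      using Suc.IH[OF interlacing_antimono[OF \<mu>] z] unfolding alternant_def
      by (simp cong: array_det_cong)
    have ex: "(\<Sum>i\<le>m. \<nu> i) - (\<Sum>i<m. \<mu> i) = \<nu> m + (\<Sum>i<m. ?a i - Suc (\<mu> i + (m - Suc i)))"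
    proof -
      have "(\<Sum>i<m. ?a i - Suc (\<mu> i + (m - Suc i))) = (\<Sum>i<m. \<nu> i - \<mu> i)"
        by (intro sum.cong) auto
      also have "\<dots> = (\<Sum>i<m. \<nu> i) - (\<Sum>i<m. \<mu> i)"
        by (rule sum_subtractf_nat) (use bd in auto)
      finally have 1: "(\<Sum>i<m. ?a i - Suc (\<mu> i + (m - Suc i))) = (\<Sum>i<m. \<nu> i) - (\<Sum>i<m. \<mu> i)" .
      have 2: "(\<Sum>i<m. \<mu> i) \<le> (\<Sum>i<m. \<nu> i)" by (rule sum_mono) (use bd in auto)
      have 3: "(\<Sum>i\<le>m. \<nu> i) = (\<Sum>i<m. \<nu> i) + \<nu> m"
        by (simp add: lessThan_Suc_atMost[symmetric])
      show ?thesis using 1 2 3 by linarith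
    qed
    have "(\<Sum>i<m. ?a i - Suc ((\<lambda>i\<in>{..<m}. \<mu> i + (m - Suc i)) i)) = (\<Sum>i<m. ?a i - Suc (\<mu> i + (m - Suc i)))"
      by (intro sum.cong) auto
    then show "x m ^ ?a m * (alternant m (\<lambda>i\<in>{..<m}. \<mu> i + (m - Suc i)) x *
         x m ^ (\<Sum>i<m. ?a i - Suc ((\<lambda>i\<in>{..<m}. \<mu> i + (m - Suc i)) i))) =
       schur m \<mu> x * vandermonde m x * x m ^ ((\<Sum>i\<le>m. \<nu> i) - (\<Sum>i<m. \<mu> i))"
      unfolding al ex by (simp add: power_add mult_ac)
  next
    fix b assume b: "b \<in> PiE {..<m} (\<lambda>i. {?a (Suc i)..<?a i})"
    have bd: "\<nu> (Suc i) + (m - Suc i) \<le> b i" "b i < \<nu> i + (m - i)" if "i < m" for i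
      using PiE_mem[OF b, of i] that by simp_all
    have undef: "b i = undefined" if "\<not> i < m" for i
      using PiE_arb[OF b, of i] that by simp
    show "(\<lambda>i\<in>{..<m}. (if i < m then b i - (m - Suc i) else 0) + (m - Suc i)) = b"
    proof
      fix i show "(\<lambda>i\<in>{..<m}. (if i < m then b i - (m - Suc i) else 0) + (m - Suc i)) i = b i"
      proof (cases "i < m")
        case True
        then show ?thesis using bd(1)[of i] by simp
      qed (use undef in simp)
    qed
    show "(\<lambda>i. if i < m then b i - (m - Suc i) else 0) \<in> interlacing m \<nu>"
      unfolding interlacing_def
    proof (intro CollectI conjI allI impI)
      fix i assume i: "i < m"
      show "\<nu> (Suc i) \<le> (if i < m then b i - (m - Suc i) else 0)"
        "(if i < m then b i - (m - Suc i) else 0) \<le> \<nu> i"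
        using bd[OF i] i by simp_all
    qed simp
  qed
  also have "(\<Prod>i<m. x i - x m) * \<dots> = alternant (Suc m) ?a x"
  proof (subst alternant_branching)
    show "?a (Suc i) \<le> ?a i" for i using anti[of i] by simp
  qed (simp add: sum_distrib_left mult_ac)
  finally show ?case by simp
qed

lemma vandermonde_alternant: "vandermonde m x = alternant m (\<lambda>i. m - Suc i) x"
proof -
  have "cells (\<lambda>_. 0) = {}" by (auto simp: cells_def)
  then have "schur m (\<lambda>_. 0) x = 1" by (simp add: schur_def ssyt_def)
  then show ?thesis using schur_bialternant[of "\<lambda>_. 0" m x] by simp
qed

section \<open>Particles, holes and the Laplace expansion\<close>

definition particle :: "nat \<Rightarrow> (nat \<Rightarrow> nat) \<Rightarrow> nat \<Rightarrow> nat" where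
  "particle n \<nu> i = \<nu> i + (n - Suc i)"

text \<open>
  The diagram on which the second Schur polynomial is evaluated. Its \<open>particle\<close>
  positions are the holes of the original diagram.
\<close>

definition dual_diagram :: "nat \<Rightarrow> nat \<Rightarrow> (nat \<Rightarrow> nat) \<Rightarrow> nat \<Rightarrow> nat" where
  "dual_diagram n k \<nu> = Defs.conjugate (rect_complement n k \<nu>)"

lemma particles_eq: "particles n \<nu> = particle n \<nu> ` {..<n}"
  by (simp add: particles_def particle_def)

text \<open>
  The length of a row of the dual diagram is the number of rows of \<open>\<nu>\<close> that are
  too short, and these are the last ones.
\<close>

lemma dual_diagram_eq:
  assumes "\<nu> \<in> young_rect n k" "j < k"
  obtains p where "p \<le> n" "dual_diagram n k \<nu> j = n - p"
    "\<And>i. i < n \<Longrightarrow> i < p \<longleftrightarrow> k - j \<le> \<nu> i"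
proof -
  let ?P = "{i. i < n \<and> k - j \<le> \<nu> i}"
  have anti: "\<nu> i' \<le> \<nu> i" if "i \<le> i'" for i i'
    using assms(1) that by (auto simp: young_rect_def antimonoD)
  obtain p where eq: "?P = {..<p}"
  proof (rule that, rule down_closed_eq_lessThan)
    fix i i' assume "i' \<in> ?P" "i \<le> i'"
    then show "i \<in> ?P" using anti[of i i'] by auto
  qed simp
  then have p: "card ?P = p" by simp
  have "p \<le> n" using card_mono[of "{..<n}" ?P] p by auto
  have "dual_diagram n k \<nu> j = card ({..<n} - ?P)"
    unfolding dual_diagram_def Defs.conjugate_def
  proof (rule bij_betw_same_card[where f = "\<lambda>i. n - Suc i"], rule bij_betw_byWitness[where f' = "\<lambda>i. n - Suc i"])
    show "(\<lambda>i. n - Suc i) ` {i. j < rect_complement n k \<nu> i} \<subseteq> {..<n} - ?P"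
      by (auto simp: rect_complement_def split: if_splits)
    show "(\<lambda>i. n - Suc i) ` ({..<n} - ?P) \<subseteq> {i. j < rect_complement n k \<nu> i}"
      using assms(2) by (auto simp: rect_complement_def)
  qed (auto simp: rect_complement_def split: if_splits)
  also have "\<dots> = n - card ?P" by (subst card_Diff_subset) auto
  finally have d: "dual_diagram n k \<nu> j = n - p" unfolding p .
  have "i < p \<longleftrightarrow> k - j \<le> \<nu> i" if "i < n" for i
    using eqset_imp_iff[OF eq, of i] that by simp
  from that[OF \<open>p \<le> n\<close> d this] show thesis .
qed

lemma dual_diagram_antimono: 
  assumes "\<nu> \<in> young_rect n k"
  shows "antimono (dual_diagram n k \<nu>)" "\<And>j. k \<le> j \<Longrightarrow> dual_diagram n k \<nu> j = 0"
    "\<And>j. dual_diagram n k \<nu> j \<le> n"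
proof -
  have fin: "finite {i. j < rect_complement n k \<nu> i}" for j
    by (rule finite_subset[of _ "{..<n}"]) (auto simp: rect_complement_def split: if_splits)
  show "antimono (dual_diagram n k \<nu>)"
    unfolding dual_diagram_def Defs.conjugate_def by (intro antimonoI card_mono fin) auto
  show "dual_diagram n k \<nu> j = 0" if "k \<le> j" for j
  proof -
    have "{i. j < rect_complement n k \<nu> i} = {}"
      using that by (auto simp: rect_complement_def)
    then show ?thesis by (simp add: dual_diagram_def Defs.conjugate_def)
  qed
  show "dual_diagram n k \<nu> j \<le> n" for j
    unfolding dual_diagram_def Defs.conjugate_def
    using card_mono[of "{..<n}" "{i. j < rect_complement n k \<nu> i}"]
    by (force simp: rect_complement_def split: if_splits)
qed

lemma particle_strict:
  assumes "antimono \<nu>" "i < j" "j < n"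
  shows "particle n \<nu> j < particle n \<nu> i"
  using antimonoD[OF assms(1), of i j] assms(2,3) unfolding particle_def by linarith

lemma particle_less:
  assumes "\<nu> \<in> young_rect n k" "i < n"
  shows "particle n \<nu> i < n + k"
proof -
  have "\<nu> i \<le> k" using assms(1) by (simp add: young_rect_def)
  then show ?thesis using assms(2) by (simp add: particle_def)
qed

lemma particle_neq_hole:
  assumes "\<nu> \<in> young_rect n k" "i < n" "j < k"
  shows "particle n \<nu> i \<noteq> particle k (dual_diagram n k \<nu>) j"
proof -
  obtain p where p: "p \<le> n" "dual_diagram n k \<nu> j = n - p"
    "\<And>i. i < n \<Longrightarrow> i < p \<longleftrightarrow> k - j \<le> \<nu> i"
    using dual_diagram_eq[OF assms(1,3)] by blast
  have hole: "particle k (dual_diagram n k \<nu>) j < (n - p) + (k - j)"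
    "(n - p) + (k - j) \<le> Suc (particle k (dual_diagram n k \<nu>) j)"
    using p(2) assms(3) by (simp_all add: particle_def)
  show ?thesis
  proof (cases "i < p")
    case True
    then have "k - j \<le> \<nu> i" "n - p \<le> n - Suc i" using p(3)[OF assms(2)] by simp_all
    then show ?thesis using hole(1) unfolding particle_def by linarith
  next
    case False
    then have "\<nu> i < k - j" "n - Suc i < n - p" using p(3)[OF assms(2)] assms(2) by simp_all
    then show ?thesis using hole(2) unfolding particle_def by linarith
  qed
qed

text \<open>
  First the particles, then the holes, both in decreasing order.
\<close>

definition young_perm :: "nat \<Rightarrow> nat \<Rightarrow> (nat \<Rightarrow> nat) \<Rightarrow> nat \<Rightarrow> nat" where
  "young_perm n k \<nu> r = (if r < n then particle n \<nu> r
     else if r < n + k then particle k (dual_diagram n k \<nu>) (r - n) else r)"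

lemma young_perm_permutes:
  assumes "\<nu> \<in> young_rect n k"
  shows "young_perm n k \<nu> permutes {..<n + k}"
proof (rule bij_imp_permutes)
  let ?p = "young_perm n k \<nu>" and ?d = "dual_diagram n k \<nu>"
  have anti: "antimono \<nu>" using assms by (simp add: young_rect_def)
  note dual = dual_diagram_antimono[OF assms]
  have neq: "?p r \<noteq> ?p s" if "r < s" "s < n + k" for r s
  proof -
    consider "s < n" | "r < n" "n \<le> s" | "n \<le> r" by linarith
    then show ?thesis
    proof cases
      case 1
      then show ?thesis using that particle_strict[OF anti, of r s n] by (simp add: young_perm_def)
    next
      case 2
      then show ?thesis using that particle_neq_hole[OF assms, of r "s - n"]
        by (simp add: young_perm_def)
    next
      case 3
      then have "r - n < s - n" "s - n < k" using that by linarith+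
      from particle_strict[OF dual(1) this] show ?thesis
        using 3 that by (simp add: young_perm_def)
    qed
  qed
  have inj: "inj_on ?p {..<n + k}"
    by (rule linorder_inj_onI') (use neq in auto)
  have "?d \<in> young_rect k n" using dual by (simp add: young_rect_def)
  then have "?p ` {..<n + k} \<subseteq> {..<n + k}"
    using particle_less[OF assms] particle_less[of ?d k n]
    by (auto simp: young_perm_def add.commute)
  then show "bij_betw ?p {..<n + k} {..<n + k}"
    using inj by (simp add: bij_betw_def endo_inj_surj)
qed (simp add: young_perm_def)

lemma vandermonde_permute:
  assumes "p permutes {..<m}"
  shows "vandermonde m (x \<circ> p) = of_int (sign p) * vandermonde m x"
proof -
  have "vandermonde m (x \<circ> p) = array_det m (\<lambda>i j. (x \<circ> p) i ^ (m - Suc j))"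
    unfolding vandermonde_alternant alternant_def
    using array_det_transpose[of m "\<lambda>i j. (x \<circ> p) j ^ (m - Suc i)"] by simp
  also have "\<dots> = of_int (sign p) * array_det m (\<lambda>i j. x i ^ (m - Suc j))"
    using array_det_permute_rows[OF assms, of "\<lambda>i j. x i ^ (m - Suc j)"] by simp
  also have "array_det m (\<lambda>i j. x i ^ (m - Suc j)) = vandermonde m x"
    unfolding vandermonde_alternant alternant_def
    using array_det_transpose[of m "\<lambda>i j. x j ^ (m - Suc i)"] by simp
  finally show ?thesis .
qed

lemma sgn_prod_real: "sgn (prod f A) = (\<Prod>a\<in>A. sgn (f a :: real))"
  by (induction A rule: infinite_finite_induct) (auto simp: sgn_mult)

lemma vandermonde_split:
  "vandermonde (n + k) x = vandermonde n x * vandermonde k (\<lambda>j. x (n + j)) * (\<Prod>i<n. \<Prod>j<k. x i - x (n + j))"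
proof (induction k)
  case (Suc k)
  have "(\<Prod>i<n + k. f i) = (\<Prod>i<n. f i) * (\<Prod>j<k. f (n + j))" for f :: "nat \<Rightarrow> real"
    by (induction k) (auto simp: mult_ac)
  from this[of "\<lambda>i. x i - x (n + k)"]
  have "(\<Prod>i<n + k. x i - x (n + k)) = (\<Prod>i<n. x i - x (n + k)) * (\<Prod>j<k. x (n + j) - x (n + k))" .
  then show ?case
    using Suc.IH by (simp add: vandermonde_def prod.distrib mult_ac)
qed (simp add: vandermonde_def)

lemma minus_one_power_mult_self: "(-1::real) ^ i * (-1) ^ i = 1"
  by (simp add: minus_one_power_iff)

lemma sgn_above_product:
  assumes "a < N"
  shows "(\<Prod>c\<in>{..<N} - {a}. sgn (real a - real c)) = (-1) ^ (N - Suc a)"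
proof -
  have "{..<N} - {a} = {..<a} \<union> {Suc a..<N}" using assms by auto
  moreover have dj: "{..<a} \<inter> {Suc a..<N} = {}" by auto
  ultimately have "(\<Prod>c\<in>{..<N} - {a}. sgn (real a - real c)) =
      (\<Prod>c\<in>{..<a}. sgn (real a - real c)) * (\<Prod>c\<in>{Suc a..<N}. sgn (real a - real c))"
    by (simp only: prod.union_disjoint[OF finite_lessThan finite_atLeastLessThan])
  also have "(\<Prod>c\<in>{..<a}. sgn (real a - real c)) = 1" by (intro prod.neutral) auto
  also have "(\<Prod>c\<in>{Suc a..<N}. sgn (real a - real c)) = (\<Prod>c\<in>{Suc a..<N}. -1)"
    by (intro prod.cong) auto
  finally show ?thesis by simp
qed

text \<open>
  The part of the sign in the Laplace expansion that is common to all diagrams. The sign of the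
  Vandermonde product of \<open>0, 1, \<dots>\<close> is left unevaluated, since only the square
  of this constant is ever needed.
\<close>

definition laplace_sign :: "nat \<Rightarrow> nat \<Rightarrow> real" where
  "laplace_sign n k = sgn (vandermonde (n + k) real) * (-1) ^ (n * (n + k - 1) + \<Sum>{..<n} + \<Sum>{..<n + k})"

text \<open>
  Among all differences between the position of particle \<open>i\<close> and other positions,
  the negative ones belong to the larger positions. The first \<open>i\<close> particles account
  for \<open>i\<close> of these, and the others are holes.
\<close>

lemma particle_hole_sign:
  assumes \<nu>: "\<nu> \<in> young_rect n k" and i: "i < n"
  shows "(\<Prod>j<k. sgn (real (particle n \<nu> i) - real (particle k (dual_diagram n k \<nu>) j))) =
    (-1) ^ (n + k - 1 + particle n \<nu> i + i)"
proof -
  let ?p = "young_perm n k \<nu>" and ?N = "n + k" and ?a = "particle n \<nu>"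
  have anti: "antimono \<nu>" using \<nu> by (simp add: young_rect_def)
  note perm = young_perm_permutes[OF \<nu>]
  have "(-1) ^ (?N - Suc (?a i)) = (\<Prod>c\<in>{..<?N} - {?p i}. sgn (real (?a i) - real c))"
    using sgn_above_product[OF particle_less[OF \<nu> i]] i by (simp add: young_perm_def)
  also have "{..<?N} - {?p i} = ?p ` ({..<?N} - {i})"
    using permutes_image[OF perm] permutes_inj_on[OF perm] i
    by (subst inj_on_image_set_diff[of _ "{..<?N}"]) auto
  also have "(\<Prod>c\<in>?p ` ({..<?N} - {i}). sgn (real (?a i) - real c)) =
      (\<Prod>r\<in>{..<?N} - {i}. sgn (real (?a i) - real (?p r)))"
    using permutes_inj_on[OF perm] by (subst prod.reindex) (auto intro: inj_on_subset)
  also have "{..<?N} - {i} = ({..<n} - {i}) \<union> {n..<?N}" using i by auto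
  also have "(\<Prod>r\<in>({..<n} - {i}) \<union> {n..<?N}. sgn (real (?a i) - real (?p r))) =
      (\<Prod>r\<in>{..<n} - {i}. sgn (real (?a i) - real (?p r))) * (\<Prod>r\<in>{n..<?N}. sgn (real (?a i) - real (?p r)))"
    by (rule prod.union_disjoint) auto
  also have "(\<Prod>r\<in>{n..<?N}. sgn (real (?a i) - real (?p r))) =
      (\<Prod>j<k. sgn (real (?a i) - real (particle k (dual_diagram n k \<nu>) j)))"
    by (rule prod.reindex_bij_witness[where i = "\<lambda>j. n + j" and j = "\<lambda>r. r - n"])
      (auto simp: young_perm_def)
  also have "(\<Prod>r\<in>{..<n} - {i}. sgn (real (?a i) - real (?p r))) = (-1) ^ i"
  proof -
    have "{..<n} - {i} = {..<i} \<union> {Suc i..<n}" using i by auto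
    moreover have "{..<i} \<inter> {Suc i..<n} = {}" by auto
    ultimately have "(\<Prod>r\<in>{..<n} - {i}. sgn (real (?a i) - real (?p r))) =
        (\<Prod>r\<in>{..<i}. sgn (real (?a i) - real (?p r))) * (\<Prod>r\<in>{Suc i..<n}. sgn (real (?a i) - real (?p r)))"
      by (simp only: prod.union_disjoint[OF finite_lessThan finite_atLeastLessThan])
    also have "(\<Prod>r\<in>{..<i}. sgn (real (?a i) - real (?p r))) = (\<Prod>r\<in>{..<i}. -1)"
      using particle_strict[OF anti, of _ i n] i by (intro prod.cong) (auto simp: young_perm_def)
    also have "(\<Prod>r\<in>{Suc i..<n}. sgn (real (?a i) - real (?p r))) = 1"
      using particle_strict[OF anti, of i _ n] i by (intro prod.neutral) (auto simp: young_perm_def)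
    finally show ?thesis by simp
  qed
  finally have *: "(-1) ^ (?N - Suc (?a i)) = (-1) ^ i * (\<Prod>j<k. sgn (real (?a i) - real (particle k (dual_diagram n k \<nu>) j)))" .
  have "(-1::real) ^ (?N - Suc (?a i)) = (-1) ^ (?N - 1 + ?a i)"
    using particle_less[OF \<nu> i] by (intro minus_one_power_iff[THEN trans]) (auto simp: minus_one_power_iff)
  then have "(-1) ^ i * (-1::real) ^ (?N - 1 + ?a i) = (-1) ^ i * ((-1) ^ i * (\<Prod>j<k. sgn (real (?a i) - real (particle k (dual_diagram n k \<nu>) j))))"
    using * by simp
  also have "\<dots> = (\<Prod>j<k. sgn (real (?a i) - real (particle k (dual_diagram n k \<nu>) j)))"
    by (simp add: minus_one_power_mult_self flip: mult.assoc)
  finally show ?thesis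
    by (simp only: power_add mult_ac)
qed

lemma particle_hole_sum:
  assumes \<nu>: "\<nu> \<in> young_rect n k"
  shows "(\<Sum>i<n. particle n \<nu> i) + (\<Sum>j<k. particle k (dual_diagram n k \<nu>) j) = \<Sum>{..<n + k}"
proof -
  let ?p = "young_perm n k \<nu>"
  have "\<Sum>{..<n + k} = (\<Sum>r<n + k. ?p r)"
    using sum.permute[OF young_perm_permutes[OF \<nu>], of "\<lambda>x. x"] by (simp add: comp_def)
  also have "\<dots> = (\<Sum>r\<in>{..<n} \<union> {n..<n + k}. ?p r)" by (rule sum.cong) auto
  also have "(\<Sum>r\<in>{..<n} \<union> {n..<n + k}. ?p r) = (\<Sum>r<n. ?p r) + (\<Sum>r\<in>{n..<n+k}. ?p r)"
    by (rule sum.union_disjoint) auto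
  also have "(\<Sum>r\<in>{n..<n+k}. ?p r) = (\<Sum>j<k. particle k (dual_diagram n k \<nu>) j)"
    by (rule sum.reindex_bij_witness[where i = "\<lambda>j. n + j" and j = "\<lambda>r. r - n"])
      (auto simp: young_perm_def)
  finally show ?thesis by (simp add: young_perm_def)
qed

lemma vandermonde_strict_decreasing:
  assumes "\<And>i j. i < j \<Longrightarrow> j < m \<Longrightarrow> x j < x i"
  shows "0 < vandermonde m x"
  unfolding vandermonde_def using assms by (auto intro!: prod_pos)

lemma vandermonde_nonzero:
  assumes "inj_on x {..<m}"
  shows "vandermonde m x \<noteq> 0"
  using assms unfolding vandermonde_def by (auto dest!: inj_onD)

text \<open>
  The sign of a permutation is the sign by which it changes a Vandermonde product. In the
  Vandermonde product of the permuted positions only the factors between a particle and a hole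
  can be negative.
\<close>

lemma sign_young_perm:
  assumes \<nu>: "\<nu> \<in> young_rect n k"
  shows "of_int (sign (young_perm n k \<nu>)) =
    laplace_sign n k * (-1) ^ (\<Sum>j<k. particle k (dual_diagram n k \<nu>) j)"
proof -
  let ?p = "young_perm n k \<nu>" and ?N = "n + k"
  let ?a = "particle n \<nu>" and ?b = "particle k (dual_diagram n k \<nu>)"
  let ?s = "sgn (vandermonde ?N real)"
  have anti: "antimono \<nu>" using \<nu> by (simp add: young_rect_def)
  have s: "?s * ?s = 1"
    using vandermonde_nonzero[of real ?N] by (auto simp: sgn_if inj_on_def)
  have "sgn (vandermonde ?N (real \<circ> ?p)) = of_int (sign ?p) * ?s"
    using vandermonde_permute[OF young_perm_permutes[OF \<nu>], of real]
    by (simp add: sgn_mult sign_def)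
  also have "sgn (vandermonde ?N (real \<circ> ?p)) = sgn (\<Prod>i<n. \<Prod>j<k. real (?a i) - real (?b j))"
  proof -
    have 1: "0 < vandermonde n (real \<circ> ?p)"
      using particle_strict[OF anti] by (intro vandermonde_strict_decreasing) (auto simp: young_perm_def)
    have 2: "0 < vandermonde k (\<lambda>j. (real \<circ> ?p) (n + j))"
      using particle_strict[OF dual_diagram_antimono(1)[OF \<nu>]]
      by (intro vandermonde_strict_decreasing) (auto simp: young_perm_def)
    show ?thesis
      unfolding vandermonde_split using 1 2 by (simp add: sgn_mult young_perm_def)
  qed
  also have "\<dots> = (\<Prod>i<n. (-1) ^ (?N - 1 + ?a i + i))"
    unfolding sgn_prod_real using particle_hole_sign[OF \<nu>] by (intro prod.cong) auto
  also have "\<dots> = (-1) ^ (n * (?N - 1) + \<Sum>{..<n} + (\<Sum>i<n. ?a i))"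
  proof -
    have "(\<Sum>i<n. M + ?a i + i) = n * M + \<Sum>{..<n} + (\<Sum>i<n. ?a i)" for M
      by (simp add: sum.distrib)
    from this[of "?N - 1"] show ?thesis unfolding power_sum[symmetric] by (simp only:)
  qed
  finally have "of_int (sign ?p) * ?s * ?s =
      ?s * (-1) ^ (n * (?N - 1) + \<Sum>{..<n} + (\<Sum>i<n. ?a i))" by simp
  moreover have "(-1::real) ^ (\<Sum>i<n. ?a i) = (-1) ^ \<Sum>{..<?N} * (-1) ^ (\<Sum>j<k. ?b j)"
    unfolding particle_hole_sum[OF \<nu>, symmetric]
    unfolding power_add mult.assoc minus_one_power_mult_self by simp
  ultimately show ?thesis
    using s unfolding laplace_sign_def power_add mult.assoc by simp
qed

lemma laplace_sign_square: "laplace_sign n k * laplace_sign n k = 1"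
proof -
  let ?s = "sgn (vandermonde (n + k) real)"
  have "?s * ?s = 1"
    using vandermonde_nonzero[of real "n + k"] by (auto simp: sgn_if inj_on_def)
  then show ?thesis
    unfolding laplace_sign_def by (auto simp: minus_one_power_iff)
qed

text \<open>
  The variables of the second Schur polynomial enter with the opposite sign: this is what makes
  one determinant out of the two alternants, since the parity of the sum of the holes is part of
  the sign of a Laplace expansion.
\<close>

definition node :: "nat \<Rightarrow> (nat \<Rightarrow> real) \<Rightarrow> (nat \<Rightarrow> real) \<Rightarrow> nat \<Rightarrow> real" where
  "node n x y r = (if r < n then x r else - y (r - n))"

text \<open>
  Both Schur polynomials are alternants, one with the particles and one with the holes as
  exponents. Their product is the determinant of a block matrix; undoing the permutation
  \<open>young_perm\<close> of its columns leaves the terms of the full power matrix in which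
  the first \<open>n\<close> rows use exactly the columns of the particles.
\<close>

lemma schur_pair_alternant:
  assumes \<nu>: "\<nu> \<in> young_rect n k"
  shows "schur n \<nu> x * schur k (dual_diagram n k \<nu>) y * (vandermonde n x * vandermonde k y) =
    laplace_sign n k * (\<Sum>p | p permutes {..<n + k} \<and> p ` {..<n} = particles n \<nu>.
      of_int (sign p) * (\<Prod>r<n + k. node n x y r ^ p r))"
proof -
  let ?N = "n + k" and ?q = "young_perm n k \<nu>" and ?S = "particles n \<nu>"
  let ?a = "particle n \<nu>" and ?b = "particle k (dual_diagram n k \<nu>)"
  (* The power matrix with all entries deleted that would pair an x with a hole or a y with a
     particle. *)
  let ?M = "\<lambda>r c. if r < n \<longleftrightarrow> c \<in> ?S then node n x y r ^ c else 0"
  let ?e = "(-1::real) ^ (\<Sum>j<k. ?b j)"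
  have \<nu>': "antimono \<nu>" "\<And>i. n \<le> i \<Longrightarrow> \<nu> i = 0" using \<nu> by (auto simp: young_rect_def)
  note q = young_perm_permutes[OF \<nu>]
  have S: "?q ` {..<n} = ?S" by (auto simp: particles_eq young_perm_def)
  have qS: "?q c \<in> ?S \<longleftrightarrow> c < n" for c
    using permutes_inj[OF q] unfolding S[symmetric] by (auto dest: injD)
  have SN: "?S \<subseteq> {..<?N}" using particle_less[OF \<nu>] by (auto simp: particles_eq)
  have "schur n \<nu> x * schur k (dual_diagram n k \<nu>) y * (vandermonde n x * vandermonde k y) =
      (schur n \<nu> x * vandermonde n x) * (schur k (dual_diagram n k \<nu>) y * vandermonde k y)"
    by (simp add: mult_ac)
  also have "\<dots> = alternant n ?a x * alternant k ?b y"
    using schur_bialternant[OF \<nu>'] schur_bialternant[OF dual_diagram_antimono(1,2)[OF \<nu>]]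
    unfolding particle_def[abs_def] by simp
  also have "alternant k ?b y = ?e * array_det k (\<lambda>i j. (- y j) ^ ?b i)"
  proof -
    have "array_det k (\<lambda>i j. (- y j) ^ ?b i) = array_det k (\<lambda>i j. (-1) ^ ?b i * y j ^ ?b i)"
      using power_mult_distrib[of "-1" "y j" "?b i" for i j] by (intro array_det_cong) simp
    also have "\<dots> = ?e * alternant k ?b y"
      unfolding array_det_scale_rows alternant_def power_sum ..
    finally show ?thesis by (simp flip: mult.assoc power_mult_distrib)
  qed
  also have "alternant n ?a x * (?e * array_det k (\<lambda>i j. (- y j) ^ ?b i)) =
      ?e * array_det ?N (\<lambda>r c. ?M r (?q c))"
  proof -
    have "array_det ?N (\<lambda>r c. ?M r (?q c)) = array_det n (\<lambda>r c. ?M r (?q c)) *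
        array_det k (\<lambda>r c. ?M (n + r) (?q (n + c)))"
      by (rule array_det_block) (auto simp: qS)
    also have "array_det n (\<lambda>r c. ?M r (?q c)) = array_det n (\<lambda>r c. x r ^ ?a c)"
      by (rule array_det_cong) (simp only: qS, simp add: node_def young_perm_def)
    also have "array_det n (\<lambda>r c. x r ^ ?a c) = alternant n ?a x"
      unfolding alternant_def by (rule array_det_transpose)
    also have "array_det k (\<lambda>r c. ?M (n + r) (?q (n + c))) = array_det k (\<lambda>r c. (- y r) ^ ?b c)"
      by (rule array_det_cong) (simp only: qS, simp add: node_def young_perm_def)
    also have "\<dots> = array_det k (\<lambda>i j. (- y j) ^ ?b i)"
      by (rule array_det_transpose)
    finally show ?thesis by simp
  qed
  also have "array_det ?N (\<lambda>r c. ?M r (?q c)) = of_int (sign ?q) * array_det ?N ?M"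
    using array_det_permute_rows[OF q, of "\<lambda>c r. ?M r c"] array_det_transpose[of ?N ?M]
      array_det_transpose[of ?N "\<lambda>r c. ?M r (?q c)"] by simp
  also have "?e * (of_int (sign ?q) * array_det ?N ?M) = laplace_sign n k * array_det ?N ?M"
    unfolding sign_young_perm[OF \<nu>] by (simp add: mult_ac flip: mult.assoc power_mult_distrib)
  also have "array_det ?N ?M = (\<Sum>p | p permutes {..<?N} \<and> p ` {..<n} = ?S.
      of_int (sign p) * (\<Prod>r<?N. ?M r (p r)))"
    unfolding array_det_leibniz
  proof (rule sum.mono_neutral_right)
    show "\<forall>p\<in>{p. p permutes {..<?N}} - {p. p permutes {..<?N} \<and> p ` {..<n} = ?S}.
        of_int (sign p) * (\<Prod>r<?N. ?M r (p r)) = 0"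
    proof
      fix p assume "p \<in> {p. p permutes {..<?N}} - {p. p permutes {..<?N} \<and> p ` {..<n} = ?S}"
      then have p: "p permutes {..<?N}" "p ` {..<n} \<noteq> ?S" by auto
      have "\<exists>r<?N. \<not> (r < n \<longleftrightarrow> p r \<in> ?S)"
      proof (rule ccontr)
        assume "\<not> ?thesis"
        then have iff: "r < n \<longleftrightarrow> p r \<in> ?S" if "r < ?N" for r using that by blast
        have "s \<in> p ` {..<n}" if "s \<in> ?S" for s
        proof -
          have "s \<in> p ` {..<?N}" using permutes_image[OF p(1)] SN that by blast
          then show ?thesis using iff that by auto
        qed
        moreover have "p r \<in> ?S" if "r < n" for r using iff[of r] that by simp
        ultimately have "p ` {..<n} = ?S" by auto
        then show False using p(2) by blast
      qed
      then have "(\<Prod>r<?N. ?M r (p r)) = 0" by (intro prod_zero) auto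
      then show "of_int (sign p) * (\<Prod>r<?N. ?M r (p r)) = 0" by simp
    qed
  qed (auto simp: finite_permutations)
  also have "\<dots> = (\<Sum>p | p permutes {..<?N} \<and> p ` {..<n} = ?S.
      of_int (sign p) * (\<Prod>r<?N. node n x y r ^ p r))"
  proof (intro sum.cong refl arg_cong2[where f = "(*)"] prod.cong)
    fix p r assume p: "p \<in> {p. p permutes {..<?N} \<and> p ` {..<n} = ?S}"
    then have "inj p" "p ` {..<n} = ?S" by (auto simp: permutes_inj)
    then have "r < n \<longleftrightarrow> p r \<in> ?S" using inj_image_mem_iff[of p r "{..<n}"] by simp
    then show "?M r (p r) = node n x y r ^ p r" by simp
  qed
  finally show ?thesis .
qed

lemma strictly_decreasing_eq_sorted_list:
  fixes a :: "nat \<Rightarrow> nat"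
  assumes "\<And>i j. i < j \<Longrightarrow> j < n \<Longrightarrow> a j < a i"
  shows "map (\<lambda>i. a (n - Suc i)) [0..<n] = sorted_list_of_set (a ` {..<n})"
proof -
  have s: "sorted_wrt (<) (map (\<lambda>i. a (n - Suc i)) [0..<n])"
    using assms by (auto simp: sorted_wrt_iff_nth_less)
  have "set (map (\<lambda>i. a (n - Suc i)) [0..<n]) = a ` {..<n}"
  proof -
    have "a i \<in> (\<lambda>i. a (n - Suc i)) ` {0..<n}" if "i < n" for i
      using that by (intro image_eqI[of _ _ "n - Suc i"]) auto
    then show ?thesis by auto
  qed
  then show ?thesis
    using sorted_list_of_set.idem_if_sorted_distinct s strict_sorted_iff by metis
qed

lemma inj_on_particles: "inj_on (particles n) (young_rect n k)"
proof (rule inj_onI, rule ext)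
  fix \<nu> \<kappa> i
  assume \<nu>: "\<nu> \<in> young_rect n k" and \<kappa>: "\<kappa> \<in> young_rect n k" and eq: "particles n \<nu> = particles n \<kappa>"
  have "map (\<lambda>i. particle n \<nu> (n - Suc i)) [0..<n] = map (\<lambda>i. particle n \<kappa> (n - Suc i)) [0..<n]"
    using \<nu> \<kappa> eq particle_strict
    by (subst (1 2) strictly_decreasing_eq_sorted_list) (auto simp: young_rect_def particles_eq)
  then have *: "particle n \<nu> (n - Suc i) = particle n \<kappa> (n - Suc i)" if "i < n" for i
    using that by (auto simp: list_eq_iff_nth_eq)
  show "\<nu> i = \<kappa> i"
  proof (cases "i < n")
    case True
    then show ?thesis using *[of "n - Suc i"] by (simp add: particle_def)
  qed (use \<nu> \<kappa> in \<open>simp add: young_rect_def\<close>)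
qed

text \<open>
  Sorting the set and subtracting the staircase recovers the diagram.
\<close>

lemma particles_surj:
  assumes "S \<subseteq> {..<n + k}" "card S = n"
  shows "S \<in> particles n ` young_rect n k"
proof -
  have fin: "finite S" using assms(1) finite_subset by blast
  define l where "l = sorted_list_of_set S"
  have l: "sorted_wrt (<) l" "set l = S" "length l = n"
    using fin assms(2) by (auto simp: l_def)
  have step: "l ! i + (j - i) \<le> l ! j" if "i \<le> j" "j < n" for i j
    using that
  proof (induction j rule: dec_induct)
    case (step j)
    then have "l ! j < l ! Suc j" using l by (auto simp: sorted_wrt_iff_nth_less)
    then show ?case using step by simp
  qed simp
  have low: "j \<le> l ! j" if "j < n" for j using step[of 0 j] that by simp
  have high: "l ! j \<le> k + j" if "j < n" for j
  proof -
    have "l ! (n - 1) \<in> S" using that l nth_mem[of "n - 1" l] by simp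
    then have "l ! (n - 1) < n + k" using assms(1) by auto
    moreover have "l ! j + (n - 1 - j) \<le> l ! (n - 1)" using step[of j "n - 1"] that by simp
    ultimately show ?thesis using that by linarith
  qed
  define \<nu> where "\<nu> i = (if i < n then l ! (n - Suc i) - (n - Suc i) else 0)" for i
  have "\<nu> j \<le> \<nu> i" if "i \<le> j" for i j
  proof (cases "j < n")
    case True
    then have "l ! (n - Suc j) + (j - i) \<le> l ! (n - Suc i)"
      using step[of "n - Suc j" "n - Suc i"] that by simp
    then show ?thesis using True that by (simp add: \<nu>_def)
  qed (simp add: \<nu>_def)
  moreover have "\<nu> i \<le> k" for i using high[of "n - Suc i"] by (auto simp: \<nu>_def)
  ultimately have "\<nu> \<in> young_rect n k"
    unfolding young_rect_def by (auto simp: \<nu>_def intro!: antimonoI)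
  moreover have "particles n \<nu> = S"
  proof -
    have "particle n \<nu> i = l ! (n - Suc i)" if "i < n" for i
      using low[of "n - Suc i"] that by (simp add: particle_def \<nu>_def)
    then have "particles n \<nu> = (\<lambda>i. l ! (n - Suc i)) ` {..<n}" by (auto simp: particles_eq)
    also have "\<dots> = (\<lambda>i. l ! i) ` {..<n}"
    proof -
      have "l ! i \<in> (\<lambda>i. l ! (n - Suc i)) ` {..<n}" if "i < n" for i
        using that by (intro image_eqI[of _ _ "n - Suc i"]) auto
      then show ?thesis by auto
    qed
    also have "\<dots> = S" using l by (auto simp: set_conv_nth)
    finally show ?thesis .
  qed
  ultimately show ?thesis by blast
qed

text \<open>
  Every permutation sends the first \<open>n\<close> rows to the particle set of exactly one
  diagram, so summing the Laplace terms over all diagrams gives every permutation once.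
\<close>

theorem schur_pair_sum:
  "(\<Sum>\<nu>\<in>young_rect n k. schur n \<nu> x * schur k (dual_diagram n k \<nu>) y * \<Phi> (particles n \<nu>)) *
     (vandermonde n x * vandermonde k y) =
   laplace_sign n k * (\<Sum>p | p permutes {..<n + k}.
     of_int (sign p) * (\<Prod>r<n + k. node n x y r ^ p r) * \<Phi> (p ` {..<n}))"
proof -
  let ?t = "\<lambda>p. of_int (sign p) * (\<Prod>r<n + k. node n x y r ^ p r) * \<Phi> (p ` {..<n})"
  have "(\<Sum>\<nu>\<in>young_rect n k. schur n \<nu> x * schur k (dual_diagram n k \<nu>) y * \<Phi> (particles n \<nu>)) *
     (vandermonde n x * vandermonde k y) =
    (\<Sum>\<nu>\<in>young_rect n k. laplace_sign n k * (\<Sum>p | p permutes {..<n + k} \<and> p ` {..<n} = particles n \<nu>. ?t p))"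
    unfolding sum_distrib_right
  proof (rule sum.cong[OF refl])
    fix \<nu> assume "\<nu> \<in> young_rect n k"
    from schur_pair_alternant[OF this, of x y]
    have "schur n \<nu> x * schur k (dual_diagram n k \<nu>) y * \<Phi> (particles n \<nu>) * (vandermonde n x * vandermonde k y) =
       laplace_sign n k * (\<Sum>p | p permutes {..<n + k} \<and> p ` {..<n} = particles n \<nu>.
      of_int (sign p) * (\<Prod>r<n + k. node n x y r ^ p r)) * \<Phi> (particles n \<nu>)"
      by (simp add: mult_ac)
    also have "\<dots> = laplace_sign n k * (\<Sum>p | p permutes {..<n + k} \<and> p ` {..<n} = particles n \<nu>. ?t p)"
      unfolding mult.assoc sum_distrib_right
      by (intro arg_cong2[where f = "(*)"] sum.cong) (auto simp: mult.assoc)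
    finally show "schur n \<nu> x * schur k (dual_diagram n k \<nu>) y * \<Phi> (particles n \<nu>) * (vandermonde n x * vandermonde k y) =
       laplace_sign n k * (\<Sum>p | p permutes {..<n + k} \<and> p ` {..<n} = particles n \<nu>. ?t p)" .
  qed
  also have "\<dots> = laplace_sign n k * (\<Sum>S\<in>particles n ` young_rect n k.
      \<Sum>p | p permutes {..<n + k} \<and> p ` {..<n} = S. ?t p)"
    unfolding sum_distrib_left[symmetric] by (subst sum.reindex[OF inj_on_particles]) simp
  also have "(\<Sum>S\<in>particles n ` young_rect n k. \<Sum>p | p permutes {..<n + k} \<and> p ` {..<n} = S. ?t p) =
      (\<Sum>p | p permutes {..<n + k}. ?t p)"
  proof -
    have "p ` {..<n} \<in> particles n ` young_rect n k" if "p permutes {..<n + k}" for p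
    proof (rule particles_surj)
      show "p ` {..<n} \<subseteq> {..<n + k}" using permutes_image[OF that] by force
      show "card (p ` {..<n}) = n" using permutes_inj_on[OF that] by (simp add: card_image)
    qed
    then show ?thesis
      using sum.group[of "{p. p permutes {..<n + k}}" "particles n ` young_rect n k" "\<lambda>p. p ` {..<n}" ?t]
      by (auto simp: finite_permutations finite_young_rect)
  qed
  finally show ?thesis .
qed

section \<open>Moments of power sums for two sets of variables\<close>

text \<open>
  Distinct positive variables make the Vandermonde factors nonzero, so that they can be
  cancelled, and make the weights nonnegative.
\<close>

locale schur_pair =
  fixes n k :: nat and x y :: "nat \<Rightarrow> real"
  assumes x_pos: "\<And>i. i < n \<Longrightarrow> 0 < x i" and y_pos: "\<And>j. j < k \<Longrightarrow> 0 < y j"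
    and inj_x: "inj_on x {..<n}" and inj_y: "inj_on y {..<k}"
begin

abbreviation z :: "nat \<Rightarrow> real" where "z \<equiv> node n x y"

definition expect :: "(nat set \<Rightarrow> real) \<Rightarrow> real" where
  "expect \<Phi> = (\<Sum>\<nu>\<in>young_rect n k. diagram_weight n k x y \<nu> * \<Phi> (particles n \<nu>))"

definition node_det :: real where
  "node_det = array_det (n + k) (\<lambda>r c. z r ^ c)"

lemma inj_z: "inj_on z {..<n + k}"
proof (rule linorder_inj_onI')
  fix r s assume "r \<in> {..<n + k}" "s \<in> {..<n + k}" "r < s"
  then consider "s < n" | "r < n" "n \<le> s" "s - n < k" | "n \<le> r" "r - n < s - n" "s - n < k"
    by fastforce
  then show "z r \<noteq> z s"
  proof cases
    case 1
    then show ?thesis using \<open>r < s\<close> inj_x by (auto simp: node_def dest: inj_onD)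
  next
    case 2
    then show ?thesis using x_pos[of r] y_pos[of "s - n"] by (simp add: node_def)
  next
    case 3
    then show ?thesis using \<open>r < s\<close> inj_onD[OF inj_y, of "r - n" "s - n"] by (auto simp: node_def)
  qed
qed

lemma abs_vandermonde_uminus: "\<bar>vandermonde m (\<lambda>j. - u j)\<bar> = \<bar>vandermonde m u\<bar>"
  unfolding vandermonde_def abs_prod by (intro prod.cong refl) simp

lemma abs_node_det:
  "\<bar>node_det\<bar> = \<bar>vandermonde n x * vandermonde k y\<bar> * (\<Prod>i<n. \<Prod>j<k. x i + y j)"
proof -
  let ?N = "n + k"
  let ?rev = "\<lambda>r. if r < ?N then ?N - Suc r else r"
  have perm: "?rev permutes {..<?N}"
  proof (rule bij_imp_permutes)
    show "bij_betw ?rev {..<?N} {..<?N}"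
      by (rule bij_betw_byWitness[where f' = ?rev]) auto
  qed simp
  have "vandermonde ?N z = array_det ?N (\<lambda>i j. z j ^ ?rev i)"
    unfolding vandermonde_alternant alternant_def by (rule array_det_cong) simp
  also have "\<dots> = of_int (sign ?rev) * array_det ?N (\<lambda>i j. z j ^ i)"
    using array_det_permute_rows[OF perm, of "\<lambda>i j. z j ^ i"] .
  also have "array_det ?N (\<lambda>i j. z j ^ i) = node_det"
    unfolding node_det_def by (rule array_det_transpose)
  finally have "\<bar>node_det\<bar> = \<bar>vandermonde ?N z\<bar>" by (simp add: abs_mult sign_def)
  also have "\<dots> = \<bar>vandermonde n z\<bar> * \<bar>vandermonde k (\<lambda>j. z (n + j))\<bar> *
      \<bar>\<Prod>i<n. \<Prod>j<k. z i - z (n + j)\<bar>"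
    unfolding vandermonde_split by (simp add: abs_mult)
  also have "vandermonde n z = vandermonde n x"
    unfolding vandermonde_def by (intro prod.cong refl) (simp add: node_def)
  also have "\<bar>vandermonde k (\<lambda>j. z (n + j))\<bar> = \<bar>vandermonde k y\<bar>"
    using abs_vandermonde_uminus[of k y] by (simp add: node_def)
  also have "(\<Prod>i<n. \<Prod>j<k. z i - z (n + j)) = (\<Prod>i<n. \<Prod>j<k. x i + y j)"
    by (intro prod.cong refl) (simp add: node_def)
  also have "\<bar>\<Prod>i<n. \<Prod>j<k. x i + y j\<bar> = (\<Prod>i<n. \<Prod>j<k. x i + y j)"
    using x_pos y_pos by (intro abs_of_nonneg prod_nonneg) (auto intro!: less_imp_le add_pos_pos)
  finally show ?thesis by (simp add: abs_mult)
qed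

lemma prod_sum_pos: "0 < (\<Prod>i<n. \<Prod>j<k. x i + y j)"
  using x_pos y_pos by (intro prod_pos) (auto intro!: add_pos_pos)

lemma vandermonde_xy_nonzero: "vandermonde n x * vandermonde k y \<noteq> 0"
  using vandermonde_nonzero inj_x inj_y by auto

lemma node_det_nonzero: "node_det \<noteq> 0"
  proof
  assume "node_det = 0"
  then have "(\<Prod>i<n. \<Prod>j<k. x i + y j) = 0"
    using abs_node_det vandermonde_xy_nonzero by (metis abs_eq_0 mult_eq_0_iff)
  then show False using prod_sum_pos by linarith
qed

lemma schur_nonneg:
  assumes "\<nu> \<in> young_rect a b" "\<And>i. i < m \<Longrightarrow> 0 \<le> u i"
  shows "(0::real) \<le> schur m \<nu> u"
  unfolding schur_def
proof (intro sum_nonneg prod_nonneg ballI)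
  fix T c assume "T \<in> ssyt m \<nu>" "c \<in> cells \<nu>"
  then have "T c < m" by (auto simp: ssyt_def)
  then show "0 \<le> u (T c)" by (rule assms(2))
qed

lemma schur_pair_nonneg:
  assumes "\<nu> \<in> young_rect n k"
  shows "0 \<le> schur n \<nu> x * schur k (dual_diagram n k \<nu>) y"
proof -
  have "dual_diagram n k \<nu> \<in> young_rect k n"
    using dual_diagram_antimono[OF assms] by (simp add: young_rect_def)
  then show ?thesis
    using assms x_pos y_pos by (intro mult_nonneg_nonneg schur_nonneg) (auto intro: less_imp_le)
qed

lemma diagram_weight_eq:
  "diagram_weight n k x y \<nu> = schur n \<nu> x * schur k (dual_diagram n k \<nu>) y / (\<Prod>i<n. \<Prod>j<k. x i + y j)"
  by (simp add: diagram_weight_def dual_diagram_def)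

lemma diagram_weight_nonneg: "\<nu> \<in> young_rect n k \<Longrightarrow> 0 \<le> diagram_weight n k x y \<nu>"
  unfolding diagram_weight_eq using schur_pair_nonneg prod_sum_pos by (auto intro!: divide_nonneg_pos)

text \<open>
  The dual Cauchy identity. By \<open>schur_pair_sum\<close> for the constant functional, the
  sum is a Vandermonde determinant in all nodes divided by those in \<open>x\<close> and
  \<open>y\<close>, up to sign. Positivity of both sides decides the sign, which also evaluates
  the constant of the Laplace expansion.
\<close>

lemma sum_schur_pair:
  "(\<Sum>\<nu>\<in>young_rect n k. schur n \<nu> x * schur k (dual_diagram n k \<nu>) y) = (\<Prod>i<n. \<Prod>j<k. x i + y j)" (is "?S = ?P")
  and laplace_sign_node_det:
  "(\<Prod>i<n. \<Prod>j<k. x i + y j) * (vandermonde n x * vandermonde k y) = laplace_sign n k * node_det"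
proof -
  have *: "?S * (vandermonde n x * vandermonde k y) = laplace_sign n k * node_det"
    using schur_pair_sum[where n = n and k = k and x = x and y = y and \<Phi> = "\<lambda>_. 1"] by (simp add: node_det_def array_det_leibniz)
  (* Only absolute values are compared, so the sign constant need not be known. *)
  have "\<bar>laplace_sign n k\<bar> = 1"
    using laplace_sign_square[of n k] by (metis abs_mult_self_eq abs_1 abs_square_eq_1 power2_eq_square)
  then have "\<bar>?S\<bar> * \<bar>vandermonde n x * vandermonde k y\<bar> = ?P * \<bar>vandermonde n x * vandermonde k y\<bar>"
    using arg_cong[OF *, of abs] abs_node_det by (simp add: abs_mult)
  then have "\<bar>?S\<bar> = ?P" using vandermonde_xy_nonzero by simp
  moreover have "0 \<le> ?S" by (intro sum_nonneg schur_pair_nonneg)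
  ultimately show "?S = ?P" by simp
  then show "?P * (vandermonde n x * vandermonde k y) = laplace_sign n k * node_det"
    using * by simp
qed

lemma expect_eq:
  "expect \<Phi> = (\<Sum>p | p permutes {..<n + k}.
     of_int (sign p) * (\<Prod>r<n + k. z r ^ p r) * \<Phi> (p ` {..<n})) / node_det" (is "_ = ?R / _")
proof -
  let ?P = "\<Prod>i<n. \<Prod>j<k. x i + y j" and ?v = "vandermonde n x * vandermonde k y"
  have l: "laplace_sign n k \<noteq> 0" using laplace_sign_square[of n k] by auto
  have "expect \<Phi> * (?P * ?v) = laplace_sign n k * ?R"
    using schur_pair_sum[where n = n and k = k and x = x and y = y and \<Phi> = \<Phi>] less_imp_neq[OF prod_sum_pos]
    by (simp del: prod_zero_iff add: expect_def diagram_weight_eq sum_divide_distrib[symmetric] sum_distrib_right[symmetric])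
  then have "expect \<Phi> * (laplace_sign n k * node_det) = laplace_sign n k * ?R"
    unfolding laplace_sign_node_det .
  then show ?thesis using l node_det_nonzero by (simp add: field_simps)
qed

lemma sum_diagram_weight: "(\<Sum>\<nu>\<in>young_rect n k. diagram_weight n k x y \<nu>) = 1"
  unfolding diagram_weight_eq sum_divide_distrib[symmetric] sum_schur_pair using less_imp_neq[OF prod_sum_pos]
  by (simp del: prod_zero_iff)

lemma expect_add: "expect (\<lambda>S. f S + g S) = expect f + expect g"
  by (simp add: expect_def distrib_left sum.distrib)

lemma expect_scale: "expect (\<lambda>S. c * f S) = c * expect f"
  by (simp add: expect_def sum_distrib_left mult_ac)

lemma expect_const: "expect (\<lambda>S. c) = c"
  using sum_diagram_weight by (simp add: expect_def flip: sum_distrib_right)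

definition lagrange :: "nat \<Rightarrow> real poly" where
  "lagrange r = Polynomial.smult (1 / (\<Prod>s\<in>{..<n + k} - {r}. z r - z s)) (\<Prod>s\<in>{..<n + k} - {r}. [:- z s, 1:])"

lemma poly_lagrange:
  "poly (lagrange r) w = (\<Prod>s\<in>{..<n + k} - {r}. (w - z s) / (z r - z s))"
  by (simp add: lagrange_def poly_prod prod_dividef)

lemma degree_lagrange: "r < n + k \<Longrightarrow> degree (lagrange r) < n + k"
  unfolding lagrange_def
  by (intro le_less_trans[OF degree_smult_le] le_less_trans[OF degree_prod_sum_le]) auto

lemma poly_lagrange_node:
  assumes "r < n + k" "s < n + k"
  shows "poly (lagrange r) (z s) = (if s = r then 1 else 0)"
proof (cases "s = r")
  case True
  have "(\<Prod>s\<in>{..<n + k} - {r}. (z r - z s) / (z r - z s)) = 1"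
    using assms inj_onD[OF inj_z] by (intro prod.neutral) auto
  then show ?thesis using True by (simp add: poly_lagrange)
next
  case False
  then have "(\<Prod>s'\<in>{..<n + k} - {r}. (z s - z s') / (z r - z s')) = 0"
    using assms by (intro prod_zero) auto
  then show ?thesis using False by (simp add: poly_lagrange)
qed

text \<open>
  Lagrange interpolation at the nodes expresses the powers of a new point by those of the nodes,
  that is, a new row of the power matrix by its rows.
\<close>

lemma lagrange_interpolation:
  assumes "degree p < n + k"
  shows "p = (\<Sum>r<n + k. Polynomial.smult (poly p (z r)) (lagrange r))"
proof (rule poly_eqI_degree[where A = "z ` {..<n + k}"])
  have card: "card (z ` {..<n + k}) = n + k" using inj_z by (simp add: card_image)
  show "degree p < card (z ` {..<n + k})" using assms card by simp
  have "degree (\<Sum>r<n + k. Polynomial.smult (poly p (z r)) (lagrange r)) < n + k"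
    using assms by (intro degree_sum_less) (auto intro: le_less_trans[OF degree_smult_le] degree_lagrange)
  then show "degree (\<Sum>r<n + k. Polynomial.smult (poly p (z r)) (lagrange r)) < card (z ` {..<n + k})"
    using card by simp
  fix w assume "w \<in> z ` {..<n + k}"
  then obtain s where s: "s < n + k" "w = z s" by auto
  have "(\<Sum>r<n + k. poly p (z r) * poly (lagrange r) (z s)) = (\<Sum>r<n + k. if s = r then poly p (z r) else 0)"
    using s by (intro sum.cong) (auto simp: poly_lagrange_node)
  then show "poly p w = poly (\<Sum>r<n + k. Polynomial.smult (poly p (z r)) (lagrange r)) w"
    using s by (simp add: poly_sum)
qed

lemma power_interpolation:
  assumes "c < n + k"
  shows "w ^ c = (\<Sum>r<n + k. poly (lagrange r) w * z r ^ c)"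
proof -
  have "poly (monom 1 c) w = poly (\<Sum>r<n + k. Polynomial.smult (poly (monom 1 c) (z r)) (lagrange r)) w"
    using lagrange_interpolation[of "monom 1 c"] assms by (simp add: degree_monom_eq)
  then show ?thesis by (simp add: poly_sum poly_monom mult.commute)
qed

text \<open>
  The coefficient of row \<open>r\<close> when node \<open>i\<close> is scaled by
  \<open>t\<close>. The trace of this matrix over the first \<open>n\<close> nodes is the mean
  of \<open>\<Sum>\<^sub>a t\<^sup>a\<close>.
\<close>

definition transfer :: "real \<Rightarrow> nat \<Rightarrow> nat \<Rightarrow> real" where
  "transfer t i r = poly (lagrange r) (t * z i)"

lemma prod_scale_row:
  assumes "i < m"
  shows "(\<Prod>r<m. z r ^ p r) * t ^ p i = (\<Prod>r<m. if r = i then (t * z r) ^ p r else z r ^ p r)"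
proof -
  have "(\<Prod>r<m. if r = i then (t * z r) ^ p r else z r ^ p r) =
      (\<Prod>r<m. z r ^ p r * (if r = i then t ^ p r else 1))"
    by (intro prod.cong) (auto simp: power_mult_distrib)
  then show ?thesis using assms by (simp add: prod.distrib)
qed

text \<open>
  The factor \<open>t\<^sup>a\<close> for the particle in row \<open>i\<close> turns that row of
  the power matrix into the powers of \<open>t * z i\<close>; Lagrange interpolation and
  Cramer's rule evaluate the new determinant.
\<close>

lemma expect_power_sum:
  "expect (\<lambda>S. \<Sum>a\<in>S. t ^ a) = (\<Sum>i<n. transfer t i i)"
proof -
  let ?N = "n + k"
  have "(\<Sum>p | p permutes {..<?N}. of_int (sign p) * (\<Prod>r<?N. z r ^ p r) * (\<Sum>a\<in>p ` {..<n}. t ^ a)) =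
    (\<Sum>p | p permutes {..<?N}. \<Sum>i<n. of_int (sign p) * (\<Prod>r<?N. if r = i then (t * z r) ^ p r else z r ^ p r))"
  proof (rule sum.cong[OF refl])
    fix p assume "p \<in> {p. p permutes {..<?N}}"
    then have "inj_on p {..<n}" by (auto intro: permutes_inj_on)
    then have "(\<Sum>a\<in>p ` {..<n}. t ^ a) = (\<Sum>i<n. t ^ p i)" by (simp add: sum.reindex)
    then show "of_int (sign p) * (\<Prod>r<?N. z r ^ p r) * (\<Sum>a\<in>p ` {..<n}. t ^ a) =
       (\<Sum>i<n. of_int (sign p) * (\<Prod>r<?N. if r = i then (t * z r) ^ p r else z r ^ p r))"
      by (simp add: sum_distrib_left mult.assoc prod_scale_row)
  qed
  also have "\<dots> = (\<Sum>i<n. array_det ?N (\<lambda>r c. if r = i then (t * z r) ^ c else z r ^ c))"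
    unfolding array_det_leibniz by (rule sum.swap)
  also have "\<dots> = (\<Sum>i<n. transfer t i i * node_det)"
  proof (rule sum.cong[OF refl])
    fix i assume "i \<in> {..<n}"
    then have i: "i < ?N" by simp
    have "array_det ?N (\<lambda>r c. if r = i then (t * z r) ^ c else z r ^ c) =
        array_det ?N (\<lambda>r c. if r = i then \<Sum>l<?N. transfer t i l * z l ^ c else z r ^ c)"
      by (rule array_det_cong) (auto simp: transfer_def power_interpolation)
    also have "\<dots> = transfer t i i * node_det"
      unfolding node_det_def by (rule array_det_replace_row[OF i])
    finally show "array_det ?N (\<lambda>r c. if r = i then (t * z r) ^ c else z r ^ c) = transfer t i i * node_det" .
  qed
  finally show ?thesis
    unfolding expect_eq using node_det_nonzero by (simp flip: sum_distrib_right)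
qed

lemma prod_scale_two_rows:
  assumes "i < m" "j < m" "i \<noteq> j"
  shows "(\<Prod>r<m. z r ^ p r) * (t ^ p i * t ^ p j) = (\<Prod>r<m. if r \<in> {i, j} then (t * z r) ^ p r else z r ^ p r)"
proof -
  have "(\<Prod>r<m. if r \<in> {i, j} then (t * z r) ^ p r else z r ^ p r) =
      (\<Prod>r<m. z r ^ p r * ((if r = i then t ^ p r else 1) * (if r = j then t ^ p r else 1)))"
    using assms(3) by (intro prod.cong) (auto simp: power_mult_distrib)
  then show ?thesis using assms by (simp add: prod.distrib)
qed

text \<open>
  Pairs of equal particles give the first term. Pairs of different ones scale two rows, and the
  determinant is multiplied by a minor of order two of the transfer matrix.
\<close>

lemma expect_power_sum_square:
  "expect (\<lambda>S. (\<Sum>a\<in>S. t ^ a)\<^sup>2) = expect (\<lambda>S. \<Sum>a\<in>S. (t\<^sup>2) ^ a) +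
    (\<Sum>i<n. transfer t i i)\<^sup>2 - (\<Sum>i<n. \<Sum>j<n. transfer t i j * transfer t j i)"
proof -
  let ?N = "n + k" and ?B = "transfer t"
  let ?D = "\<lambda>i j. array_det ?N (\<lambda>r c. if r \<in> {i, j} then (t * z r) ^ c else z r ^ c)"
  let ?w = "\<lambda>p. of_int (sign p) * (\<Prod>r<?N. z r ^ p r)"
  have sq: "(\<Sum>i<n. f i)\<^sup>2 = (\<Sum>i<n. (f i)\<^sup>2) + (\<Sum>i<n. \<Sum>j\<in>{..<n} - {i}. f i * f j)" for f :: "nat \<Rightarrow> real"
  proof -
    have "(\<Sum>i<n. f i)\<^sup>2 = (\<Sum>i<n. \<Sum>j<n. f i * f j)" by (simp add: power2_eq_square sum_product)
    also have "\<dots> = (\<Sum>i<n. (f i)\<^sup>2 + (\<Sum>j\<in>{..<n} - {i}. f i * f j))"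
      by (intro sum.cong) (auto simp: sum.remove power2_eq_square)
    finally show ?thesis by (simp add: sum.distrib)
  qed
  have "expect (\<lambda>S. (\<Sum>a\<in>S. t ^ a)\<^sup>2) * node_det =
      (\<Sum>p | p permutes {..<?N}. ?w p * (\<Sum>a\<in>p ` {..<n}. t ^ a)\<^sup>2)"
    unfolding expect_eq using node_det_nonzero by simp
  also have "\<dots> = (\<Sum>p | p permutes {..<?N}. ?w p * (\<Sum>a\<in>p ` {..<n}. (t\<^sup>2) ^ a) +
      (\<Sum>i<n. \<Sum>j\<in>{..<n} - {i}. of_int (sign p) * (\<Prod>r<?N. if r \<in> {i, j} then (t * z r) ^ p r else z r ^ p r)))"
  proof (rule sum.cong[OF refl])
    fix p assume "p \<in> {p. p permutes {..<?N}}"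
    then have inj: "inj_on p {..<n}" by (auto intro: permutes_inj_on)
    have "(\<Sum>a\<in>p ` {..<n}. t ^ a)\<^sup>2 = (\<Sum>i<n. t ^ p i)\<^sup>2" by (simp add: sum.reindex[OF inj])
    also have "\<dots> = (\<Sum>i<n. (t ^ p i)\<^sup>2) + (\<Sum>i<n. \<Sum>j\<in>{..<n} - {i}. t ^ p i * t ^ p j)" by (rule sq)
    also have "(\<Sum>i<n. (t ^ p i)\<^sup>2) = (\<Sum>a\<in>p ` {..<n}. (t\<^sup>2) ^ a)"
      by (simp add: sum.reindex[OF inj] power_mult[symmetric] mult.commute)
    finally have "?w p * (\<Sum>a\<in>p ` {..<n}. t ^ a)\<^sup>2 = ?w p * (\<Sum>a\<in>p ` {..<n}. (t\<^sup>2) ^ a) +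
       (\<Sum>i<n. \<Sum>j\<in>{..<n} - {i}. of_int (sign p) * ((\<Prod>r<?N. z r ^ p r) * (t ^ p i * t ^ p j)))"
      by (simp add: distrib_left sum_distrib_left mult.assoc)
    also have "(\<Sum>i<n. \<Sum>j\<in>{..<n} - {i}. of_int (sign p) * ((\<Prod>r<?N. z r ^ p r) * (t ^ p i * t ^ p j))) =
      (\<Sum>i<n. \<Sum>j\<in>{..<n} - {i}. of_int (sign p) * (\<Prod>r<?N. if r \<in> {i, j} then (t * z r) ^ p r else z r ^ p r))"
      by (intro sum.cong refl arg_cong2[where f = "(*)"] prod_scale_two_rows) auto
    finally show "?w p * (\<Sum>a\<in>p ` {..<n}. t ^ a)\<^sup>2 = ?w p * (\<Sum>a\<in>p ` {..<n}. (t\<^sup>2) ^ a) +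
       (\<Sum>i<n. \<Sum>j\<in>{..<n} - {i}. of_int (sign p) * (\<Prod>r<?N. if r \<in> {i, j} then (t * z r) ^ p r else z r ^ p r))" .
  qed
  also have "\<dots> = (\<Sum>p | p permutes {..<?N}. ?w p * (\<Sum>a\<in>p ` {..<n}. (t\<^sup>2) ^ a)) +
      (\<Sum>i<n. \<Sum>j\<in>{..<n} - {i}. ?D i j)"
    unfolding array_det_leibniz sum.distrib
    by (subst sum.swap, subst (2) sum.swap) simp
  also have "(\<Sum>p | p permutes {..<?N}. ?w p * (\<Sum>a\<in>p ` {..<n}. (t\<^sup>2) ^ a)) =
      expect (\<lambda>S. \<Sum>a\<in>S. (t\<^sup>2) ^ a) * node_det"
    unfolding expect_eq using node_det_nonzero by simp
  also have "(\<Sum>i<n. \<Sum>j\<in>{..<n} - {i}. ?D i j) =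
      (\<Sum>i<n. \<Sum>j\<in>{..<n} - {i}. (?B i i * ?B j j - ?B i j * ?B j i) * node_det)"
  proof (intro sum.cong refl)
    fix i j assume "i \<in> {..<n}" "j \<in> {..<n} - {i}"
    then have ij: "i < ?N" "j < ?N" "i \<noteq> j" by auto
    have "?D i j = array_det ?N (\<lambda>r c. if r \<in> {i, j} then \<Sum>l<?N. ?B r l * z l ^ c else z r ^ c)"
      by (rule array_det_cong) (auto simp: transfer_def power_interpolation)
    also have "\<dots> = (?B i i * ?B j j - ?B i j * ?B j i) * node_det"
      unfolding node_det_def by (rule array_det_replace_two_rows[OF ij])
    finally show "?D i j = (?B i i * ?B j j - ?B i j * ?B j i) * node_det" .
  qed
  also have "\<dots> = (\<Sum>i<n. \<Sum>j<n. ?B i i * ?B j j - ?B i j * ?B j i) * node_det"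
    unfolding sum_distrib_right by (intro sum.cong refl sum.mono_neutral_left) auto
  also have "(\<Sum>i<n. \<Sum>j<n. ?B i i * ?B j j - ?B i j * ?B j i) =
      (\<Sum>i<n. ?B i i)\<^sup>2 - (\<Sum>i<n. \<Sum>j<n. ?B i j * ?B j i)"
    by (simp add: sum_subtractf power2_eq_square sum_product)
  finally have "expect (\<lambda>S. (\<Sum>a\<in>S. t ^ a)\<^sup>2) * node_det = (expect (\<lambda>S. \<Sum>a\<in>S. (t\<^sup>2) ^ a) +
    ((\<Sum>i<n. ?B i i)\<^sup>2 - (\<Sum>i<n. \<Sum>j<n. ?B i j * ?B j i))) * node_det"
    by (simp add: distrib_right)
  then show ?thesis using node_det_nonzero by simp
qed

text \<open>
  Expanding in powers of \<open>t\<close> gives \<open>\<Sum> t\<^sup>a\<^sup>+\<^sup>b K a b *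
  K b a\<close> with the kernel \<open>K a b = (\<Sum>i<n. coeff (lagrange i) a * x i ^
  b)\<close>. A polynomial \<open>W\<close> that vanishes at all products \<open>x i * (- y
  j)\<close> makes this kernel symmetric up to positive weights: interpolating \<open>w
  \<mapsto> W (x i * w)\<close> uses only the nodes \<open>x j\<close>, with the symmetric
  coefficients \<open>W (x i * x j)\<close>, so that \<open>coeff W b * K a b\<close> is
  symmetric in \<open>a\<close> and \<open>b\<close>. Hence \<open>K a b\<close> and \<open>K b
  a\<close> never have opposite signs.
\<close>

lemma trace_square_nonneg:
  assumes W: "degree W < n + k" "\<And>a. a < n + k \<Longrightarrow> 0 < coeff W a"
    "\<And>i j. i < n \<Longrightarrow> j < k \<Longrightarrow> poly W (- (x i * y j)) = 0" and t: "0 < t"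
  shows "0 \<le> (\<Sum>i<n. \<Sum>j<n. transfer t i j * transfer t j i)"
proof -
  let ?N = "n + k"
  let ?c = "\<lambda>i a. coeff (lagrange i) a" and ?g = "\<lambda>i j. poly W (x i * x j)"
  (* The correlation kernel of the particles; its symmetry up to positive weights is the point of
     the proof. *)
  define K where "K a b = (\<Sum>i<n. ?c i a * x i ^ b)" for a b
  have zx: "z i = x i" if "i < n" for i using that by (simp add: node_def)
  have wx: "coeff W a * x i ^ a = (\<Sum>j<n. ?g i j * ?c j a)" if i: "i < n" for i a
  proof -
    let ?R = "pcompose W [:0, x i:]"
    have "?R = (\<Sum>r<?N. Polynomial.smult (poly ?R (z r)) (lagrange r))"
    proof (rule lagrange_interpolation)
      have "degree [:0, x i:] \<le> 1" by simp
      then have "degree W * degree [:0, x i:] \<le> degree W * 1" by (intro mult_le_mono2)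
      then show "degree ?R < ?N" using degree_pcompose_le[of W "[:0, x i:]"] W(1) by linarith
    qed
    also have "\<dots> = (\<Sum>r<n. Polynomial.smult (poly ?R (z r)) (lagrange r))"
    proof (rule sum.mono_neutral_right)
      show "\<forall>r\<in>{..<?N} - {..<n}. Polynomial.smult (poly ?R (z r)) (lagrange r) = 0"
      proof
        fix r assume "r \<in> {..<?N} - {..<n}"
        then have "r - n < k" "\<not> r < n" by auto
        then have "poly ?R (z r) = 0" 
          using W(3)[OF i, of "r - n"] by (simp add: poly_pcompose node_def mult.commute)
        then show "Polynomial.smult (poly ?R (z r)) (lagrange r) = 0" by simp
      qed
    qed auto
    also have "\<dots> = (\<Sum>j<n. Polynomial.smult (?g i j) (lagrange j))"
      by (intro sum.cong) (auto simp: poly_pcompose zx mult.commute)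
    finally have "coeff ?R a = (\<Sum>j<n. ?g i j * ?c j a)" by (simp add: coeff_sum)
    then show ?thesis by (simp add: coeff_pcompose_linear mult.commute)
  qed
  have K: "coeff W b * K a b = (\<Sum>i<n. \<Sum>j<n. ?c i a * ?g i j * ?c j b)" for a b
  proof -
    have "coeff W b * K a b = (\<Sum>i<n. ?c i a * (coeff W b * x i ^ b))"
      by (simp add: K_def sum_distrib_left mult_ac)
    also have "\<dots> = (\<Sum>i<n. ?c i a * (\<Sum>j<n. ?g i j * ?c j b))"
      by (intro sum.cong refl arg_cong2[where f = "(*)"] wx) auto
    finally show ?thesis by (simp add: sum_distrib_left mult.assoc)
  qed
  have sym: "coeff W b * K a b = coeff W a * K b a" for a b
    unfolding K by (subst sum.swap) (simp add: mult_ac)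
  have KK: "0 \<le> K a b * K b a" if "b < ?N" "a < ?N" for a b
  proof -
    have "coeff W b * (K a b * K b a) = coeff W a * (K b a * K b a)"
      using sym[of b a] by (simp flip: mult.assoc)
    also have "\<dots> \<ge> 0" using W(2)[OF that(2)] by simp
    finally show ?thesis using W(2)[OF that(1)] by (simp add: zero_le_mult_iff)
  qed
  have tr: "transfer t i j = (\<Sum>a<?N. ?c j a * t ^ a * x i ^ a)" if "i < n" "j < n" for i j
  proof -
    have "degree (lagrange j) < ?N" using degree_lagrange that by simp
    then have "poly (lagrange j) w = (\<Sum>a<?N. ?c j a * w ^ a)" for w
      unfolding poly_altdef by (intro sum.mono_neutral_left) (auto simp: coeff_eq_0)
    then show ?thesis by (simp add: transfer_def zx that power_mult_distrib mult.assoc)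
  qed
  have "(\<Sum>i<n. \<Sum>j<n. transfer t i j * transfer t j i) =
     (\<Sum>i<n. \<Sum>j<n. \<Sum>a<?N. \<Sum>b<?N. t ^ a * t ^ b * ((?c j a * x j ^ b) * (?c i b * x i ^ a)))"
    by (intro sum.cong refl) (simp add: tr sum_product mult_ac)
  also have "\<dots> = (\<Sum>a<?N. \<Sum>b<?N. \<Sum>i<n. \<Sum>j<n. t ^ a * t ^ b * ((?c j a * x j ^ b) * (?c i b * x i ^ a)))"
    by (simp only: sum.swap[of _ "{..<?N}" "{..<n}"])
  also have "\<dots> = (\<Sum>a<?N. \<Sum>b<?N. t ^ a * t ^ b * (K b a * K a b))"
    unfolding K_def sum_product
    by (intro sum.cong refl) (simp add: sum_distrib_left mult_ac)
  also have "\<dots> \<ge> 0"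
  proof (intro sum_nonneg)
    fix a b assume "a \<in> {..<?N}" "b \<in> {..<?N}"
    then have "0 \<le> K b a * K a b" using KK[of a b] by simp
    then show "0 \<le> t ^ a * t ^ b * (K b a * K a b)" using t by simp
  qed
  finally show ?thesis .
qed

text \<open>
  The variance of \<open>\<Sum>\<^sub>a t\<^sup>a\<close> is at most the mean of
  \<open>\<Sum>\<^sub>a t\<^sup>2\<^sup>a\<close>. That mean is of order \<open>n\<close> in the
  scaling limit, while the square of the mean has order \<open>n\<^sup>2\<close>: the power sums
  concentrate.
\<close>

lemma expect_square_le:
  assumes "degree W < n + k" "\<And>a. a < n + k \<Longrightarrow> 0 < coeff W a"
    "\<And>i j. i < n \<Longrightarrow> j < k \<Longrightarrow> poly W (- (x i * y j)) = 0" and "0 < t"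
  shows "expect (\<lambda>S. (\<Sum>a\<in>S. t ^ a)\<^sup>2) \<le> expect (\<lambda>S. \<Sum>a\<in>S. (t\<^sup>2) ^ a) + (expect (\<lambda>S. \<Sum>a\<in>S. t ^ a))\<^sup>2"
  unfolding expect_power_sum_square expect_power_sum[of t] using trace_square_nonneg[OF assms] by simp

end

section \<open>Geometric progressions\<close>

lemma power_eq_power_iff_base:
  fixes q :: real
  assumes "0 < q" "q \<noteq> 1"
  shows "q ^ i = q ^ j \<longleftrightarrow> i = j"
proof -
  have "ln q \<noteq> 0" using assms by simp
  moreover have "q ^ i = q ^ j \<longleftrightarrow> ln (q ^ i) = ln (q ^ j)" using assms by simp
  ultimately show ?thesis using assms by (simp add: ln_realpow)
qed

lemma prod_lessThan_add: "(\<Prod>j<a + b. g j) = (\<Prod>j<a. g j) * (\<Prod>j<b. g (a + j))"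
  for g :: "nat \<Rightarrow> 'a::comm_monoid_mult"
  by (induction b) (auto simp: mult_ac)

text \<open>
  This supplies the positive weights for \<open>trace_square_nonneg\<close>.
\<close>

lemma coeff_prod_linear_pos:
  assumes "\<And>r. r < m \<Longrightarrow> 0 < c r" "a \<le> m"
  shows "0 < coeff (\<Prod>r<m. [:c r, 1:] :: real poly) a"
  using assms
proof (induction m arbitrary: a)
  case (Suc m)
  let ?p = "\<Prod>r<m. [:c r, 1:]"
  have nn: "0 \<le> coeff ?p b" for b
  proof (cases "b \<le> m")
    case False
    have "degree ?p \<le> m" by (rule order.trans[OF degree_prod_sum_le]) auto
    then show ?thesis using False by (simp add: coeff_eq_0)
  qed (use Suc in \<open>auto intro: less_imp_le\<close>)
  have eq: "(\<Prod>r<Suc m. [:c r, 1:]) = Polynomial.smult (c m) ?p + pCons 0 ?p"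
    by (simp add: mult.commute)
  show ?case
  proof (cases a)
    case 0
    then show ?thesis unfolding eq using Suc.IH[of 0] Suc.prems by simp
  next
    case (Suc b)
    have "0 < coeff ?p b" using Suc.IH[of b] Suc.prems Suc by simp
    moreover have "0 \<le> c m * coeff ?p (Suc b)" using nn Suc.prems(1)[of m] by (simp add: less_imp_le)
    ultimately show ?thesis unfolding eq using Suc by simp
  qed
qed simp

text \<open>
  Both measures have this form. The bijection \<open>e\<close> allows the geometric progression
  of the second variables to be listed in either direction, so that it can always be written
  with ratio \<open>q\<close>: \<open>1, q\<inverse>, \<dots>, q\<^bsup>1 - k\<^esup>\<close> is
  \<open>\<mu>, \<mu> q, \<dots>, \<mu> q\<^bsup>k - 1\<^esup>\<close> backwards, with
  \<open>\<mu> = q\<^bsup>1 - k\<^esup>\<close>.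
\<close>

locale q_pair =
  fixes n k :: nat and q \<mu> :: real and e :: "nat \<Rightarrow> nat" and x y :: "nat \<Rightarrow> real"
  assumes n_pos: "0 < n" and q_pos: "0 < q" and q_neq_1: "q \<noteq> 1" and \<mu>_pos: "0 < \<mu>"
    and e: "bij_betw e {..<k} {..<k}"
    and x_eq: "\<And>i. i < n \<Longrightarrow> x i = q ^ i"
    and y_eq: "\<And>j. j < k \<Longrightarrow> y j = \<mu> * q ^ e j"

sublocale q_pair \<subseteq> schur_pair
proof
  show "inj_on x {..<n}"
    using power_eq_power_iff_base[OF q_pos q_neq_1] by (auto simp: inj_on_def x_eq)
  show "inj_on y {..<k}"
    using power_eq_power_iff_base[OF q_pos q_neq_1] \<mu>_pos e
    by (auto simp: inj_on_def y_eq bij_betw_def)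
qed (use q_pos \<mu>_pos in \<open>auto simp: x_eq y_eq\<close>)

context q_pair
begin

text \<open>
  For geometric progressions the products \<open>x i * y j\<close> take only the \<open>n + k -
  1\<close> values \<open>\<mu> q\<^sup>r\<close>, so there is a polynomial of degree \<open>n +
  k - 1\<close> with positive coefficients and with the required roots.
\<close>

lemma q_expect_square_le:
  assumes "0 < t"
  shows "expect (\<lambda>S. (\<Sum>a\<in>S. t ^ a)\<^sup>2) \<le> expect (\<lambda>S. \<Sum>a\<in>S. (t\<^sup>2) ^ a) + (expect (\<lambda>S. \<Sum>a\<in>S. t ^ a))\<^sup>2"
proof (rule expect_square_le[OF _ _ _ assms])
  (* The roots are the numbers - \<mu> q^r, among them all - x i * y j. *)
  let ?W = "\<Prod>r<n + k - 1. [:\<mu> * q ^ r, 1:]"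
  have "degree ?W \<le> n + k - 1" by (rule order.trans[OF degree_prod_sum_le]) auto
  then show "degree ?W < n + k" using n_pos by simp
  show "0 < coeff ?W a" if "a < n + k" for a
    using that \<mu>_pos q_pos by (intro coeff_prod_linear_pos) auto
  show "poly ?W (- (x i * y j)) = 0" if "i < n" "j < k" for i j
  proof -
    have "e j < k" using e that by (auto simp: bij_betw_def)
    then have "i + e j < n + k - 1" using that by simp
    moreover have "poly [:\<mu> * q ^ (i + e j), 1:] (- (x i * y j)) = 0"
      using that by (simp add: x_eq y_eq power_add)
    ultimately show ?thesis unfolding poly_prod by (intro prod_zero) auto
  qed
qed

end

text \<open>
  The part of a diagonal entry of the transfer matrix for \<open>t = q\<^sup>m\<close> that
  depends analytically on the node \<open>z\<close>, with \<open>R = q\<^sup>k\<close>. In the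
  limit \<open>q \<rightarrow> 1\<close> it becomes the \<open>m\<close>-th power of \<open>(z -
  1) (z + \<mu>) / (z + \<mu> R)\<close>, divided by \<open>z\<close>.
\<close>

definition moment_summand :: "nat \<Rightarrow> real \<Rightarrow> real \<Rightarrow> real \<Rightarrow> 'a::real_normed_field \<Rightarrow> 'a" where
  "moment_summand m q R \<mu> z = (\<Prod>j<m. (z - of_real (q ^ j / q ^ m)) * (z + of_real (\<mu> * q ^ j / q ^ m)) /
     (z + of_real (\<mu> * R * q ^ j / q ^ m))) / z"

context q_pair
begin

text \<open>
  Scaling by \<open>q\<^sup>m\<close> shifts the geometric progression by \<open>m\<close>
  steps, so all but \<open>m\<close> factors at each end cancel.
\<close>

lemma y_factor:
  assumes "0 < w"
  shows "(\<Prod>j<k. (q ^ m * w + y j) / (w + y j)) =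
    q ^ (m * k) * (\<Prod>j<m. (w + \<mu> * q ^ j / q ^ m) / (w + \<mu> * q ^ k * q ^ j / q ^ m))"
proof -
  let ?g = "\<lambda>j. w + \<mu> * q ^ j / q ^ m"
  have g: "0 < ?g j" for j using assms \<mu>_pos q_pos by (intro add_pos_pos) auto
  have "(\<Prod>j<k. (q ^ m * w + y j) / (w + y j)) = (\<Prod>j<k. (q ^ m * w + \<mu> * q ^ e j) / (w + \<mu> * q ^ e j))"
    by (intro prod.cong) (auto simp: y_eq)
  also have "\<dots> = (\<Prod>j<k. (q ^ m * w + \<mu> * q ^ j) / (w + \<mu> * q ^ j))"
    by (rule prod.reindex_bij_betw[OF e])
  also have "\<dots> = (\<Prod>j<k. q ^ m * (?g j / ?g (m + j)))"
  proof (rule prod.cong[OF refl])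
    fix j
    have "q ^ m * ?g j = q ^ m * w + \<mu> * q ^ j" "?g (m + j) = w + \<mu> * q ^ j"
      using q_pos by (simp_all add: distrib_left power_add)
    then show "(q ^ m * w + \<mu> * q ^ j) / (w + \<mu> * q ^ j) = q ^ m * (?g j / ?g (m + j))"
      by (simp only: times_divide_eq_right)
  qed
  also have "\<dots> = q ^ (m * k) * ((\<Prod>j<k. ?g j) / (\<Prod>j<k. ?g (m + j)))"
    by (simp add: prod.distrib prod_dividef power_mult)
  also have "(\<Prod>j<k. ?g j) / (\<Prod>j<k. ?g (m + j)) = (\<Prod>j<m. ?g j) / (\<Prod>j<m. ?g (k + j))"
  proof -
    have "(\<Prod>j<k. ?g j) * (\<Prod>j<m. ?g (k + j)) = (\<Prod>j<m. ?g j) * (\<Prod>j<k. ?g (m + j))"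
      using prod_lessThan_add[of ?g k m] prod_lessThan_add[of ?g m k] by (simp add: add.commute)
    moreover have "(\<Prod>j<m. ?g (k + j)) \<noteq> 0" "(\<Prod>j<k. ?g (m + j)) \<noteq> 0"
      using g by (auto simp: less_imp_neq[THEN not_sym])
    ultimately show ?thesis by (simp add: frac_eq_eq)
  qed
  finally show ?thesis by (simp add: prod_dividef power_add mult.assoc)
qed

text \<open>
  Scaled by \<open>q\<^sup>m\<close>, every node \<open>q\<^sup>i\<close> except the last
  \<open>m\<close> is again a node.
\<close>

lemma x_factor_zero:
  assumes "0 < m" "i + m < n"
  shows "(\<Prod>s\<in>{..<n} - {i}. (q ^ m * q ^ i - q ^ s) / (q ^ i - q ^ s)) = 0"
  using assms by (intro prod_zero bexI[of _ "i + m"]) (auto simp: power_add mult.commute)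

text \<open>
  For the last \<open>m\<close> nodes \<open>p l = q\<^bsup>n - m + l\<^esup>\<close> the
  product telescopes as well. What remains of the denominator are the differences among these
  nodes.
\<close>

lemma x_factor:
  assumes m: "0 < m" "m \<le> n" and l: "l < m"
  defines "p \<equiv> \<lambda>l. q ^ n * (q ^ l / q ^ m)"
  shows "(\<Prod>s\<in>{..<n} - {n - m + l}. (q ^ m * p l - q ^ s) / (p l - q ^ s)) =
    q ^ (m * n) / ((q ^ m - 1) * p l) * (\<Prod>j<m. p l - q ^ j / q ^ m) / (\<Prod>l'\<in>{..<m} - {l}. p l - p l')"
proof -
  let ?i = "n - m + l"
  let ?g = "\<lambda>s. p l - q ^ s / q ^ m"
  have pl: "p l = q ^ ?i"
    using m q_pos by (simp add: p_def power_add power_diff)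
  have qm: "q ^ m \<noteq> 1" using power_eq_power_iff_base[OF q_pos q_neq_1, of m 0] m by simp
  have pl0: "p l \<noteq> 0" using q_pos by (simp add: p_def)
  have i: "?i < n" using m l by simp
  have num: "(q ^ m * p l - p l) * (\<Prod>s\<in>{..<n} - {?i}. q ^ m * p l - q ^ s) = q ^ (m * n) * (\<Prod>s<n. ?g s)"
  proof -
    have "(\<Prod>s<n. q ^ m * p l - q ^ s) = (q ^ m * p l - q ^ ?i) * (\<Prod>s\<in>{..<n} - {?i}. q ^ m * p l - q ^ s)"
      by (rule prod.remove) (use i in auto)
    moreover have "(\<Prod>s<n. q ^ m * p l - q ^ s) = (\<Prod>s<n. q ^ m * ?g s)"
      using q_pos by (intro prod.cong) (auto simp: field_simps)
    ultimately show ?thesis unfolding pl by (simp add: prod.distrib power_mult)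
  qed
  have split: "(\<Prod>s<n. ?g s) = (\<Prod>j<m. ?g j) * (\<Prod>s<n - m. p l - q ^ s)"
  proof -
    have "(\<Prod>s<n. ?g s) = (\<Prod>j<m. ?g j) * (\<Prod>s<n - m. ?g (m + s))"
      using prod_lessThan_add[of ?g m "n - m"] m by simp
    also have "(\<Prod>s<n - m. ?g (m + s)) = (\<Prod>s<n - m. p l - q ^ s)"
      using q_pos by (simp add: power_add)
    finally show ?thesis .
  qed
  have den: "(\<Prod>s\<in>{..<n} - {?i}. p l - q ^ s) = (\<Prod>s<n - m. p l - q ^ s) * (\<Prod>l'\<in>{..<m} - {l}. p l - p l')"
  proof -
    have "{..<n} - {?i} = {..<n - m} \<union> (\<lambda>l'. n - m + l') ` ({..<m} - {l})"
    proof (intro equalityI subsetI)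
      fix s assume s: "s \<in> {..<n} - {?i}"
      show "s \<in> {..<n - m} \<union> (\<lambda>l'. n - m + l') ` ({..<m} - {l})"
      proof (cases "s < n - m")
        case False
        then show ?thesis using s m by (intro UnI2 image_eqI[of _ _ "s - (n - m)"]) auto
      qed simp
    qed (use m l in auto)
    moreover have "{..<n - m} \<inter> (\<lambda>l'. n - m + l') ` ({..<m} - {l}) = {}" by auto
    ultimately have "(\<Prod>s\<in>{..<n} - {?i}. p l - q ^ s) =
       (\<Prod>s<n - m. p l - q ^ s) * (\<Prod>s\<in>(\<lambda>l'. n - m + l') ` ({..<m} - {l}). p l - q ^ s)"
      by (simp add: prod.union_disjoint)
    also have "(\<Prod>s\<in>(\<lambda>l'. n - m + l') ` ({..<m} - {l}). p l - q ^ s) = (\<Prod>l'\<in>{..<m} - {l}. p l - p l')"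
      using m q_pos by (subst prod.reindex) (auto simp: p_def power_add power_diff)
    finally show ?thesis .
  qed
  have "q ^ ?i \<noteq> q ^ s" if "s < n - m" for s
  proof -
    have "?i \<noteq> s" using that by simp
    then show ?thesis unfolding power_eq_power_iff_base[OF q_pos q_neq_1] .
  qed
  then have "(\<Prod>s<n - m. p l - q ^ s) \<noteq> 0"
    unfolding pl by simp
  moreover have "(\<Prod>s\<in>{..<n} - {?i}. q ^ m * p l - q ^ s) =
      q ^ (m * n) * ((\<Prod>j<m. ?g j) * (\<Prod>s<n - m. p l - q ^ s)) / ((q ^ m - 1) * p l)"
    using num pl0 qm unfolding split by (simp add: field_simps)
  moreover have "X = c * (G * D) / d \<Longrightarrow> D \<noteq> 0 \<Longrightarrow> X / (D * Q) = c / d * G / Q" for X c G D d Q :: real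
    by simp
  ultimately show ?thesis
    unfolding prod_dividef den by blast
qed

text \<open>
  The mean is a divided difference of \<open>moment_summand\<close> at \<open>m\<close> points.
  They all tend to the same limit \<open>exp (- \<gamma>)\<close> and the divided difference
  stays bounded, while \<open>1 / (q\<^sup>m - 1)\<close> grows like \<open>n\<close>.
\<close>

theorem expect_geometric_moment:
  assumes m: "0 < m" "m \<le> n"
  defines "p \<equiv> \<lambda>l. q ^ n * (q ^ l / q ^ m)"
  shows "expect (\<lambda>S. \<Sum>a\<in>S. (q ^ m) ^ a) = q ^ (m * (n + k)) / (q ^ m - 1) *
    (\<Sum>l<m. moment_summand m q (q ^ k) \<mu> (p l) / (\<Prod>l'\<in>{..<m} - {l}. p l - p l'))"
proof -
  have tr: "transfer t i i = (\<Prod>s\<in>{..<n} - {i}. (t * q ^ i - q ^ s) / (q ^ i - q ^ s)) *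
      (\<Prod>j<k. (t * q ^ i + y j) / (q ^ i + y j))" if "i < n" for i t
  proof -
    have "{..<n + k} - {i} = ({..<n} - {i}) \<union> {n..<n + k}" using that by auto
    moreover have "({..<n} - {i}) \<inter> {n..<n + k} = {}" by auto
    ultimately have "transfer t i i = (\<Prod>s\<in>{..<n} - {i}. (t * z i - z s) / (z i - z s)) *
        (\<Prod>s\<in>{n..<n + k}. (t * z i - z s) / (z i - z s))"
      unfolding transfer_def poly_lagrange by (simp add: prod.union_disjoint)
    also have "(\<Prod>s\<in>{..<n} - {i}. (t * z i - z s) / (z i - z s)) =
       (\<Prod>s\<in>{..<n} - {i}. (t * q ^ i - q ^ s) / (q ^ i - q ^ s))"
      using that by (intro prod.cong) (auto simp: node_def x_eq)
    also have "(\<Prod>s\<in>{n..<n + k}. (t * z i - z s) / (z i - z s)) = (\<Prod>j<k. (t * q ^ i + y j) / (q ^ i + y j))"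
      by (rule prod.reindex_bij_witness[where i = "\<lambda>j. n + j" and j = "\<lambda>r. r - n"])
        (use that in \<open>auto simp: node_def x_eq\<close>)
    finally show ?thesis .
  qed
  have "expect (\<lambda>S. \<Sum>a\<in>S. (q ^ m) ^ a) = (\<Sum>i<n. transfer (q ^ m) i i)"
    by (rule expect_power_sum)
  also have "\<dots> = (\<Sum>i\<in>(\<lambda>l. n - m + l) ` {..<m}. transfer (q ^ m) i i)"
  proof (rule sum.mono_neutral_right)
    show "\<forall>i\<in>{..<n} - (\<lambda>l. n - m + l) ` {..<m}. transfer (q ^ m) i i = 0"
    proof
      fix i assume i: "i \<in> {..<n} - (\<lambda>l. n - m + l) ` {..<m}"
      have "i + m < n"
      proof (rule ccontr)
        assume "\<not> i + m < n"
        then have "i \<in> (\<lambda>l. n - m + l) ` {..<m}"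
          using i m by (intro image_eqI[of _ _ "i - (n - m)"]) auto
        then show False using i by blast
      qed
      then show "transfer (q ^ m) i i = 0" using i tr[of i] x_factor_zero[OF m(1)] by simp
    qed
  qed (use m in auto)
  also have "\<dots> = (\<Sum>l<m. transfer (q ^ m) (n - m + l) (n - m + l))"
    by (subst sum.reindex) (auto simp: inj_on_def)
  also have "\<dots> = (\<Sum>l<m. q ^ (m * (n + k)) / (q ^ m - 1) *
      (moment_summand m q (q ^ k) \<mu> (p l) / (\<Prod>l'\<in>{..<m} - {l}. p l - p l')))"
  proof (rule sum.cong[OF refl])
    fix l assume "l \<in> {..<m}"
    then have l: "l < m" by simp
    have pl: "q ^ (n - m + l) = p l"
      using m q_pos by (simp add: p_def power_add power_diff)
    have "0 < p l" using q_pos by (simp add: p_def)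
    have "n - m + l < n" using l m by simp
    from tr[OF this, of "q ^ m"] have "transfer (q ^ m) (n - m + l) (n - m + l) =
       (\<Prod>s\<in>{..<n} - {n - m + l}. (q ^ m * p l - q ^ s) / (p l - q ^ s)) *
       (\<Prod>j<k. (q ^ m * p l + y j) / (p l + y j))"
      unfolding pl .
    also have "\<dots> = q ^ (m * n) / ((q ^ m - 1) * p l) * (\<Prod>j<m. p l - q ^ j / q ^ m) / (\<Prod>l'\<in>{..<m} - {l}. p l - p l') *
       (q ^ (m * k) * (\<Prod>j<m. (p l + \<mu> * q ^ j / q ^ m) / (p l + \<mu> * q ^ k * q ^ j / q ^ m)))"
    proof -
      have "(\<Prod>s\<in>{..<n} - {n - m + l}. (q ^ m * p l - q ^ s) / (p l - q ^ s)) =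
          q ^ (m * n) / ((q ^ m - 1) * p l) * (\<Prod>j<m. p l - q ^ j / q ^ m) / (\<Prod>l'\<in>{..<m} - {l}. p l - p l')"
        unfolding p_def by (rule x_factor[OF m l])
      then show ?thesis unfolding y_factor[OF \<open>0 < p l\<close>] by simp
    qed
    also have "\<dots> = q ^ (m * (n + k)) / (q ^ m - 1) *
      (moment_summand m q (q ^ k) \<mu> (p l) / (\<Prod>l'\<in>{..<m} - {l}. p l - p l'))"
    proof -
      have "q ^ (m * (n + k)) = q ^ (m * n) * q ^ (m * k)"
        by (simp add: distrib_left power_add)
      then show ?thesis
        by (simp add: moment_summand_def prod_dividef prod.distrib mult_ac)
    qed
    finally show "transfer (q ^ m) (n - m + l) (n - m + l) = q ^ (m * (n + k)) / (q ^ m - 1) *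
      (moment_summand m q (q ^ k) \<mu> (p l) / (\<Prod>l'\<in>{..<m} - {l}. p l - p l'))" .
  qed
  finally show ?thesis by (simp add: sum_distrib_left)
qed

end

section \<open>The limit of the moments\<close>

text \<open>
  Written as a sum over simple poles, a contour integral with this kernel is a divided
  difference.
\<close>

lemma partial_fractions_distinct:
  fixes p :: "nat \<Rightarrow> complex"
  assumes inj: "inj_on p {..<m}" and m: "0 < m" and w: "\<And>l. l < m \<Longrightarrow> w \<noteq> p l"
  shows "1 / (\<Prod>l<m. w - p l) = (\<Sum>l<m. 1 / ((w - p l) * (\<Prod>l'\<in>{..<m} - {l}. p l - p l')))"
proof -
  let ?L = "\<lambda>l. \<Prod>l'\<in>{..<m} - {l}. [:- p l', 1:]"
  let ?d = "\<lambda>l. \<Prod>l'\<in>{..<m} - {l}. p l - p l'"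
  have d: "?d l \<noteq> 0" if "l < m" for l using that inj by (auto simp: inj_on_def)
  have "(\<Sum>l<m. Polynomial.smult (1 / ?d l) (?L l)) = 1"
  proof (rule poly_eqI_degree[where A = "p ` {..<m}"])
    have card: "card (p ` {..<m}) = m" using inj by (simp add: card_image)
    have deg: "degree (?L l) \<le> m - 1" if "l < m" for l
      by (rule order.trans[OF degree_prod_sum_le]) (use that in auto)
    have "degree (\<Sum>l<m. Polynomial.smult (1 / ?d l) (?L l)) \<le> m - 1"
      by (intro degree_sum_le order.trans[OF degree_smult_le] deg) auto
    then show "degree (\<Sum>l<m. Polynomial.smult (1 / ?d l) (?L l)) < card (p ` {..<m})"
      using card m by simp
    show "degree (1 :: complex poly) < card (p ` {..<m})" using card m by simp
    fix v assume "v \<in> p ` {..<m}"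
    then obtain s where s: "s < m" "v = p s" by auto
    have "(\<Sum>l<m. 1 / ?d l * poly (?L l) (p s)) = (\<Sum>l<m. if s = l then 1 else 0)"
    proof (rule sum.cong[OF refl])
      fix l assume "l \<in> {..<m}"
      have "poly (?L l) (p s) = (\<Prod>l'\<in>{..<m} - {l}. p s - p l')" by (simp add: poly_prod)
      also have "\<dots> = (if s = l then ?d l else 0)"
        using s by (auto intro!: prod_zero)
      finally show "1 / ?d l * poly (?L l) (p s) = (if s = l then 1 else 0)"
        using d[of l] \<open>l \<in> {..<m}\<close> by (simp del: prod_zero_iff)
    qed
    then show "poly (\<Sum>l<m. Polynomial.smult (1 / ?d l) (?L l)) v = poly 1 v"
      using s by (simp add: poly_sum del: prod_zero_iff)
  qed
  then have "poly (\<Sum>l<m. Polynomial.smult (1 / ?d l) (?L l)) w = 1" by simp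
  then have one: "1 = (\<Sum>l<m. (\<Prod>l'\<in>{..<m} - {l}. w - p l') / ?d l)"
    by (simp add: poly_sum poly_prod)
  have "1 / (\<Prod>l<m. w - p l) = (\<Sum>l<m. (\<Prod>l'\<in>{..<m} - {l}. w - p l') / ?d l) / (\<Prod>l<m. w - p l)"
    using one by simp
  also have "\<dots> = (\<Sum>l<m. 1 / ((w - p l) * ?d l))"
    unfolding sum_divide_distrib
  proof (rule sum.cong[OF refl])
    fix l assume l: "l \<in> {..<m}"
    have "(\<Prod>l<m. w - p l) = (w - p l) * (\<Prod>l'\<in>{..<m} - {l}. w - p l')"
      by (rule prod.remove) (use l in auto)
    moreover have "(\<Prod>l'\<in>{..<m} - {l}. w - p l') \<noteq> 0" using w by auto
    ultimately show "(\<Prod>l'\<in>{..<m} - {l}. w - p l') / ?d l / (\<Prod>l<m. w - p l) = 1 / ((w - p l) * ?d l)"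
      by (simp del: prod_zero_iff)
  qed
  finally show ?thesis .
qed

text \<open>
  The limits of the parameters of \<open>q_pair\<close>: \<open>q\<^sup>n \<rightarrow>
  \<alpha>\<close>, \<open>q\<^sup>k \<rightarrow> \<beta>\<close>, and \<open>\<nu>\<close> is
  the limit of \<open>\<mu> q\<^sup>k\<close>. The limit of the moments is governed by
  \<open>F(z) = \<kappa> (z - 1) (z + \<mu>) / ((z - \<alpha>) (z + \<nu>))\<close>. The
  coordinate \<open>\<eta>\<close> with \<open>z = moebius \<eta> = (\<alpha> - \<nu> \<eta>) /
  (1 + \<eta>)\<close> puts its poles at \<open>0\<close> and \<open>\<infinity>\<close>, so
  that \<open>F(z)\<close> becomes \<open>U \<eta> = p / \<eta> + mid + r \<eta>\<close>. The
  point \<open>z = 0\<close> has coordinate \<open>A\<close> and \<open>z = \<infinity>\<close>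
  has coordinate \<open>- 1\<close>. On the circle of radius \<open>rad\<close> the terms
  \<open>p / \<eta>\<close> and \<open>r \<eta>\<close> are complex conjugate, so
  \<open>U\<close> is real there, with the value \<open>V \<phi>\<close> at the angle
  \<open>\<phi>\<close>.
\<close>

locale limit_parameters =
  fixes c \<gamma> \<mu> :: real
  assumes c_pos: "0 < c" and \<gamma>_nonzero: "\<gamma> \<noteq> 0" and \<mu>_pos: "0 < \<mu>"
begin

definition \<alpha> where "\<alpha> = exp (- \<gamma>)"
definition \<beta> where "\<beta> = exp (- \<gamma> * c)"
definition \<kappa> where "\<kappa> = \<alpha> * \<beta>"
definition \<nu> where "\<nu> = \<beta> * \<mu>"
definition A where "A = \<alpha> / \<nu>"
definition r where "r = \<kappa> * (1 + \<nu>) * (\<mu> - \<nu>) / (\<alpha> + \<nu>)\<^sup>2"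
definition p where "p = \<kappa> * (1 - \<alpha>) * (\<alpha> + \<mu>) / (\<alpha> + \<nu>)\<^sup>2"
definition mid where "mid = \<kappa> * ((1 - \<alpha>) * (\<mu> - \<nu>) + (1 + \<nu>) * (\<alpha> + \<mu>)) / (\<alpha> + \<nu>)\<^sup>2"
definition rad where "rad = sqrt (p / r)"

lemma pos: "0 < \<alpha>" "0 < \<beta>" "0 < \<kappa>" "0 < \<nu>" "0 < A"
  using \<mu>_pos by (simp_all add: \<alpha>_def \<beta>_def \<kappa>_def \<nu>_def A_def)

text \<open>
  Equal signs of \<open>r\<close> and \<open>p\<close> are needed for a circle on which
  \<open>U\<close> is real.
\<close>

lemma r_p_sign: "0 < \<gamma> * r" "0 < \<gamma> * p" 
proof -
  have 1: "0 < \<gamma> * (1 - \<alpha>)" 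
    using \<gamma>_nonzero by (cases "0 < \<gamma>") (auto simp: \<alpha>_def zero_less_mult_iff)
  have "0 < \<gamma> * (1 - \<beta>)"
    using \<gamma>_nonzero c_pos by (cases "0 < \<gamma>") (auto simp: \<beta>_def zero_less_mult_iff mult_less_0_iff)
  then have "0 < \<mu> * (\<gamma> * (1 - \<beta>))" using \<mu>_pos by simp
  then have 2: "0 < \<gamma> * (\<mu> - \<nu>)" by (simp add: \<nu>_def algebra_simps)
  have "0 < \<kappa> * (1 + \<nu>) / (\<alpha> + \<nu>)\<^sup>2" "0 < \<kappa> * (\<alpha> + \<mu>) / (\<alpha> + \<nu>)\<^sup>2"
    using pos \<mu>_pos by (auto intro!: divide_pos_pos mult_pos_pos)
  from mult_pos_pos[OF 2 this(1)] mult_pos_pos[OF 1 this(2)]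
  show "0 < \<gamma> * r" "0 < \<gamma> * p" by (simp_all add: r_def p_def mult_ac)
qed

lemma rad_pos: "0 < rad" and p_eq: "p = r * rad\<^sup>2" and r_nonzero: "r \<noteq> 0"
proof -
  have "0 < p / r" using r_p_sign by (auto simp: zero_less_divide_iff zero_less_mult_iff)
  then show "0 < rad" "p = r * rad\<^sup>2" "r \<noteq> 0" by (auto simp: rad_def)
qed

lemma \<kappa>\<mu>: "\<kappa> * \<mu> = \<alpha> * \<nu>" by (simp add: \<kappa>_def \<nu>_def)

text \<open>
  These express \<open>U A = F(0) = 1\<close> and \<open>U (- 1) = F(\<infinity>) =
  \<kappa>\<close>. Consequently \<open>U - 1\<close> is divisible by \<open>\<eta> - A\<close>
  and \<open>U - \<kappa>\<close> by \<open>1 + \<eta>\<close>.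
\<close>

lemma mid_eq: "mid = 1 - r * A - p / A" "mid = \<kappa> + r + p"
proof -
  have s: "\<alpha> + \<nu> \<noteq> 0" using pos by simp
  have \<nu>: "\<nu> \<noteq> 0" "\<alpha> \<noteq> 0" using pos by auto
  let ?D = "(\<alpha> + \<nu>)\<^sup>2"
  have D: "?D * mid = \<kappa> * ((1 - \<alpha>) * (\<mu> - \<nu>) + (1 + \<nu>) * (\<alpha> + \<mu>))"
    "?D * r = \<kappa> * (1 + \<nu>) * (\<mu> - \<nu>)" "?D * p = \<kappa> * (1 - \<alpha>) * (\<alpha> + \<mu>)"
    using s by (simp_all add: mid_def r_def p_def)
  have "?D * (mid + r * A + p / A) = ?D * mid + ?D * r * (\<alpha> / \<nu>) + ?D * p * (\<nu> / \<alpha>)"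
    by (simp add: A_def distrib_left)
  also have "\<dots> * (\<nu> * \<alpha>) = \<kappa> * \<mu> * ?D"
    unfolding D using \<nu> by (simp add: field_simps power2_eq_square)
  also have "\<dots> = ?D * (\<nu> * \<alpha>)" unfolding \<kappa>\<mu> by (simp add: mult_ac)
  finally have "mid + r * A + p / A = 1" using s \<nu> by simp
  then show "mid = 1 - r * A - p / A" by simp
  have "?D * (mid - r - p) = ?D * mid - ?D * r - ?D * p"
    by (simp add: right_diff_distrib)
  also have "\<dots> = ?D * \<kappa>"
    unfolding D by (simp add: algebra_simps power2_eq_square)
  finally show "mid = \<kappa> + r + p" using s by simp
qed

definition V where "V \<phi> = mid + 2 * r * rad * cos \<phi>"

text \<open>
  The real part of \<open>- \<eta> ((U\<^sup>m - 1) / (\<eta> - A) - (U\<^sup>m -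
  \<kappa>\<^sup>m) / (1 + \<eta>))\<close> at \<open>\<eta> = rad * cis \<phi>\<close>, with
  both quotients expanded as geometric sums.
\<close>

definition edge_integrand where
  "edge_integrand m \<phi> = r * (\<Sum>j<m. V \<phi> ^ j * (rad\<^sup>2 / A - rad * cos \<phi>) + \<kappa> ^ (m - Suc j) * (V \<phi> ^ j * (rad\<^sup>2 + rad * cos \<phi>)))"

definition moment where
  "moment m = integral {0..pi} (edge_integrand m) / (\<gamma> * real m * pi)"

definition moebius :: "complex \<Rightarrow> complex" where
  "moebius \<eta> = (of_real \<alpha> - of_real \<nu> * \<eta>) / (1 + \<eta>)"

text \<open>
  The derivative of \<open>moebius\<close>, for the substitution in contour integrals.
\<close>

definition moebius' :: "complex \<Rightarrow> complex" where
  "moebius' \<eta> = - of_real (\<alpha> + \<nu>) / (1 + \<eta>)\<^sup>2"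

definition U :: "complex \<Rightarrow> complex" where
  "U \<eta> = of_real p / \<eta> + of_real mid + of_real r * \<eta>"

lemma one_plus_nonzero:
  fixes \<eta> :: complex
  assumes "norm \<eta> < 1" shows "1 + \<eta> \<noteq> 0"
proof
  assume "1 + \<eta> = 0"
  then have "\<eta> = -1" by (simp add: eq_neg_iff_add_eq_0 add.commute)
  then show False using assms by simp
qed

text \<open>
  Small circles in the coordinate \<open>\<eta>\<close> stay in the half plane in which
  \<open>moment_summand\<close> has no poles: \<open>- 1\<close> and \<open>A\<close>, the
  coordinates of \<open>\<infinity>\<close> and \<open>0\<close>, lie outside.
\<close>

lemma moebius_Re_pos:
  assumes "norm \<eta> < 1" "norm \<eta> < A"
  shows "0 < Re (moebius \<eta>)"
proof -
  let ?s = "norm \<eta>" and ?x = "Re \<eta>"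
  have x: "\<bar>?x\<bar> \<le> ?s" by (rule abs_Re_le_cmod)
  have "?s\<^sup>2 + ?x - ?s * (1 + ?x) = (1 - ?s) * (?x - ?s)" by (simp add: algebra_simps power2_eq_square)
  also have "\<dots> \<le> 0" using assms x by (intro mult_nonneg_nonpos) auto
  finally have "\<nu> * (?s\<^sup>2 + ?x) \<le> \<nu> * (?s * (1 + ?x))" using pos by simp
  also have "\<dots> = (\<nu> * ?s) * (1 + ?x)" by simp
  also have "\<dots> < \<alpha> * (1 + ?x)"
  proof (rule mult_strict_right_mono)
    show "\<nu> * ?s < \<alpha>" using assms(2) pos by (simp add: A_def field_simps)
    show "0 < 1 + ?x" using x assms by linarith
  qed
  finally have *: "0 < \<alpha> * (1 + ?x) - \<nu> * (?s\<^sup>2 + ?x)" by simp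
  have "moebius \<eta> = (of_real \<alpha> - of_real \<nu> * \<eta>) * cnj (1 + \<eta>) / of_real ((norm (1 + \<eta>))\<^sup>2)"
    by (simp only: moebius_def complex_div_cnj[of _ "1 + \<eta>"])
  then have "Re (moebius \<eta>) = Re ((of_real \<alpha> - of_real \<nu> * \<eta>) * cnj (1 + \<eta>)) / (norm (1 + \<eta>))\<^sup>2"
    by (simp only: Re_divide_of_real)
  also have "Re ((of_real \<alpha> - of_real \<nu> * \<eta>) * cnj (1 + \<eta>)) = \<alpha> * (1 + ?x) - \<nu> * (?s\<^sup>2 + ?x)"
    unfolding cmod_power2 by (simp add: algebra_simps power2_eq_square)
  finally show ?thesis using * one_plus_nonzero[OF assms(1)] by simp
qed

lemma moebius_holomorphic: "0 < \<epsilon> \<Longrightarrow> \<epsilon> < 1 \<Longrightarrow> moebius holomorphic_on cball 0 \<epsilon>"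
  unfolding moebius_def using one_plus_nonzero by (intro holomorphic_intros) auto

lemma moebius_eq_real:
  assumes "1 + \<eta> \<noteq> 0" "0 < x"
  shows "moebius \<eta> - of_real x = - (of_real (\<nu> + x) * (\<eta> - of_real ((\<alpha> - x) / (\<nu> + x)))) / (1 + \<eta>)"
proof -
  have "(\<nu> + x) * ((\<alpha> - x) / (\<nu> + x)) = \<alpha> - x"
    using pos(4) assms(2) by simp
  then have "of_real (\<nu> + x) * of_real ((\<alpha> - x) / (\<nu> + x)) = (of_real (\<alpha> - x) :: complex)"
    by (simp only: flip: of_real_mult)
  then show ?thesis using assms(1) by (simp add: moebius_def field_simps)
qed

lemma norm_moebius_inverse:
  assumes "0 < x" "\<bar>\<alpha> - x\<bar> < \<epsilon> * \<nu>" "0 < \<epsilon>"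
  shows "norm (of_real ((\<alpha> - x) / (\<nu> + x)) :: complex) < \<epsilon>"
proof -
  have "\<bar>\<alpha> - x\<bar> < \<epsilon> * (\<nu> + x)" using assms by (auto simp: distrib_left intro: less_trans)
  then show ?thesis
    using pos(4) assms(1) by (simp only: norm_of_real abs_divide) (simp add: divide_less_eq)
qed

lemma moebius_neq_real:
  assumes \<epsilon>: "0 < \<epsilon>" "\<epsilon> < 1" and x: "0 < x" "\<bar>\<alpha> - x\<bar> < \<epsilon> * \<nu>" and \<eta>: "norm \<eta> = \<epsilon>"
  shows "moebius \<eta> \<noteq> of_real x"
proof
  assume eq: "moebius \<eta> = of_real x"
  have n1: "1 + \<eta> \<noteq> 0" using one_plus_nonzero[of \<eta>] \<epsilon> \<eta> by simp
  have "of_real (\<nu> + x) \<noteq> (0::complex)" using pos(4) x(1) by (simp only: of_real_eq_0_iff)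
  then have "\<eta> = of_real ((\<alpha> - x) / (\<nu> + x))"
    using moebius_eq_real[OF n1 x(1)] eq n1 by simp
  then show False using norm_moebius_inverse[OF x \<epsilon>(1)] \<eta> by simp
qed

text \<open>
  Cauchy's formula on a small circle around \<open>\<eta> = 0\<close>, which
  \<open>moebius\<close> maps to a loop around \<open>\<alpha>\<close>. The condition on
  \<open>x\<close> places its coordinate inside the circle.
\<close>

lemma cauchy_moebius:
  assumes \<epsilon>: "0 < \<epsilon>" "\<epsilon> < 1" "\<epsilon> < A"
    and g: "g holomorphic_on {w. 0 < Re w}" and x: "0 < x" "\<bar>\<alpha> - x\<bar> < \<epsilon> * \<nu>"
  shows "((\<lambda>\<eta>. g (moebius \<eta>) * moebius' \<eta> / (moebius \<eta> - of_real x)) has_contour_integral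
     2 * of_real pi * \<i> * g (of_real x)) (circlepath 0 \<epsilon>)"
proof -
  define \<eta>x :: complex where "\<eta>x = of_real ((\<alpha> - x) / (\<nu> + x))"
  let ?G = "\<lambda>\<eta>. g (moebius \<eta>) * (of_real (\<alpha> + \<nu>) / (of_real (\<nu> + x) * (1 + \<eta>)))"
  have \<nu>x: "0 < \<nu> + x" using pos x by simp
  have n1: "1 + \<eta> \<noteq> 0" if "norm \<eta> \<le> \<epsilon>" for \<eta> :: complex using one_plus_nonzero[of \<eta>] that \<epsilon> by simp
  have \<eta>x: "norm \<eta>x < \<epsilon>" unfolding \<eta>x_def by (rule norm_moebius_inverse[OF x \<epsilon>(1)])
  have "?G holomorphic_on cball 0 \<epsilon>"
  proof (intro holomorphic_intros)
    have "moebius ` cball 0 \<epsilon> \<subseteq> {w. 0 < Re w}"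
    proof clarify
      fix \<eta> :: complex assume "\<eta> \<in> cball 0 \<epsilon>"
      then show "0 < Re (moebius \<eta>)" using \<epsilon> by (intro moebius_Re_pos) auto
    qed
    from holomorphic_on_compose_gen[OF moebius_holomorphic[OF \<epsilon>(1,2)] g this]
    show "(\<lambda>\<eta>. g (moebius \<eta>)) holomorphic_on cball 0 \<epsilon>" by (simp add: comp_def)
    show "of_real (\<nu> + x) * (1 + \<eta>) \<noteq> 0" if "\<eta> \<in> cball 0 \<epsilon>" for \<eta> :: complex
    proof -
      have "of_real (\<nu> + x) \<noteq> (0 :: complex)" using \<nu>x by (simp only: of_real_eq_0_iff)
      then show ?thesis using n1[of \<eta>] that by (simp del: of_real_add)
    qed
  qed
  from Cauchy_integral_circlepath_simple[OF this, of \<eta>x] \<eta>x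
  have I1: "((\<lambda>\<eta>. ?G \<eta> / (\<eta> - \<eta>x)) has_contour_integral 2 * of_real pi * \<i> * ?G \<eta>x) (circlepath 0 \<epsilon>)"
    by simp
  have I2: "?G \<eta>x = g (of_real x)"
  proof -
    let ?s = "(\<alpha> + \<nu>) / (\<nu> + x)"
    have s: "?s \<noteq> 0" "(\<nu> + x) * ?s = \<alpha> + \<nu>" "\<alpha> + \<nu> \<noteq> 0" using \<nu>x pos by simp_all
    have "1 + (\<alpha> - x) / (\<nu> + x) = ?s" using \<nu>x by (simp add: field_simps)
    then have 1: "1 + \<eta>x = of_real ?s" unfolding \<eta>x_def by (metis of_real_1 of_real_add)
    have "\<alpha> - \<nu> * ((\<alpha> - x) / (\<nu> + x)) = x * ?s" using \<nu>x by (simp add: field_simps)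
    then have "of_real \<alpha> - of_real \<nu> * \<eta>x = (of_real (x * ?s) :: complex)"
      unfolding \<eta>x_def by (metis of_real_diff of_real_mult)
    then have "moebius \<eta>x = of_real (x * ?s / ?s)"
      unfolding moebius_def 1 by (simp only: of_real_divide)
    moreover have "x * ?s / ?s = x" using s(1) by simp
    ultimately have m: "moebius \<eta>x = of_real x" by (simp only:)
    have "of_real (\<nu> + x) * (1 + \<eta>x) = (of_real (\<alpha> + \<nu>) :: complex)"
      unfolding 1 by (simp only: s(2) flip: of_real_mult)
    then show ?thesis using s(3) by (simp only: m of_real_eq_0_iff divide_self_if if_False mult_1_right)
  qed
  have I3: "?G \<eta> / (\<eta> - \<eta>x) = g (moebius \<eta>) * moebius' \<eta> / (moebius \<eta> - of_real x)"
    if "\<eta> \<in> path_image (circlepath 0 \<epsilon>)" for \<eta>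
  proof -
    have "norm \<eta> = \<epsilon>" using that \<epsilon> by simp
    then have \<eta>: "1 + \<eta> \<noteq> 0" using n1 by simp
    have nx: "of_real (\<nu> + x) \<noteq> (0::complex)" using \<nu>x by (simp flip: of_real_add)
    have eq: "moebius \<eta> - of_real x = - (of_real (\<nu> + x) * (\<eta> - \<eta>x)) / (1 + \<eta>)"
      unfolding \<eta>x_def by (rule moebius_eq_real[OF \<eta> x(1)])
    have alg: "g' * (- S / w\<^sup>2) / (- (B * d) / w) = g' * (S / (B * w)) / d"
      if "w \<noteq> 0" "B \<noteq> 0" for g' S w B d :: complex
      using that by (cases "d = 0") (auto simp: field_simps power2_eq_square)
    show ?thesis unfolding moebius'_def eq by (rule alg[OF \<eta> nx, symmetric])
  qed
  show ?thesis
    by (rule has_contour_integral_eq[OF I1[unfolded I2] I3])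
qed

end

lemma of_real_moment_summand:
  "of_real (moment_summand m q R M (x::real)) = (moment_summand m q R M (of_real x) :: complex)"
  by (simp add: moment_summand_def)

lemma holomorphic_moment_summand:
  assumes "0 < q" "0 < R" "0 < M"
  shows "moment_summand m q R M holomorphic_on {w::complex. 0 < Re w}"
proof -
  have "w + of_real (M * R * q ^ j / q ^ m) \<noteq> 0" if "0 < Re w" for w :: complex and j
  proof
    assume "w + of_real (M * R * q ^ j / q ^ m) = 0"
    then have "Re w + M * R * q ^ j / q ^ m = 0" by (metis Re_complex_of_real plus_complex.sel(1) zero_complex.sel(1))
    moreover have "0 < M * R * q ^ j / q ^ m" using assms by simp
    ultimately show False using that by linarith
  qed
  then show ?thesis
    unfolding moment_summand_def by (intro holomorphic_intros) auto
qed

text \<open>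
  The lower half of the circle contributes as much as the upper half.
\<close>

lemma integral_cos_period:
  fixes h :: "real \<Rightarrow> real"
  assumes h: "continuous_on UNIV h"
  shows "((\<lambda>x. h (cos (2 * pi * x))) has_integral (integral {0..pi} (\<lambda>\<phi>. h (cos \<phi>)) / pi)) {0..1::real}"
proof -
  let ?f = "\<lambda>\<phi>. h (cos \<phi>)"
  define G where "G \<phi> = integral {0..\<phi>} ?f" for \<phi>
  have cont: "continuous_on S ?f" for S
    using continuous_on_compose2[OF h continuous_on_cos[OF continuous_on_id], of S] by simp
  have G: "(G has_vector_derivative ?f \<phi>) (at \<phi> within {0..pi})" if "\<phi> \<in> {0..pi}" for \<phi>
    unfolding G_def by (rule integral_has_vector_derivative[OF cont that])
  have 1: "((\<lambda>x. ?f (2 * pi * x)) has_integral (G (2 * pi * (1 / 2)) / (2 * pi) - G (2 * pi * 0) / (2 * pi))) {0..1 / 2}"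
  proof (rule fundamental_theorem_of_calculus)
    fix x :: real assume x: "x \<in> {0..1 / 2}"
    let ?g = "\<lambda>x. 2 * pi * x"
    have "?g x \<in> {0..pi}" using x by (auto simp: field_simps)
    then have "(G has_real_derivative ?f (?g x)) (at (?g x) within {0..pi})"
      using G[of "?g x"] unfolding has_real_derivative_iff_has_vector_derivative by blast
    moreover have "?g ` {0..1 / 2} \<subseteq> {0..pi}" by auto
    ultimately have "(G has_real_derivative ?f (?g x)) (at (?g x) within ?g ` {0..1 / 2})"
      by (rule DERIV_subset)
    moreover have "(?g has_real_derivative 2 * pi) (at x within {0..1 / 2})"
      by (auto intro!: derivative_eq_intros)
    ultimately have "(G \<circ> ?g has_real_derivative ?f (?g x) * (2 * pi)) (at x within {0..1 / 2})"
      by (rule DERIV_image_chain)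
    from DERIV_cdivide[OF this, of "2 * pi"]
    show "((\<lambda>x. G (2 * pi * x) / (2 * pi)) has_vector_derivative ?f (2 * pi * x)) (at x within {0..1 / 2})"
      unfolding has_real_derivative_iff_has_vector_derivative comp_def by simp
  qed simp
  have 2: "((\<lambda>x. ?f (2 * pi * x)) has_integral (- G (2 * pi * (1 - 1)) / (2 * pi) - (- G (2 * pi * (1 - 1 / 2)) / (2 * pi)))) {1 / 2..1}"
  proof (rule fundamental_theorem_of_calculus)
    fix x :: real assume x: "x \<in> {1 / 2..1}"
    let ?g = "\<lambda>x. 2 * pi * (1 - x)"
    have "?g x \<in> {0..pi}" using x by (auto simp: field_simps)
    then have "(G has_real_derivative ?f (?g x)) (at (?g x) within {0..pi})"
      using G[of "?g x"] unfolding has_real_derivative_iff_has_vector_derivative by blast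
    moreover have "?g ` {1 / 2..1} \<subseteq> {0..pi}" by (auto simp: field_simps)
    ultimately have "(G has_real_derivative ?f (?g x)) (at (?g x) within ?g ` {1 / 2..1})"
      by (rule DERIV_subset)
    moreover have "(?g has_real_derivative - 2 * pi) (at x within {1 / 2..1})"
      by (auto intro!: derivative_eq_intros)
    ultimately have "(G \<circ> ?g has_real_derivative ?f (?g x) * (- 2 * pi)) (at x within {1 / 2..1})"
      by (rule DERIV_image_chain)
    from DERIV_cdivide[OF DERIV_minus[OF this], of "2 * pi"]
    have "((\<lambda>x. - G (?g x) / (2 * pi)) has_vector_derivative ?f (?g x)) (at x within {1 / 2..1})"
      unfolding has_real_derivative_iff_has_vector_derivative comp_def by simp
    moreover have "cos (?g x) = cos (2 * pi * x)" by (simp add: right_diff_distrib cos_diff)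
    ultimately show "((\<lambda>x. - G (?g x) / (2 * pi)) has_vector_derivative ?f (2 * pi * x)) (at x within {1 / 2..1})"
      by simp
  qed simp
  have "G 0 = 0" by (simp add: G_def)
  then show ?thesis
    using has_integral_combine[OF _ _ 1 2] by (simp add: G_def)
qed

context limit_parameters
begin

definition loop_integrand :: "nat \<Rightarrow> real \<Rightarrow> real \<Rightarrow> real \<Rightarrow> real \<Rightarrow> complex \<Rightarrow> complex" where
  "loop_integrand m Q P R M \<eta> = moment_summand m Q R M (moebius \<eta>) * moebius' \<eta> /
     (\<Prod>l<m. moebius \<eta> - of_real (P * (Q ^ l / Q ^ m)))"

text \<open>
  The parameters \<open>(q, q\<^sup>n, q\<^sup>k, \<mu>)\<close> with all points of the divided
  difference so close to \<open>\<alpha>\<close> that they lie inside the loop of radius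
  \<open>\<epsilon>\<close>. The limit \<open>(1, \<alpha>, \<beta>, \<mu>)\<close>, where the
  points coincide and the divided difference itself is not defined, belongs to this set.
\<close>

definition near :: "real \<Rightarrow> nat \<Rightarrow> (real \<times> real \<times> real \<times> real) set" where
  "near \<epsilon> m = {(Q, P, R, M). 0 < Q \<and> 0 < P \<and> 0 < R \<and> 0 < M \<and> (\<forall>l<m. \<bar>\<alpha> - P * (Q ^ l / Q ^ m)\<bar> < \<epsilon> * \<nu>)}"

text \<open>
  The sum over the poles inside the loop, by partial fractions and Cauchy's formula.
\<close>

lemma divided_difference_loop:
  assumes \<epsilon>: "0 < \<epsilon>" "\<epsilon> < 1" "\<epsilon> < A" and m: "0 < m"
    and u: "(Q, P, R, M) \<in> near \<epsilon> m" and Q1: "Q \<noteq> 1"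
  defines "pt \<equiv> \<lambda>l. P * (Q ^ l / Q ^ m)"
  shows "contour_integral (circlepath 0 \<epsilon>) (loop_integrand m Q P R M) =
    2 * of_real pi * \<i> * of_real (\<Sum>l<m. moment_summand m Q R M (pt l) / (\<Prod>l'\<in>{..<m} - {l}. pt l - pt l'))"
proof -
  let ?g = "moment_summand m Q R M :: complex \<Rightarrow> complex"
  have pos': "0 < Q" "0 < P" "0 < R" "0 < M" and near: "\<And>l. l < m \<Longrightarrow> \<bar>\<alpha> - pt l\<bar> < \<epsilon> * \<nu>"
    using u by (auto simp: near_def pt_def)
  have pt: "0 < pt l" for l using pos' by (simp add: pt_def)
  have "pt l = pt l' \<longleftrightarrow> l = l'" for l l'
    using power_eq_power_iff_base[OF pos'(1) Q1] pos' by (simp add: pt_def)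
  then have inj: "inj_on (\<lambda>l. of_real (pt l) :: complex) {..<m}"
    by (simp only: inj_on_def of_real_eq_iff) simp
  let ?d = "\<lambda>l. \<Prod>l'\<in>{..<m} - {l}. of_real (pt l) - (of_real (pt l') :: complex)"
  have "((\<lambda>\<eta>. \<Sum>l<m. 1 / ?d l * (?g (moebius \<eta>) * moebius' \<eta> / (moebius \<eta> - of_real (pt l))))
     has_contour_integral (\<Sum>l<m. 1 / ?d l * (2 * of_real pi * \<i> * ?g (of_real (pt l))))) (circlepath 0 \<epsilon>)"
    using holomorphic_moment_summand[OF pos'(1,3,4)] pt near
    by (intro has_contour_integral_sum has_contour_integral_lmul cauchy_moebius[OF \<epsilon>]) auto
  moreover have "(\<Sum>l<m. 1 / ?d l * (?g (moebius \<eta>) * moebius' \<eta> / (moebius \<eta> - of_real (pt l)))) =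
      loop_integrand m Q P R M \<eta>" if "\<eta> \<in> path_image (circlepath 0 \<epsilon>)" for \<eta>
  proof -
    have "norm \<eta> = \<epsilon>" using that \<epsilon> by simp
    then have "moebius \<eta> \<noteq> of_real (pt l)" if "l < m" for l
      using moebius_neq_real[OF \<epsilon>(1,2) pt near[OF that]] by blast
    from partial_fractions_distinct[OF inj m this]
    have pf: "1 / (\<Prod>l<m. moebius \<eta> - of_real (pt l)) = (\<Sum>l<m. 1 / ((moebius \<eta> - of_real (pt l)) * ?d l))" .
    have "loop_integrand m Q P R M \<eta> = ?g (moebius \<eta>) * moebius' \<eta> * (1 / (\<Prod>l<m. moebius \<eta> - of_real (pt l)))"
      unfolding loop_integrand_def pt_def by simp
    moreover have "1 / d * (a / w) = a * (1 / (w * d))" for a d w :: complex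
      by (simp add: mult.commute)
    ultimately show ?thesis unfolding pf sum_distrib_left by (simp only:)
  qed
  ultimately have "(loop_integrand m Q P R M has_contour_integral
     (\<Sum>l<m. 1 / ?d l * (2 * of_real pi * \<i> * ?g (of_real (pt l))))) (circlepath 0 \<epsilon>)"
    by (rule has_contour_integral_eq)
  then have "contour_integral (circlepath 0 \<epsilon>) (loop_integrand m Q P R M) =
      (\<Sum>l<m. 1 / ?d l * (2 * of_real pi * \<i> * ?g (of_real (pt l))))"
    by (rule contour_integral_unique)
  also have "\<dots> = (\<Sum>l<m. 2 * of_real pi * \<i> * (?g (of_real (pt l)) / ?d l))"
    by (intro sum.cong refl) (simp only: times_divide_eq_left times_divide_eq_right mult_1_left)
  also have "\<dots> = 2 * of_real pi * \<i> * of_real (\<Sum>l<m. moment_summand m Q R M (pt l) / (\<Prod>l'\<in>{..<m} - {l}. pt l - pt l'))"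
    by (simp only: of_real_sum of_real_divide of_real_prod of_real_diff of_real_moment_summand sum_distrib_left)
  finally show ?thesis .
qed

text \<open>
  The reason for the contour integral: it depends continuously on the parameters also at the
  limit point.
\<close>

lemma continuous_loop:
  assumes \<epsilon>: "0 < \<epsilon>" "\<epsilon> < 1" "\<epsilon> < A"
  shows "continuous_on (near \<epsilon> m) (\<lambda>u. contour_integral (circlepath 0 \<epsilon>)
    (loop_integrand m (fst u) (fst (snd u)) (fst (snd (snd u))) (snd (snd (snd u)))))"
proof -
  let ?c = "\<lambda>x. complex_of_real \<epsilon> * exp (2 * of_real pi * \<i> * of_real x)"
  let ?f = "\<lambda>u x. loop_integrand m (fst u) (fst (snd u)) (fst (snd (snd u))) (snd (snd (snd u))) (?c x) *
     (2 * of_real pi * \<i> * of_real \<epsilon> * exp (2 * of_real pi * \<i> * of_real x))"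
  have norm_c: "norm (?c x) = \<epsilon>" for x
    using \<epsilon> by (simp add: norm_mult norm_exp_eq_Re)
  have n1: "1 + ?c x \<noteq> 0" for x using one_plus_nonzero[of "?c x"] norm_c \<epsilon> by simp
  have Re: "0 < Re (moebius (?c x))" for x using moebius_Re_pos[of "?c x"] norm_c \<epsilon> by simp
  have "continuous_on (near \<epsilon> m \<times> cbox 0 1) (\<lambda>(u, x). ?f u x)"
  proof -
    have mo: "continuous_on (near \<epsilon> m \<times> cbox (0::real) 1) (\<lambda>y. moebius (?c (snd y)))"
      unfolding moebius_def using n1 by (intro continuous_intros) auto
    have mo': "continuous_on (near \<epsilon> m \<times> cbox (0::real) 1) (\<lambda>y. moebius' (?c (snd y)))"
      unfolding moebius'_def using n1 by (intro continuous_intros) auto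
    have Qpos: "fst u ^ m \<noteq> 0" "0 < fst u" "0 < fst (snd u)" "0 < fst (snd (snd u))" "0 < snd (snd (snd u))"
      "\<And>l. l < m \<Longrightarrow> \<bar>\<alpha> - fst (snd u) * (fst u ^ l / fst u ^ m)\<bar> < \<epsilon> * \<nu>" if "u \<in> near \<epsilon> m" for u
      using that by (auto simp: near_def)
    have d1: "moebius (?c x) + of_real (snd (snd (snd u)) * fst (snd (snd u)) * fst u ^ j / fst u ^ m) \<noteq> 0"
      if "u \<in> near \<epsilon> m" for u j x
    proof
      assume "moebius (?c x) + of_real (snd (snd (snd u)) * fst (snd (snd u)) * fst u ^ j / fst u ^ m) = 0"
      then have "Re (moebius (?c x)) + snd (snd (snd u)) * fst (snd (snd u)) * fst u ^ j / fst u ^ m = 0"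
        by (metis Re_complex_of_real plus_complex.sel(1) zero_complex.sel(1))
      moreover have "0 < snd (snd (snd u)) * fst (snd (snd u)) * fst u ^ j / fst u ^ m"
        using Qpos[OF that] by simp
      ultimately show False using Re[of x] by linarith
    qed
    have d2: "moebius (?c x) \<noteq> 0" for x using Re[of x] by auto
    have d3: "moebius (?c x) - of_real (fst (snd u) * (fst u ^ l / fst u ^ m)) \<noteq> 0"
      if "u \<in> near \<epsilon> m" "l < m" for u l x
      using moebius_neq_real[OF \<epsilon>(1,2) _ Qpos(6)[OF that] norm_c] Qpos[OF that(1)] by simp
    show ?thesis
      unfolding split_def loop_integrand_def moment_summand_def
      by (intro continuous_intros mo mo')
        (use Qpos d1 d2 d3 in \<open>auto simp del: of_real_divide of_real_mult of_real_power\<close>)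
  qed
  from integral_continuous_on_param[OF this]
  show ?thesis
    unfolding contour_integral_integral vector_derivative_circlepath
    by (simp add: circlepath_def part_circlepath_def linepath_def cbox_interval mult_ac)
qed

text \<open>
  A residue at \<open>0\<close>; its value does not depend on the radius, so that these
  integrals may be moved to the circle on which \<open>U\<close> is real.
\<close>

lemma laurent_loop:
  assumes "0 < \<rho>"
  shows "((\<lambda>\<eta>. U \<eta> ^ j * (of_real a + of_real b / \<eta>)) has_contour_integral
     of_real (2 * pi) * \<i> / fact j * (deriv ^^ j) (\<lambda>\<eta>. (of_real p + of_real mid * \<eta> + of_real r * \<eta>\<^sup>2) ^ j * (of_real a * \<eta> + of_real b)) 0)
     (circlepath 0 \<rho>)"
proof -
  let ?P = "\<lambda>\<eta>::complex. (of_real p + of_real mid * \<eta> + of_real r * \<eta>\<^sup>2) ^ j * (of_real a * \<eta> + of_real b)"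
  have "((\<lambda>\<eta>. ?P \<eta> / (\<eta> - 0) ^ Suc j) has_contour_integral
     (2 * pi * \<i>) / (fact j) * (deriv ^^ j) ?P 0) (circlepath 0 \<rho>)"
    by (rule Cauchy_has_contour_integral_higher_derivative_circlepath)
      (use assms in \<open>auto intro!: continuous_intros holomorphic_intros\<close>)
  then show ?thesis
  proof (rule has_contour_integral_eq)
    fix \<eta> :: complex assume "\<eta> \<in> path_image (circlepath 0 \<rho>)"
    then have "\<eta> \<noteq> 0" using assms by auto
    then have eq: "of_real p + of_real mid * \<eta> + of_real r * \<eta>\<^sup>2 = U \<eta> * \<eta>"
      "of_real a + of_real b / \<eta> = (of_real a * \<eta> + of_real b) / \<eta>"
      by (simp_all add: U_def field_simps power2_eq_square)
    then show "?P \<eta> / (\<eta> - 0) ^ Suc j = U \<eta> ^ j * (of_real a + of_real b / \<eta>)"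
      unfolding eq using \<open>\<eta> \<noteq> 0\<close> by (simp add: power_mult_distrib)
  qed
qed

lemma Re_laurent_loop:
  assumes "0 < \<rho>"
  shows "Re (contour_integral (circlepath 0 \<rho>) (\<lambda>\<eta>. U \<eta> ^ j * (of_real a + of_real b / \<eta>)) / (2 * of_real pi * \<i>)) =
    integral {0..pi} (\<lambda>\<phi>. V \<phi> ^ j * (a * rad * cos \<phi> + b)) / pi"
proof -
  let ?f = "\<lambda>\<eta>. U \<eta> ^ j * (of_real a + of_real b / \<eta>)"
  let ?c = "\<lambda>x. complex_of_real rad * exp (2 * of_real pi * \<i> * of_real x)"
  let ?h = "\<lambda>x. (mid + 2 * r * rad * x) ^ j * (a * rad * x + b)"
  have "(?f has_contour_integral contour_integral (circlepath 0 rad) ?f) (circlepath 0 rad)"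
    by (rule has_contour_integral_integral[OF has_contour_integral_integrable[OF laurent_loop[OF rad_pos]]])
  then have "((\<lambda>x. ?f (circlepath 0 rad x) * vector_derivative (circlepath 0 rad) (at x)) has_integral
     contour_integral (circlepath 0 rad) ?f) {0..1}"
    unfolding has_contour_integral by simp
  then have I: "((\<lambda>x. ?f (?c x) * (2 * of_real pi * \<i> * ?c x)) has_integral contour_integral (circlepath 0 rad) ?f) {0..1}"
    unfolding vector_derivative_circlepath by (simp add: circlepath_def part_circlepath_def linepath_def mult_ac)
  have eq: "Re (?f (?c x) * (2 * of_real pi * \<i> * ?c x) / (2 * of_real pi * \<i>)) = ?h (cos (2 * pi * x))" for x
  proof -
    let ?z = "?c x"
    have Re: "Re ?z = rad * cos (2 * pi * x)" by (simp add: Re_exp)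
    have norm: "norm ?z = rad" using rad_pos by (simp add: norm_mult norm_exp_eq_Re)
    then have z0: "?z \<noteq> 0" using rad_pos by auto
    have "of_real p = of_real r * (?z * cnj ?z)"
      unfolding p_eq complex_norm_square[symmetric] norm by simp
    then have "of_real p / ?z = of_real r * cnj ?z" using z0 by (simp del: complex_cnj_mult)
    then have "U ?z = of_real mid + of_real r * (?z + cnj ?z)"
      unfolding U_def by (simp add: distrib_left del: complex_cnj_mult)
    also have "\<dots> = of_real (mid + 2 * r * rad * cos (2 * pi * x))"
      unfolding complex_add_cnj Re by simp
    finally have U: "U ?z = of_real (mid + 2 * r * rad * cos (2 * pi * x))" .
    have "?f ?z * (2 * of_real pi * \<i> * ?z) / (2 * of_real pi * \<i>) = U ?z ^ j * (of_real a * ?z + of_real b)"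
      using z0 by (simp add: field_simps)
    also have "\<dots> = of_real ((mid + 2 * r * rad * cos (2 * pi * x)) ^ j) * (of_real a * ?z + of_real b)"
      unfolding U by (simp only: of_real_power)
    finally have "?f ?z * (2 * of_real pi * \<i> * ?z) / (2 * of_real pi * \<i>) =
      of_real ((mid + 2 * r * rad * cos (2 * pi * x)) ^ j) * (of_real a * ?z + of_real b)" .
    moreover have "Re (of_real s * (of_real a * w + of_real b)) = s * (a * Re w + b)" for s w
      by simp
    ultimately have "Re (?f ?z * (2 * of_real pi * \<i> * ?z) / (2 * of_real pi * \<i>)) =
        (mid + 2 * r * rad * cos (2 * pi * x)) ^ j * (a * Re ?z + b)"
      by (simp only:)
    then show ?thesis unfolding Re by (simp add: mult_ac)
  qed
  have "((\<lambda>x. Re (?f (?c x) * (2 * of_real pi * \<i> * ?c x) / (2 * of_real pi * \<i>))) has_integral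
     Re (contour_integral (circlepath 0 rad) ?f / (2 * of_real pi * \<i>))) {0..1}"
    using has_integral_linear[OF has_integral_mult_left[OF I, of "1 / (2 * of_real pi * \<i>)"] bounded_linear_Re]
    by (simp add: comp_def)
  then have "((\<lambda>x. ?h (cos (2 * pi * x))) has_integral
     Re (contour_integral (circlepath 0 rad) ?f / (2 * of_real pi * \<i>))) {0..1}"
    unfolding eq .
  moreover have "((\<lambda>x. ?h (cos (2 * pi * x))) has_integral (integral {0..pi} (\<lambda>\<phi>. ?h (cos \<phi>)) / pi)) {0..1}"
    by (rule integral_cos_period) (intro continuous_intros)
  ultimately have "Re (contour_integral (circlepath 0 rad) ?f / (2 * of_real pi * \<i>)) = integral {0..pi} (\<lambda>\<phi>. ?h (cos \<phi>)) / pi"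
    by (rule has_integral_unique)
  moreover have "contour_integral (circlepath 0 \<rho>) ?f = contour_integral (circlepath 0 rad) ?f"
    using contour_integral_unique[OF laurent_loop[OF assms]] contour_integral_unique[OF laurent_loop[OF rad_pos]] by simp
  ultimately show ?thesis by (simp add: V_def)
qed

end

context limit_parameters
begin

lemma laurent_loop_integrable:
  assumes "0 < \<rho>"
  shows "((\<lambda>\<eta>. U \<eta> ^ j * (of_real a + of_real b / \<eta>)) has_contour_integral
    contour_integral (circlepath 0 \<rho>) (\<lambda>\<eta>. U \<eta> ^ j * (of_real a + of_real b / \<eta>))) (circlepath 0 \<rho>)"
  by (rule has_contour_integral_integral[OF has_contour_integral_integrable[OF laurent_loop[OF assms]]])

lemma U_moebius:
  assumes "1 + \<eta> \<noteq> 0" "\<eta> \<noteq> 0"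
  shows "of_real \<kappa> * ((moebius \<eta> - 1) * (moebius \<eta> + of_real \<mu>) / (moebius \<eta> + of_real \<nu>)) / (moebius \<eta> - of_real \<alpha>) = U \<eta>"
proof -
  let ?D = "(\<alpha> + \<nu>)\<^sup>2" and ?w = "moebius \<eta>" and ?s = "of_real (\<alpha> + \<nu>) :: complex"
  have s: "\<alpha> + \<nu> \<noteq> 0" using pos by simp
  have s': "?s \<noteq> 0" using s by (simp only: of_real_eq_0_iff not_False_eq_True)
  have D: "?D * mid = \<kappa> * ((1 - \<alpha>) * (\<mu> - \<nu>) + (1 + \<nu>) * (\<alpha> + \<mu>))"
    "?D * r = \<kappa> * (1 + \<nu>) * (\<mu> - \<nu>)" "?D * p = \<kappa> * (1 - \<alpha>) * (\<alpha> + \<mu>)"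
    using s by (simp_all add: mid_def r_def p_def)
  have w: "(1 + \<eta>) * (?w - of_real \<alpha>) = - ?s * \<eta>" "(1 + \<eta>) * (?w + of_real \<nu>) = ?s"
    "(1 + \<eta>) * (?w - 1) = of_real (\<alpha> - 1) - of_real (\<nu> + 1) * \<eta>"
    "(1 + \<eta>) * (?w + of_real \<mu>) = of_real (\<alpha> + \<mu>) + of_real (\<mu> - \<nu>) * \<eta>"
  proof -
    have "(1 + \<eta>) * ?w = of_real \<alpha> - of_real \<nu> * \<eta>" using assms by (simp add: moebius_def)
    then have "(1 + \<eta>) * (?w + v) = of_real \<alpha> - of_real \<nu> * \<eta> + (1 + \<eta>) * v" for v
      by (simp only: distrib_left)
    from this[of "- of_real \<alpha>"] this[of "of_real \<nu>"] this[of "- 1"] this[of "of_real \<mu>"]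
    show "(1 + \<eta>) * (?w - of_real \<alpha>) = - ?s * \<eta>" "(1 + \<eta>) * (?w + of_real \<nu>) = ?s"
      "(1 + \<eta>) * (?w - 1) = of_real (\<alpha> - 1) - of_real (\<nu> + 1) * \<eta>"
      "(1 + \<eta>) * (?w + of_real \<mu>) = of_real (\<alpha> + \<mu>) + of_real (\<mu> - \<nu>) * \<eta>"
      by (simp_all add: algebra_simps)
  qed
  have U\<eta>: "U \<eta> * \<eta> = of_real p + of_real mid * \<eta> + of_real r * \<eta>\<^sup>2"
    using assms(2) by (simp add: U_def field_simps power2_eq_square)
  have "U \<eta> * (- ?s * \<eta> * ?s) = - (of_real ?D * (U \<eta> * \<eta>))"
  proof -
    have "u * (- s * v * s) = - (s\<^sup>2 * (u * v))" for u s v :: complex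
      by (simp add: power2_eq_square)
    then show ?thesis by (simp only: of_real_power)
  qed
  also have "\<dots> = - (of_real (?D * p) + of_real (?D * mid) * \<eta> + of_real (?D * r) * \<eta>\<^sup>2)"
    unfolding U\<eta> by (simp only: of_real_mult distrib_left mult.assoc)
  also have "\<dots> = of_real \<kappa> * ((of_real (\<alpha> - 1) - of_real (\<nu> + 1) * \<eta>) * (of_real (\<alpha> + \<mu>) + of_real (\<mu> - \<nu>) * \<eta>))"
    unfolding D by (simp add: algebra_simps power2_eq_square)
  finally have main: "U \<eta> * (((1 + \<eta>) * (?w - of_real \<alpha>)) * ((1 + \<eta>) * (?w + of_real \<nu>))) =
      of_real \<kappa> * (((1 + \<eta>) * (?w - 1)) * ((1 + \<eta>) * (?w + of_real \<mu>)))"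
    unfolding w by (simp only: mult.assoc)
  have "(1 + \<eta>) * (?w - of_real \<alpha>) \<noteq> 0" "(1 + \<eta>) * (?w + of_real \<nu>) \<noteq> 0"
    unfolding w using s' assms by (simp_all del: of_real_add)
  then have n: "?w - of_real \<alpha> \<noteq> 0" "?w + of_real \<nu> \<noteq> 0" by auto
  have "(1 + \<eta>) * (1 + \<eta>) * (U \<eta> * ((?w - of_real \<alpha>) * (?w + of_real \<nu>))) =
     (1 + \<eta>) * (1 + \<eta>) * (of_real \<kappa> * ((?w - 1) * (?w + of_real \<mu>)))"
    using main by (simp only: mult_ac)
  then have "U \<eta> * ((?w - of_real \<alpha>) * (?w + of_real \<nu>)) = of_real \<kappa> * ((?w - 1) * (?w + of_real \<mu>))"
    using assms by simp
  then have "of_real \<kappa> * ((?w - 1) * (?w + of_real \<mu>)) / ((?w - of_real \<alpha>) * (?w + of_real \<nu>)) = U \<eta>"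
    using n by (metis no_zero_divisors nonzero_mult_div_cancel_right)
  then show ?thesis by (simp add: mult_ac)
qed

lemma dlog_moebius:
  assumes "1 + \<eta> \<noteq> 0" "\<eta> \<noteq> of_real A"
  shows "moebius' \<eta> / moebius \<eta> = 1 / (\<eta> - of_real A) - 1 / (1 + \<eta>)"
proof -
  have \<nu>: "of_real \<nu> \<noteq> (0::complex)" using pos by simp
  have a: "of_real \<alpha> = of_real \<nu> * (of_real A :: complex)"
    using pos by (simp add: A_def)
  have "moebius \<eta> = - (of_real \<nu> * (\<eta> - of_real A)) / (1 + \<eta>)"
    unfolding moebius_def a by (simp add: algebra_simps)
  moreover have "moebius' \<eta> = - (of_real \<nu> * (1 + of_real A)) / (1 + \<eta>)\<^sup>2"
    unfolding moebius'_def of_real_add a by (simp add: algebra_simps)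
  moreover have "- (v * (1 + B)) / w\<^sup>2 / (- (v * d) / w) = (1 + B) / (w * d)"
    if "v \<noteq> 0" "w \<noteq> 0" "d \<noteq> 0" for v w d B :: complex
    using that by (simp add: field_simps power2_eq_square)
  ultimately have "moebius' \<eta> / moebius \<eta> = (1 + of_real A) / ((1 + \<eta>) * (\<eta> - of_real A))"
    using \<nu> assms by simp
  then show ?thesis using assms by (simp add: diff_frac_eq algebra_simps)
qed

text \<open>
  In the coordinate \<open>\<eta>\<close> the limit integrand is \<open>U\<^sup>m (1 / (\<eta> -
  A) - 1 / (1 + \<eta>))\<close>. Replacing \<open>U\<^sup>m\<close> by \<open>1\<close> in the
  first term and by \<open>\<kappa>\<^sup>m\<close> in the second leaves a function without
  poles inside the small circle. The difference is a Laurent polynomial, because \<open>U -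
  1\<close> and \<open>U - \<kappa>\<close> vanish at \<open>A\<close> and \<open>- 1\<close>.
  The circle of radius \<open>rad\<close> may surround \<open>A\<close> or \<open>- 1\<close>,
  so this splitting has to precede the change of the radius.
\<close>

lemma loop_limit_value:
  assumes \<epsilon>: "0 < \<epsilon>" "\<epsilon> < 1" "\<epsilon> < A" and m: "0 < m"
  shows "Re (of_real (\<kappa> ^ m) * contour_integral (circlepath 0 \<epsilon>) (loop_integrand m 1 \<alpha> \<beta> \<mu>) / (2 * of_real pi * \<i>)) =
    - integral {0..pi} (edge_integrand m) / pi"
proof -
  let ?X = "\<lambda>j a b. contour_integral (circlepath 0 \<epsilon>) (\<lambda>\<eta>. U \<eta> ^ j * (of_real a + of_real b / \<eta>))"
  let ?I = "\<lambda>j a b. integral {0..pi} (\<lambda>\<phi>. V \<phi> ^ j * (a * rad * cos \<phi> + b))"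
  let ?e = "\<lambda>\<eta>. 1 / (\<eta> - of_real A) - of_real (\<kappa> ^ m) / (1 + \<eta>)"
  let ?F = "\<lambda>\<eta>. ?e \<eta> + ((\<Sum>j<m. U \<eta> ^ j * (of_real r + of_real (- (p / A)) / \<eta>)) -
      (\<Sum>j<m. of_real (\<kappa> ^ (m - Suc j)) * (U \<eta> ^ j * (of_real r + of_real p / \<eta>))))"
  have loop: "of_real (\<kappa> ^ m) * loop_integrand m 1 \<alpha> \<beta> \<mu> \<eta> = ?F \<eta>" if "\<eta> \<in> path_image (circlepath 0 \<epsilon>)" for \<eta>
  proof -
    have n: "norm \<eta> = \<epsilon>" using that \<epsilon> by simp
    have \<eta>: "1 + \<eta> \<noteq> 0" "\<eta> \<noteq> 0" "\<eta> \<noteq> of_real A"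
      using one_plus_nonzero[of \<eta>] n \<epsilon> by auto
    let ?w = "moebius \<eta>"
    have li: "loop_integrand m 1 \<alpha> \<beta> \<mu> \<eta> =
        ((?w - 1) * (?w + of_real \<mu>) / (?w + of_real \<nu>)) ^ m / ?w * moebius' \<eta> / (?w - of_real \<alpha>) ^ m"
      by (simp add: loop_integrand_def moment_summand_def \<nu>_def mult.commute)
    have "of_real (\<kappa> ^ m) * loop_integrand m 1 \<alpha> \<beta> \<mu> \<eta> =
       (of_real \<kappa> * ((?w - 1) * (?w + of_real \<mu>) / (?w + of_real \<nu>)) / (?w - of_real \<alpha>)) ^ m * (moebius' \<eta> / ?w)"
    proof -
      have "a ^ m * (X ^ m / w * d / Y ^ m) = (a * X / Y) ^ m * (d / w)" for a X Y w d :: complex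
        by (simp add: power_mult_distrib power_divide mult_ac)
      then show ?thesis unfolding li by (simp only: of_real_power)
    qed
    also have "\<dots> = U \<eta> ^ m * (1 / (\<eta> - of_real A) - 1 / (1 + \<eta>))"
      unfolding U_moebius[OF \<eta>(1,2)] dlog_moebius[OF \<eta>(1,3)] ..
    also have "\<dots> = U \<eta> ^ m / (\<eta> - of_real A) - U \<eta> ^ m / (1 + \<eta>)"
      by (simp add: right_diff_distrib)
    also have "U \<eta> ^ m / (\<eta> - of_real A) = 1 / (\<eta> - of_real A) + (\<Sum>j<m. U \<eta> ^ j * (of_real r + of_real (- (p / A)) / \<eta>))"
    proof -
      have "U \<eta> - 1 = (\<eta> - of_real A) * (of_real r + of_real (- (p / A)) / \<eta>)"
        using pos \<eta>(2) by (simp add: U_def mid_eq(1) field_simps)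
      then have "U \<eta> ^ m - 1 = (\<eta> - of_real A) * ((of_real r + of_real (- (p / A)) / \<eta>) * (\<Sum>j<m. U \<eta> ^ j))"
        unfolding power_diff_1_eq by simp
      then have "U \<eta> ^ m = 1 + (\<eta> - of_real A) * ((of_real r + of_real (- (p / A)) / \<eta>) * (\<Sum>j<m. U \<eta> ^ j))"
        by (simp add: algebra_simps)
      moreover have "(1 + a * (b * S)) / a = 1 / a + b * S" if "a \<noteq> 0" for a b S :: complex
        using that by (simp add: field_simps)
      ultimately have "U \<eta> ^ m / (\<eta> - of_real A) = 1 / (\<eta> - of_real A) +
          (of_real r + of_real (- (p / A)) / \<eta>) * (\<Sum>j<m. U \<eta> ^ j)"
        using \<eta>(3) by (simp only: right_minus_eq not_False_eq_True)
      moreover have "(\<Sum>j<m. U \<eta> ^ j * b) = b * (\<Sum>j<m. U \<eta> ^ j)" for b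
        by (simp add: sum_distrib_left mult.commute)
      ultimately show ?thesis by (simp only:)
    qed
    also have "U \<eta> ^ m / (1 + \<eta>) = of_real (\<kappa> ^ m) / (1 + \<eta>) +
        (\<Sum>j<m. of_real (\<kappa> ^ (m - Suc j)) * (U \<eta> ^ j * (of_real r + of_real p / \<eta>)))"
    proof -
      have "U \<eta> - of_real \<kappa> = (1 + \<eta>) * (of_real r + of_real p / \<eta>)"
        using \<eta>(2) by (simp add: U_def mid_eq(2) field_simps)
      then have "U \<eta> ^ m - of_real \<kappa> ^ m = (1 + \<eta>) * ((of_real r + of_real p / \<eta>) * (\<Sum>j<m. of_real \<kappa> ^ (m - Suc j) * U \<eta> ^ j))"
        unfolding diff_power_eq_sum power_diff_sumr2 by simp
      then have "U \<eta> ^ m = of_real \<kappa> ^ m + (1 + \<eta>) * ((of_real r + of_real p / \<eta>) * (\<Sum>j<m. of_real \<kappa> ^ (m - Suc j) * U \<eta> ^ j))"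
        by (simp add: algebra_simps)
      moreover have "(c + a * (b * S)) / a = c / a + b * S" if "a \<noteq> 0" for a b c S :: complex
        using that by (simp add: field_simps)
      ultimately have "U \<eta> ^ m / (1 + \<eta>) = of_real (\<kappa> ^ m) / (1 + \<eta>) +
          (of_real r + of_real p / \<eta>) * (\<Sum>j<m. of_real \<kappa> ^ (m - Suc j) * U \<eta> ^ j)"
        using \<eta>(1) by (simp only: of_real_power)
      then show ?thesis by (simp only: sum_distrib_left mult_ac of_real_power)
    qed
    finally show ?thesis by (simp only: add_diff_eq diff_add_eq diff_diff_eq add_ac)
  qed
  (* The poles A and -1 lie outside the small circle. *)
  have "(?e has_contour_integral 0) (circlepath 0 \<epsilon>)"
  proof (rule Cauchy_theorem_disc_simple)
    show "?e holomorphic_on ball 0 (min 1 A)"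
      using one_plus_nonzero pos by (intro holomorphic_intros) (auto simp: norm_minus_commute)
    show "path_image (circlepath 0 \<epsilon>) \<subseteq> ball 0 (min 1 A)" using \<epsilon> by auto
  qed auto
  then have "(?F has_contour_integral (0 + ((\<Sum>j<m. ?X j r (- (p / A))) - (\<Sum>j<m. of_real (\<kappa> ^ (m - Suc j)) * ?X j r p)))) (circlepath 0 \<epsilon>)"
    by (intro has_contour_integral_add has_contour_integral_diff has_contour_integral_sum
        has_contour_integral_lmul laurent_loop_integrable[OF \<epsilon>(1)]) auto
  then have "((\<lambda>\<eta>. of_real (\<kappa> ^ m) * loop_integrand m 1 \<alpha> \<beta> \<mu> \<eta>) has_contour_integral
      (0 + ((\<Sum>j<m. ?X j r (- (p / A))) - (\<Sum>j<m. of_real (\<kappa> ^ (m - Suc j)) * ?X j r p)))) (circlepath 0 \<epsilon>)"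
    by (rule has_contour_integral_eq) (simp only: loop)
  from has_contour_integral_lmul[OF this, of "1 / of_real (\<kappa> ^ m)"]
  have "(loop_integrand m 1 \<alpha> \<beta> \<mu> has_contour_integral
      1 / of_real (\<kappa> ^ m) * ((\<Sum>j<m. ?X j r (- (p / A))) - (\<Sum>j<m. of_real (\<kappa> ^ (m - Suc j)) * ?X j r p))) (circlepath 0 \<epsilon>)"
    using pos(3) by (simp add: eta_contract_eq)
  then have "of_real (\<kappa> ^ m) * contour_integral (circlepath 0 \<epsilon>) (loop_integrand m 1 \<alpha> \<beta> \<mu>) =
      (\<Sum>j<m. ?X j r (- (p / A))) - (\<Sum>j<m. of_real (\<kappa> ^ (m - Suc j)) * ?X j r p)"
    using pos(3) by (simp add: contour_integral_unique)
  then have "of_real (\<kappa> ^ m) * contour_integral (circlepath 0 \<epsilon>) (loop_integrand m 1 \<alpha> \<beta> \<mu>) / (2 * of_real pi * \<i>) =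
      (\<Sum>j<m. ?X j r (- (p / A)) / (2 * of_real pi * \<i>)) - (\<Sum>j<m. of_real (\<kappa> ^ (m - Suc j)) * (?X j r p / (2 * of_real pi * \<i>)))"
    by (simp only: diff_divide_distrib sum_divide_distrib times_divide_eq_right)
  moreover have "Re (of_real s * z) = s * Re z" for s z by simp
  ultimately have "Re (of_real (\<kappa> ^ m) * contour_integral (circlepath 0 \<epsilon>) (loop_integrand m 1 \<alpha> \<beta> \<mu>) / (2 * of_real pi * \<i>)) =
      (\<Sum>j<m. ?I j r (- (p / A)) / pi) - (\<Sum>j<m. \<kappa> ^ (m - Suc j) * (?I j r p / pi))"
    by (simp only: minus_complex.sel Re_sum Re_laurent_loop[OF \<epsilon>(1)])
  also have "\<dots> = - ((\<Sum>j<m. - ?I j r (- (p / A))) + (\<Sum>j<m. \<kappa> ^ (m - Suc j) * ?I j r p)) / pi"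
    by (simp add: sum_negf sum_divide_distrib[symmetric] diff_divide_distrib)
  also have "(\<Sum>j<m. - ?I j r (- (p / A))) + (\<Sum>j<m. \<kappa> ^ (m - Suc j) * ?I j r p) = integral {0..pi} (edge_integrand m)"
  proof (rule integral_unique[symmetric])
    have I: "((\<lambda>\<phi>. V \<phi> ^ j * (a * rad * cos \<phi> + b)) has_integral ?I j a b) {0..pi}" for j a b
      unfolding V_def by (intro integrable_integral integrable_continuous_real continuous_intros)
    have I2: "((\<lambda>\<phi>. (\<Sum>j<m. - (V \<phi> ^ j * (r * rad * cos \<phi> + - (p / A)))) + (\<Sum>j<m. \<kappa> ^ (m - Suc j) * (V \<phi> ^ j * (r * rad * cos \<phi> + p))))
       has_integral ((\<Sum>j<m. - ?I j r (- (p / A))) + (\<Sum>j<m. \<kappa> ^ (m - Suc j) * ?I j r p))) {0..pi}"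
      by (intro has_integral_add has_integral_sum has_integral_neg has_integral_mult_right I) auto
    have eq: "(\<Sum>j<m. - (V \<phi> ^ j * (r * rad * cos \<phi> + - (p / A)))) + (\<Sum>j<m. \<kappa> ^ (m - Suc j) * (V \<phi> ^ j * (r * rad * cos \<phi> + p))) =
        edge_integrand m \<phi>" for \<phi>
      unfolding edge_integrand_def sum.distrib[symmetric] sum_distrib_left
      by (intro sum.cong refl) (simp add: p_eq algebra_simps)
    show "(edge_integrand m has_integral ((\<Sum>j<m. - ?I j r (- (p / A))) + (\<Sum>j<m. \<kappa> ^ (m - Suc j) * ?I j r p))) {0..pi}"
      by (rule has_integral_eq[OF eq I2])
  qed
  finally show ?thesis .
qed

theorem moment_limit:
  fixes Q M :: "nat \<Rightarrow> real" and k :: "nat \<Rightarrow> nat"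
  assumes m: "0 < m"
    and Q1: "Q \<longlonglongrightarrow> 1" "\<forall>\<^sub>F n in sequentially. Q n \<noteq> 1" and Qn: "(\<lambda>n. Q n ^ n) \<longlonglongrightarrow> \<alpha>" and Qk: "(\<lambda>n. Q n ^ k n) \<longlonglongrightarrow> \<beta>"
    and M: "M \<longlonglongrightarrow> \<mu>" and D: "(\<lambda>n. real n * (Q n ^ m - 1)) \<longlonglongrightarrow> - \<gamma> * real m"
  defines "pt \<equiv> \<lambda>n l. Q n ^ n * (Q n ^ l / Q n ^ m)"
  shows "(\<lambda>n. (Q n ^ (m * (n + k n)) / (Q n ^ m - 1) *
     (\<Sum>l<m. moment_summand m (Q n) (Q n ^ k n) (M n) (pt n l) / (\<Prod>l'\<in>{..<m} - {l}. pt n l - pt n l'))) / real n) \<longlonglongrightarrow> moment m"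
proof -
  (* Small enough to exclude the coordinates -1 and A of \<infinity> and 0. *)
  define \<epsilon> where "\<epsilon> = min 1 A / 2"
  have \<epsilon>: "0 < \<epsilon>" "\<epsilon> < 1" "\<epsilon> < A" using pos by (auto simp: \<epsilon>_def)
  let ?J = "\<lambda>u. contour_integral (circlepath 0 \<epsilon>)
    (loop_integrand m (fst u) (fst (snd u)) (fst (snd (snd u))) (snd (snd (snd u))))"
  let ?u = "\<lambda>n. (Q n, Q n ^ n, Q n ^ k n, M n)"
  have lim: "?u \<longlonglongrightarrow> (1, \<alpha>, \<beta>, \<mu>)" by (intro tendsto_intros Q1 Qn Qk M)
  have mem: "(1, \<alpha>, \<beta>, \<mu>) \<in> near \<epsilon> m" using pos \<mu>_pos \<epsilon> by (simp add: near_def)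
  have ev: "\<forall>\<^sub>F n in sequentially. ?u n \<in> near \<epsilon> m"
  proof -
    have "(\<lambda>n. \<bar>\<alpha> - Q n ^ n * (Q n ^ l / Q n ^ m)\<bar>) \<longlonglongrightarrow> \<bar>\<alpha> - \<alpha> * (1 ^ l / 1 ^ m)\<bar>" for l
      by (intro tendsto_intros Q1 Qn) auto
    then have "\<forall>\<^sub>F n in sequentially. \<bar>\<alpha> - Q n ^ n * (Q n ^ l / Q n ^ m)\<bar> < \<epsilon> * \<nu>" for l
      by (rule order_tendstoD(2)) (use \<epsilon> pos in auto)
    then have "\<forall>\<^sub>F n in sequentially. \<forall>l\<in>{..<m}. \<bar>\<alpha> - Q n ^ n * (Q n ^ l / Q n ^ m)\<bar> < \<epsilon> * \<nu>"
      by (intro eventually_ball_finite) auto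
    moreover have "\<forall>\<^sub>F n in sequentially. 0 < Q n" "\<forall>\<^sub>F n in sequentially. 0 < Q n ^ n"
      "\<forall>\<^sub>F n in sequentially. 0 < Q n ^ k n" "\<forall>\<^sub>F n in sequentially. 0 < M n"
      using order_tendstoD(1)[OF Q1(1), of 0] order_tendstoD(1)[OF Qn, of 0] order_tendstoD(1)[OF Qk, of 0]
        order_tendstoD(1)[OF M, of 0] pos \<mu>_pos by auto
    ultimately show ?thesis by eventually_elim (auto simp: near_def)
  qed
  have "(\<lambda>n. ?J (?u n)) \<longlonglongrightarrow> ?J (1, \<alpha>, \<beta>, \<mu>)"
    by (rule continuous_on_tendsto_compose[OF continuous_loop[OF \<epsilon>] lim mem ev])
  then have "(\<lambda>n. Re (?J (?u n) / (2 * of_real pi * \<i>))) \<longlonglongrightarrow> Re (?J (1, \<alpha>, \<beta>, \<mu>) / (2 * of_real pi * \<i>))"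
    by (intro tendsto_intros) auto
  moreover have "\<forall>\<^sub>F n in sequentially. Re (?J (?u n) / (2 * of_real pi * \<i>)) =
     (\<Sum>l<m. moment_summand m (Q n) (Q n ^ k n) (M n) (pt n l) / (\<Prod>l'\<in>{..<m} - {l}. pt n l - pt n l'))"
    using ev Q1(2)
  proof eventually_elim
    case (elim n)
    have "z * of_real s / z = of_real s" if "z \<noteq> 0" for z :: complex and s using that by simp
    then show ?case
      unfolding fst_conv snd_conv divided_difference_loop[OF \<epsilon> m elim] pt_def
      by (simp del: of_real_sum)
  qed
  ultimately have S: "(\<lambda>n. \<Sum>l<m. moment_summand m (Q n) (Q n ^ k n) (M n) (pt n l) / (\<Prod>l'\<in>{..<m} - {l}. pt n l - pt n l'))
     \<longlonglongrightarrow> Re (?J (1, \<alpha>, \<beta>, \<mu>) / (2 * of_real pi * \<i>))"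
    by (rule Lim_transform_eventually)
  have "(\<lambda>n. ((Q n ^ n) ^ m * (Q n ^ k n) ^ m) / (real n * (Q n ^ m - 1)) *
     (\<Sum>l<m. moment_summand m (Q n) (Q n ^ k n) (M n) (pt n l) / (\<Prod>l'\<in>{..<m} - {l}. pt n l - pt n l')))
     \<longlonglongrightarrow> (\<alpha> ^ m * \<beta> ^ m) / (- \<gamma> * real m) * Re (?J (1, \<alpha>, \<beta>, \<mu>) / (2 * of_real pi * \<i>))"
    using m \<gamma>_nonzero by (intro tendsto_mult tendsto_divide S D tendsto_power Qn Qk) auto
  moreover have "(Q n ^ n) ^ m * (Q n ^ k n) ^ m = Q n ^ (m * (n + k n))" for n
    by (simp add: power_add distrib_left mult.commute flip: power_mult)
  moreover have "(\<alpha> ^ m * \<beta> ^ m) / (- \<gamma> * real m) * Re (?J (1, \<alpha>, \<beta>, \<mu>) / (2 * of_real pi * \<i>)) = moment m"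
  proof -
    have "\<kappa> ^ m * Re (?J (1, \<alpha>, \<beta>, \<mu>) / (2 * of_real pi * \<i>)) =
       Re (of_real (\<kappa> ^ m) * ?J (1, \<alpha>, \<beta>, \<mu>) / (2 * of_real pi * \<i>))"
    proof -
      have "s * Re (z / w) = Re (of_real s * z / w)" for s z w
      proof -
        have "of_real s * z / w = of_real s * (z / w)" by simp
        then show ?thesis by (simp del: times_divide_eq_right)
      qed
      then show ?thesis by blast
    qed
    also have "\<dots> = - integral {0..pi} (edge_integrand m) / pi"
      unfolding fst_conv snd_conv by (rule loop_limit_value[OF \<epsilon> m])
    finally have *: "\<kappa> ^ m * Re (?J (1, \<alpha>, \<beta>, \<mu>) / (2 * of_real pi * \<i>)) = - integral {0..pi} (edge_integrand m) / pi" .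
    have "\<alpha> ^ m * \<beta> ^ m = \<kappa> ^ m" by (simp add: \<kappa>_def power_mult_distrib)
    then have "(\<alpha> ^ m * \<beta> ^ m) / (- \<gamma> * real m) * Re (?J (1, \<alpha>, \<beta>, \<mu>) / (2 * of_real pi * \<i>)) =
       (\<kappa> ^ m * Re (?J (1, \<alpha>, \<beta>, \<mu>) / (2 * of_real pi * \<i>))) / (- \<gamma> * real m)" by simp
    also have "\<dots> = moment m" unfolding * moment_def using \<gamma>_nonzero m by (simp add: field_simps)
    finally show ?thesis .
  qed
  ultimately show ?thesis by (simp add: mult_ac)
qed

end

section \<open>Addition of extended arc cosines\<close>

lemma arccos_ext_clip: "arccos_ext y = arccos (max (-1) (min 1 y))"
  by (auto simp: arccos_ext_def max_def min_def)

lemma arccos_ext_ge_1: "1 \<le> y \<Longrightarrow> arccos_ext y = 0"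
  by (auto simp: arccos_ext_clip)

lemma arccos_ext_le_m1: "y \<le> -1 \<Longrightarrow> arccos_ext y = pi"
  by (auto simp: arccos_ext_clip)

lemma arccos_ext_eq: "\<bar>y\<bar> \<le> 1 \<Longrightarrow> arccos_ext y = arccos y"
  by (auto simp: arccos_ext_def)

lemma arccos_ext_bounds: "0 \<le> arccos_ext y" "arccos_ext y \<le> pi"
  unfolding arccos_ext_clip by (intro arccos_lbound arccos_ubound; simp)+

lemma continuous_arccos_ext: "continuous_on UNIV arccos_ext"
proof -
  have "continuous_on UNIV (\<lambda>y::real. arccos (max (-1) (min 1 y)))"
    by (intro continuous_intros) auto
  then show ?thesis unfolding arccos_ext_clip[abs_def] .
qed

lemma continuous_on_arccos_ext [continuous_intros]:
  "continuous_on S f \<Longrightarrow> continuous_on S (\<lambda>x. arccos_ext (f x))"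
  using continuous_on_compose2[OF continuous_arccos_ext, of S f] by simp

lemma arccos_ext_has_derivative_0:
  assumes "isCont f t" "1 < \<bar>f t\<bar>"
  shows "((\<lambda>t. arccos_ext (f t)) has_real_derivative 0) (at t)"
proof (cases "0 < f t")
  case True
  then have "\<forall>\<^sub>F x in nhds t. 1 < f x"
    using assms order_tendstoD(1)[of f "f t" "at t" 1] by (auto simp: isCont_def eventually_nhds_conv_at)
  then have "\<forall>\<^sub>F x in nhds t. arccos_ext (f x) = 0"
    by eventually_elim (simp add: arccos_ext_ge_1)
  from DERIV_cong_ev[OF refl this refl] show ?thesis by simp
next
  case False
  then have "\<forall>\<^sub>F x in nhds t. f x < -1"
    using assms order_tendstoD(2)[of f "f t" "at t" "-1"] by (auto simp: isCont_def eventually_nhds_conv_at)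
  then have "\<forall>\<^sub>F x in nhds t. arccos_ext (f x) = pi"
    by eventually_elim (simp add: arccos_ext_le_m1)
  from DERIV_cong_ev[OF refl this refl] show ?thesis by simp
qed

text \<open>
  With \<open>C = cos \<phi>\<close> this is the squared modulus of \<open>1 - b * cis
  \<phi>\<close>, and \<open>arccos (edge_cos b C)\<close> is the modulus of the argument of
  that number. For \<open>C\<close> outside \<open>[- 1, 1]\<close> the formulas still make
  sense as long as \<open>quad b C\<close> is positive, and \<open>arccos_ext\<close> then gives
  \<open>0\<close> or \<open>pi\<close>.
\<close>

definition quad :: "real \<Rightarrow> real \<Rightarrow> real" where
  "quad b C = 1 - 2 * b * C + b\<^sup>2"

definition edge_cos :: "real \<Rightarrow> real \<Rightarrow> real" where
  "edge_cos b C = (1 - b * C) / sqrt (quad b C)"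

lemma edge_cos_square:
  assumes "0 < quad b C"
  shows "(edge_cos b C)\<^sup>2 - 1 = b\<^sup>2 * (C\<^sup>2 - 1) / quad b C"
proof -
  have "(edge_cos b C)\<^sup>2 = (1 - b * C)\<^sup>2 / quad b C"
    using assms by (simp add: edge_cos_def power_divide)
  moreover have "(1 - b * C)\<^sup>2 - quad b C = b\<^sup>2 * (C\<^sup>2 - 1)"
    by (simp add: quad_def algebra_simps power2_eq_square)
  ultimately show ?thesis using assms by (simp add: field_simps)
qed

lemma abs_ge_1_iff_square: "1 \<le> \<bar>y\<bar> \<longleftrightarrow> 0 \<le> y\<^sup>2 - (1::real)" "1 < \<bar>y\<bar> \<longleftrightarrow> 0 < y\<^sup>2 - (1::real)"
  using abs_le_square_iff[of 1 y] abs_square_less_1[of y] abs_square_le_1[of y] by (auto simp: not_le not_less)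

text \<open>
  By \<open>edge_cos_square\<close> the modulus of \<open>edge_cos b C\<close> is at least
  \<open>1\<close> here, so only the sign of \<open>1 - b * C\<close> matters. Positivity of
  \<open>quad b C\<close> reduces it to the comparison of \<open>b\<close> with
  \<open>1\<close>.
\<close>

lemma edge_angle_outer:
  assumes q: "0 < quad b C" and b: "0 < b"
  shows "C \<le> -1 \<Longrightarrow> arccos_ext (edge_cos b C) = 0"
    "1 \<le> C \<Longrightarrow> b < 1 \<Longrightarrow> arccos_ext (edge_cos b C) = 0"
    "1 \<le> C \<Longrightarrow> 1 < b \<Longrightarrow> arccos_ext (edge_cos b C) = pi"
    "1 \<le> C \<Longrightarrow> b \<noteq> 1"
proof -
  have outer: "1 \<le> \<bar>edge_cos b C\<bar>" if "1 \<le> C\<^sup>2"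
    unfolding abs_ge_1_iff_square edge_cos_square[OF q] using q that by simp
  have sq: "1 \<le> C\<^sup>2" if "1 \<le> \<bar>C\<bar>" using that abs_ge_1_iff_square(1)[of C] by simp
  have sgn: "0 \<le> edge_cos b C \<longleftrightarrow> 0 \<le> 1 - b * C"
    using q by (simp add: edge_cos_def zero_le_divide_iff)
  show "arccos_ext (edge_cos b C) = 0" if "C \<le> -1"
  proof -
    have "b * C \<le> 0" using that b by (intro mult_nonneg_nonpos) auto
    then show ?thesis using outer[OF sq] sgn that by (intro arccos_ext_ge_1) auto
  qed
  have q2: "2 * (b * C) < 1 + b\<^sup>2" using q by (simp add: quad_def)
  show "arccos_ext (edge_cos b C) = 0" if "1 \<le> C" "b < 1"
  proof -
    have "b\<^sup>2 < 1" using b that by (simp add: power_less_one_iff)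
    then have "0 \<le> 1 - b * C" using q2 by simp
    then show ?thesis using outer[OF sq] sgn that by (intro arccos_ext_ge_1) auto
  qed
  show "arccos_ext (edge_cos b C) = pi" if "1 \<le> C" "1 < b"
  proof -
    have "1 * 1 < b * C" using that by (intro mult_less_le_imp_less) auto
    then have "\<not> 0 \<le> edge_cos b C" using sgn by simp
    then show ?thesis using outer[OF sq] that by (intro arccos_ext_le_m1) auto
  qed
  show "b \<noteq> 1" if "1 \<le> C" using q that by (auto simp: quad_def)
qed

lemma edge_numerator:
  fixes b l C :: real
  shows "(1 - b * C) * (1 + l * C) - b * l * (1 - C\<^sup>2) = (1 - b * C) + l * (C - b)"
  by (simp add: algebra_simps power2_eq_square)

lemma arccos_ext_add_outer:
  assumes q: "0 < quad b C" "0 < quad l (- C)" and pos: "0 < b" "0 < l" and C: "1 \<le> C"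
  shows "arccos_ext (edge_cos b C) + arccos_ext (edge_cos l (- C)) =
    arccos_ext (((1 - b * C) + l * (C - b)) / (sqrt (quad b C) * sqrt (quad l (- C))))" (is "_ = arccos_ext ?X")
proof -
  let ?l = "(1 - b * C) + l * (C - b)"
  have "?X\<^sup>2 - 1 = (b + l)\<^sup>2 * (C\<^sup>2 - 1) / (quad b C * quad l (- C))"
  proof -
    have "?X\<^sup>2 = ?l\<^sup>2 / (quad b C * quad l (- C))"
      using q by (simp add: power_divide power_mult_distrib)
    moreover have "?l\<^sup>2 - quad b C * quad l (- C) = (b + l)\<^sup>2 * (C\<^sup>2 - 1)"
      by (simp add: quad_def algebra_simps power2_eq_square)
    moreover have "quad b C * quad l (- C) \<noteq> 0" using q by simp
    ultimately show ?thesis by (metis diff_divide_distrib divide_self)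
  qed
  moreover have "0 \<le> C\<^sup>2 - 1" using C by simp
  ultimately have X: "1 \<le> \<bar>?X\<bar>" unfolding abs_ge_1_iff_square using q by simp
  have l0: "arccos_ext (edge_cos l (- C)) = 0" using edge_angle_outer(1)[OF q(2) pos(2)] C by simp
  have den: "0 < sqrt (quad b C) * sqrt (quad l (- C))" using q by simp
  have q2: "2 * (b * C) < 1 + b\<^sup>2" using q(1) by (simp add: quad_def)
  consider "b < 1" | "1 < b" using edge_angle_outer(4)[OF q(1) pos(1) C] by linarith
  then show ?thesis
  proof cases
    case 1
    then have "b\<^sup>2 < 1" using pos by (simp add: power_less_one_iff)
    then have "0 \<le> 1 - b * C" using q2 by simp
    moreover have "0 \<le> l * (C - b)" using 1 C pos by simp
    ultimately have "0 \<le> ?X" using den by (intro divide_nonneg_pos) auto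
    then have "arccos_ext ?X = 0" using X by (intro arccos_ext_ge_1) auto
    then show ?thesis using edge_angle_outer(2)[OF q(1) pos(1) C 1] l0 by simp
  next
    case 2
    have "1 * 1 < b * C" using 2 C by (intro mult_less_le_imp_less) auto
    moreover have "l * (C - b) \<le> 0"
    proof (rule mult_nonneg_nonpos)
      have "1 < b * b" using 2 by (simp add: less_1_mult)
      then have "b * C < b * b" using q2 unfolding power2_eq_square by linarith
      then show "C - b \<le> 0" using pos by simp
    qed (use pos in simp)
    ultimately have "?X \<le> 0" using den by (intro divide_nonpos_pos) auto
    then have "arccos_ext ?X = pi" using X by (intro arccos_ext_le_m1) auto
    then show ?thesis using edge_angle_outer(3)[OF q(1) pos(1) C 2] l0 by simp
  qed
qed

lemma edge_cos_inner:
  assumes q: "0 < quad b C" and b: "0 < b" and C: "\<bar>C\<bar> < 1"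
  shows "\<bar>edge_cos b C\<bar> < 1" "sqrt (1 - (edge_cos b C)\<^sup>2) = b * sqrt (1 - C\<^sup>2) / sqrt (quad b C)"
proof -
  have "C\<^sup>2 < 1" using C by (simp add: abs_square_less_1)
  have "1 - (edge_cos b C)\<^sup>2 = b\<^sup>2 * (1 - C\<^sup>2) / quad b C"
  proof -
    have "1 - (edge_cos b C)\<^sup>2 = - (b\<^sup>2 * (C\<^sup>2 - 1) / quad b C)"
      using edge_cos_square[OF q] by linarith
    also have "\<dots> = b\<^sup>2 * (1 - C\<^sup>2) / quad b C"
      by (simp only: minus_divide_left mult_minus_right[symmetric] minus_diff_eq)
    finally show ?thesis .
  qed
  then show "sqrt (1 - (edge_cos b C)\<^sup>2) = b * sqrt (1 - C\<^sup>2) / sqrt (quad b C)"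
    using b by (simp add: real_sqrt_divide real_sqrt_mult)
  have "0 < b\<^sup>2 * (1 - C\<^sup>2) / quad b C" using q b \<open>C\<^sup>2 < 1\<close> by simp
  then have "(edge_cos b C)\<^sup>2 < 1" using \<open>1 - (edge_cos b C)\<^sup>2 = _\<close> by simp
  then show "\<bar>edge_cos b C\<bar> < 1" by (simp add: abs_square_less_1)
qed

text \<open>
  The angles are those of \<open>1 - b * cis (- \<phi>)\<close> and \<open>1 + l * cis
  \<phi>\<close>, both in the upper half plane. Their product has the real part in the
  numerator, and it lies in the upper half plane as well, because its imaginary part is
  \<open>(b + l) * sin \<phi>\<close>.
\<close>

lemma arccos_ext_add_inner:
  assumes q: "0 < quad b C" "0 < quad l (- C)" and pos: "0 < b" "0 < l" and C: "\<bar>C\<bar> < 1"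
  shows "arccos_ext (edge_cos b C) + arccos_ext (edge_cos l (- C)) =
    arccos_ext (((1 - b * C) + l * (C - b)) / (sqrt (quad b C) * sqrt (quad l (- C))))" (is "_ = arccos_ext ?X")
proof -
  let ?a = "edge_cos b C" and ?b = "edge_cos l (- C)" and ?s = "sqrt (1 - C\<^sup>2)"
  have C2: "C\<^sup>2 < 1" using C by (simp add: abs_square_less_1)
  have s: "0 < ?s" "?s * ?s = 1 - C\<^sup>2" using C2 by auto
  note a = edge_cos_inner[OF q(1) pos(1) C] and b = edge_cos_inner[OF q(2) pos(2), simplified, OF C]
  have ca: "cos (arccos ?a) = ?a" "sin (arccos ?a) = b * ?s / sqrt (quad b C)"
    and cb: "cos (arccos ?b) = ?b" "sin (arccos ?b) = l * ?s / sqrt (quad l (- C))"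
    using a b by (simp_all add: sin_arccos abs_less_iff)
  have prods: "u / v * (u' / v') - b * s / v * (l * s / v') = (u * u' - b * l * (s * s)) / (v * v')"
    "b * s / v * (u' / v') + u / v * (l * s / v') = s * (b * u' + l * u) / (v * v')" for u v u' v' s :: real
    by (simp_all add: diff_divide_distrib add_divide_distrib distrib_left mult_ac)
  have ab: "?a = (1 - b * C) / sqrt (quad b C)" "?b = (1 + l * C) / sqrt (quad l (- C))"
    by (simp_all add: edge_cos_def)
  let ?\<theta> = "arccos ?a + arccos ?b"
  have "cos ?\<theta> = ((1 - b * C) * (1 + l * C) - b * l * (?s * ?s)) / (sqrt (quad b C) * sqrt (quad l (- C)))"
    unfolding cos_add ca cb unfolding ab by (simp only: prods)
  then have cos: "cos ?\<theta> = ?X" unfolding s edge_numerator .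
  have "sin ?\<theta> = ?s * (b * (1 + l * C) + l * (1 - b * C)) / (sqrt (quad b C) * sqrt (quad l (- C)))"
    unfolding sin_add ca cb unfolding ab by (simp only: prods)
  also have "b * (1 + l * C) + l * (1 - b * C) = b + l" by (simp add: algebra_simps)
  finally have sin: "0 < sin ?\<theta>" using s(1) pos q by simp
  have "0 \<le> ?\<theta>" "?\<theta> \<le> 2 * pi"
    using arccos_lbound[of ?a] arccos_lbound[of ?b] arccos_ubound[of ?a] arccos_ubound[of ?b] a(1) b(1)
    by (auto simp: abs_less_iff)
  moreover have "?\<theta> < pi"
  proof (rule ccontr)
    assume "\<not> ?\<theta> < pi"
    then have "0 \<le> sin (?\<theta> - pi)" using \<open>?\<theta> \<le> 2 * pi\<close> by (intro sin_ge_zero) auto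
    then show False using sin by simp
  qed
  ultimately have "arccos (cos ?\<theta>) = ?\<theta>" by (intro arccos_cos) auto
  moreover have "arccos_ext (cos ?\<theta>) = arccos (cos ?\<theta>)"
    by (rule arccos_ext_eq) simp
  ultimately show ?thesis
    using a(1) b(1) unfolding cos by (simp add: arccos_ext_eq)
qed

lemma arccos_ext_add:
  assumes q: "0 < quad b C" "0 < quad l (- C)" and pos: "0 < b" "0 < l"
  shows "arccos_ext (edge_cos b C) + arccos_ext (edge_cos l (- C)) =
    arccos_ext (((1 - b * C) + l * (C - b)) / (sqrt (quad b C) * sqrt (quad l (- C))))"
proof -
  consider "1 \<le> C" | "\<bar>C\<bar> < 1" | "C \<le> -1" by linarith
  then show ?thesis
  proof cases
    case 3
    have "(1 - l * (- C)) + b * (- C - l) = (1 - b * C) + l * (C - b)"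
      by (simp add: algebra_simps)
    then have "arccos_ext (edge_cos l (- C)) + arccos_ext (edge_cos b C) =
        arccos_ext (((1 - b * C) + l * (C - b)) / (sqrt (quad l (- C)) * sqrt (quad b C)))"
      using arccos_ext_add_outer[of l "- C" b] q pos 3 by (simp only: minus_minus)
    then show ?thesis by (simp only: add.commute mult.commute)
  qed (use arccos_ext_add_outer arccos_ext_add_inner assms in auto)
qed

lemma edge_angle_derivative:
  assumes q: "0 < quad b C" and b: "0 < b" and C: "\<bar>C\<bar> < 1"
  shows "((\<lambda>C. arccos_ext (edge_cos b C)) has_real_derivative
    - (b * (C - b) / quad b C / sqrt (1 - C\<^sup>2))) (at C)"
proof -
  have C2: "0 < 1 - C\<^sup>2" using C by (simp add: abs_square_less_1)
  note i = edge_cos_inner[OF q b C]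
  have "((\<lambda>C. sqrt (quad b C)) has_real_derivative (- 2 * b) * (inverse (sqrt (quad b C)) / 2)) (at C)"
    unfolding quad_def using q by (auto intro!: derivative_eq_intros simp: quad_def)
  moreover have "((\<lambda>C. 1 - b * C) has_real_derivative - b) (at C)"
    by (auto intro!: derivative_eq_intros)
  moreover have "sqrt (quad b C) \<noteq> 0" using q by simp
  ultimately have "(edge_cos b has_real_derivative
     (- b * sqrt (quad b C) - (1 - b * C) * ((- 2 * b) * (inverse (sqrt (quad b C)) / 2))) / (sqrt (quad b C) * sqrt (quad b C))) (at C)"
    unfolding edge_cos_def[abs_def] by (intro DERIV_divide)
  also have "(- b * sqrt (quad b C) - (1 - b * C) * ((- 2 * b) * (inverse (sqrt (quad b C)) / 2))) / (sqrt (quad b C) * sqrt (quad b C))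
     = b\<^sup>2 * (C - b) / (quad b C * sqrt (quad b C))"
  proof -
    let ?w = "sqrt (quad b C)"
    have w: "0 < ?w" "?w * ?w = quad b C" using q by auto
    have "(- b * ?w - (1 - b * C) * ((- 2 * b) * (inverse ?w / 2))) / (?w * ?w) = (- b * (?w * ?w) + (1 - b * C) * b) / ((?w * ?w) * ?w)"
      using w(1) by (simp add: field_simps)
    also have "- b * (?w * ?w) + (1 - b * C) * b = b\<^sup>2 * (C - b)"
      unfolding w by (simp add: quad_def algebra_simps power2_eq_square)
    finally show ?thesis unfolding w .
  qed
  finally have dY: "(edge_cos b has_real_derivative b\<^sup>2 * (C - b) / (quad b C * sqrt (quad b C))) (at C)" .
  have "((\<lambda>C. arccos (edge_cos b C)) has_real_derivative
     inverse (- sqrt (1 - (edge_cos b C)\<^sup>2)) * (b\<^sup>2 * (C - b) / (quad b C * sqrt (quad b C)))) (at C)"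
    by (rule DERIV_chain2[OF DERIV_arccos dY]) (use i in auto)
  also have "inverse (- sqrt (1 - (edge_cos b C)\<^sup>2)) * (b\<^sup>2 * (C - b) / (quad b C * sqrt (quad b C))) =
     - (b * (C - b) / quad b C / sqrt (1 - C\<^sup>2))"
    unfolding i using b q C2 by (simp add: field_simps power2_eq_square)
  finally have *: "((\<lambda>C. arccos (edge_cos b C)) has_real_derivative - (b * (C - b) / quad b C / sqrt (1 - C\<^sup>2))) (at C)" .
  have "isCont (edge_cos b) C" using dY DERIV_isCont by blast
  then have "\<forall>\<^sub>F x in nhds C. \<bar>edge_cos b x\<bar> < 1"
    using i(1) order_tendstoD(2)[of "\<lambda>x. \<bar>edge_cos b x\<bar>" "\<bar>edge_cos b C\<bar>" "at C" 1] tendsto_rabs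
    by (auto simp: isCont_def eventually_nhds_conv_at)
  then have "\<forall>\<^sub>F x in nhds C. arccos_ext (edge_cos b x) = arccos (edge_cos b x)"
    by eventually_elim (simp add: arccos_ext_eq)
  from DERIV_cong_ev[OF refl this refl] * show ?thesis by simp
qed

text \<open>
  A factor that vanishes at \<open>a\<close> absorbs a bounded discontinuity there.
\<close>

lemma continuous_on_mult_bounded_zero:
  fixes g h :: "real \<Rightarrow> real"
  assumes g: "continuous_on S g" and h: "continuous_on (S - {a}) h" and a: "g a = 0"
    and B: "\<And>x. \<bar>h x\<bar> \<le> B"
  shows "continuous_on S (\<lambda>x. g x * h x)"
  unfolding continuous_on_def
proof
  fix x assume x: "x \<in> S"
  show "((\<lambda>x. g x * h x) \<longlongrightarrow> g x * h x) (at x within S)"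
  proof (cases "x = a")
    case False
    have "at x within S = at x within (S - {a})"
      by (rule at_within_nhd[of _ "- {a}"]) (use False in auto)
    moreover have "(h \<longlongrightarrow> h x) (at x within (S - {a}))"
      using h x False by (auto simp: continuous_on_def)
    ultimately show ?thesis
      using g x by (intro tendsto_mult) (auto simp: continuous_on_def)
  next
    case True
    have "(g \<longlongrightarrow> 0) (at x within S)" using g x a True by (auto simp: continuous_on_def)
    then have lim: "((\<lambda>x. B * \<bar>g x\<bar>) \<longlongrightarrow> 0) (at x within S)"
      using tendsto_mult_right_zero[OF tendsto_rabs_zero] by blast
    have bd: "norm (g x * h x) \<le> B * \<bar>g x\<bar>" for x
      using mult_right_mono[OF B[of x] abs_ge_zero[of "g x"]] by (simp add: abs_mult mult.commute)
    have "((\<lambda>x. g x * h x) \<longlongrightarrow> 0) (at x within S)"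
      by (rule Lim_null_comparison[OF always_eventually[OF allI[OF bd]] lim])
    then show ?thesis using a True by simp
  qed
qed

section \<open>The limit density and its moments\<close>

context limit_parameters
begin

text \<open>
  The cosine of the angle \<open>\<phi>\<close> at which \<open>V \<phi> = exp (- \<gamma>
  t)\<close>. It leaves \<open>[- 1, 1]\<close> on the straight parts of the limit shape, where
  the density is \<open>0\<close> or \<open>1\<close>.
\<close>

definition edge_coord :: "real \<Rightarrow> real" where
  "edge_coord t = (exp (- \<gamma> * t) - mid) / (2 * r * rad)"

definition inner_ratio :: real where "inner_ratio = rad / A"

text \<open>
  The argument of \<open>(1 + \<eta>) / (1 - \<eta> / A)\<close> at the point
  \<open>\<eta>\<close> of the upper half circle with \<open>U \<eta> = exp (- \<gamma>
  t)\<close>, if there is one; \<open>pi\<close> times the limit density.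
\<close>

definition angle_sum :: "real \<Rightarrow> real" where
  "angle_sum t = arccos_ext (edge_cos inner_ratio (edge_coord t)) + arccos_ext (edge_cos rad (- edge_coord t))"

lemma inner_ratio_pos: "0 < inner_ratio"
  using rad_pos pos by (simp add: inner_ratio_def)

lemma edge_coord_eq: "2 * r * rad * edge_coord t = exp (- \<gamma> * t) - mid"
  using rad_pos r_nonzero by (simp add: edge_coord_def)

text \<open>
  The factorizations of \<open>1 - U\<close> and \<open>U - \<kappa>\<close> on the circle: both
  \<open>\<eta> - A\<close> and \<open>1 + \<eta>\<close> occur there together with their
  conjugates.
\<close>

lemma quad_edge_coord:
  "r * A * quad inner_ratio (edge_coord t) = 1 - exp (- \<gamma> * t)"
  "r * quad rad (- edge_coord t) = exp (- \<gamma> * t) - \<kappa>"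
proof -
  have "r * A * quad inner_ratio (edge_coord t) = r * A - 2 * r * rad * edge_coord t + p / A"
    using pos(5) by (simp add: quad_def inner_ratio_def p_eq field_simps power2_eq_square)
  then show "r * A * quad inner_ratio (edge_coord t) = 1 - exp (- \<gamma> * t)"
    unfolding edge_coord_eq mid_eq(1) by simp
  have "r * quad rad (- edge_coord t) = r + 2 * r * rad * edge_coord t + p"
    by (simp add: quad_def p_eq algebra_simps)
  then show "r * quad rad (- edge_coord t) = exp (- \<gamma> * t) - \<kappa>"
    unfolding edge_coord_eq mid_eq(2) by simp
qed

lemma \<kappa>_exp: "\<kappa> = exp (- \<gamma> * (c + 1))"
  by (simp add: \<kappa>_def \<alpha>_def \<beta>_def exp_add[symmetric] algebra_simps)

lemma exp_sign:
  "0 < t \<Longrightarrow> 0 < \<gamma> * (1 - exp (- \<gamma> * t))"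
  "t < c + 1 \<Longrightarrow> 0 < \<gamma> * (exp (- \<gamma> * t) - \<kappa>)"
proof -
  show "0 < \<gamma> * (1 - exp (- \<gamma> * t))" if "0 < t"
    using that \<gamma>_nonzero by (cases "0 < \<gamma>") (auto simp: zero_less_mult_iff mult_less_0_iff)
  show "0 < \<gamma> * (exp (- \<gamma> * t) - \<kappa>)" if "t < c + 1"
    using that \<gamma>_nonzero unfolding \<kappa>_exp by (cases "0 < \<gamma>") (auto simp: zero_less_mult_iff)
qed

lemma quad_pos:
  "0 < t \<Longrightarrow> 0 < quad inner_ratio (edge_coord t)"
  "t < c + 1 \<Longrightarrow> 0 < quad rad (- edge_coord t)"
proof -
  show "0 < quad inner_ratio (edge_coord t)" if "0 < t"
  proof -
    have "0 < (\<gamma> * r) * A * quad inner_ratio (edge_coord t)"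
      using exp_sign(1)[OF that] unfolding quad_edge_coord(1)[symmetric] by (simp add: mult.assoc)
    then show ?thesis using r_p_sign(1) pos(5) by (metis mult_pos_pos zero_less_mult_pos)
  qed
  show "0 < quad rad (- edge_coord t)" if "t < c + 1"
  proof -
    have "0 < (\<gamma> * r) * quad rad (- edge_coord t)"
      using exp_sign(2)[OF that] unfolding quad_edge_coord(2)[symmetric] by (simp add: mult.assoc)
    then show ?thesis using r_p_sign(1) by (metis zero_less_mult_pos)
  qed
qed

lemma continuous_edge_coord [continuous_intros]: "continuous_on S edge_coord"
  unfolding edge_coord_def[abs_def] using rad_pos r_nonzero by (intro continuous_intros) auto

lemma continuous_angles:
  "continuous_on {0<..} (\<lambda>t. arccos_ext (edge_cos inner_ratio (edge_coord t)))"
  "continuous_on {..<c + 1} (\<lambda>t. arccos_ext (edge_cos rad (- edge_coord t)))"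
proof -
  have "0 < sqrt (quad inner_ratio (edge_coord t))" if "0 < t" for t using quad_pos(1)[OF that] by simp
  then show "continuous_on {0<..} (\<lambda>t. arccos_ext (edge_cos inner_ratio (edge_coord t)))"
    unfolding edge_cos_def quad_def by (intro continuous_intros) (force simp: quad_def)
  have "0 < sqrt (quad rad (- edge_coord t))" if "t < c + 1" for t using quad_pos(2)[OF that] by simp
  then show "continuous_on {..<c + 1} (\<lambda>t. arccos_ext (edge_cos rad (- edge_coord t)))"
    unfolding edge_cos_def quad_def by (intro continuous_intros) (force simp: quad_def)
qed

lemma continuous_angle_sum: "continuous_on {0<..<c + 1} angle_sum"
  unfolding angle_sum_def[abs_def]
  by (intro continuous_on_add continuous_on_subset[OF continuous_angles(1)] continuous_on_subset[OF continuous_angles(2)]) auto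

text \<open>
  Adding the two angles by \<open>arccos_ext_add\<close> and expressing the moduli by
  \<open>quad_edge_coord\<close> gives the form of the density as one arc cosine.
\<close>

lemma angle_sum_eq:
  assumes "0 < t" "t < c + 1"
  shows "angle_sum t = arccos_ext (sgn \<gamma> * (\<kappa> * (\<mu> - 1) - exp (- \<gamma> * t) * (\<nu> - \<alpha>)) /
    (2 * sqrt (\<kappa> * \<mu>) * sqrt ((1 - exp (- \<gamma> * t)) * (exp (- \<gamma> * t) - \<kappa>))))"
proof -
  let ?C = "edge_coord t" and ?u = "exp (- \<gamma> * t)"
  let ?q1 = "quad inner_ratio ?C" and ?q2 = "quad rad (- ?C)"
  let ?n = "(1 - inner_ratio * ?C) + rad * (?C - inner_ratio)"
  let ?S = "\<kappa> * (\<mu> - 1) - ?u * (\<nu> - \<alpha>)"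
  have q: "0 < ?q1" "0 < ?q2" using quad_pos assms by auto
  have S: "2 * \<alpha> * r * ?n = ?S"
  proof -
    let ?D = "(\<alpha> + \<nu>)\<^sup>2"
    have D: "?D \<noteq> 0" using pos by simp
    have A\<nu>: "\<alpha> / A = \<nu>" using pos by (simp add: A_def)
    have "2 * \<alpha> * r * ?n = 2 * \<alpha> * r - 2 * (\<alpha> / A) * (r * rad\<^sup>2) + (2 * r * rad * ?C) * (\<alpha> - \<alpha> / A)"
      by (simp add: inner_ratio_def algebra_simps power2_eq_square)
    also have "\<dots> = 2 * \<alpha> * r - 2 * \<nu> * p + (?u - mid) * (\<alpha> - \<nu>)"
      unfolding A\<nu> p_eq[symmetric] edge_coord_eq ..
    also have "\<dots> = (\<alpha> + \<nu>) * (r - p) - (\<alpha> - \<nu>) * \<kappa> - ?u * (\<nu> - \<alpha>)"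
      unfolding mid_eq(2) by (simp add: algebra_simps)
    also have "(\<alpha> + \<nu>) * (r - p) = \<kappa> * (\<mu> - 1 + \<alpha> - \<nu>)"
    proof -
      have "?D * r = \<kappa> * (1 + \<nu>) * (\<mu> - \<nu>)" "?D * p = \<kappa> * (1 - \<alpha>) * (\<alpha> + \<mu>)"
        using D by (simp_all add: r_def p_def)
      then have "?D * (r - p) = (\<alpha> + \<nu>) * (\<kappa> * (\<mu> - 1 + \<alpha> - \<nu>))"
        unfolding right_diff_distrib by (simp add: algebra_simps)
      then have "(\<alpha> + \<nu>) * ((\<alpha> + \<nu>) * (r - p)) = (\<alpha> + \<nu>) * (\<kappa> * (\<mu> - 1 + \<alpha> - \<nu>))"
        by (simp add: power2_eq_square mult.assoc)
      then show ?thesis using pos by simp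
    qed
    finally show ?thesis by (simp add: algebra_simps)
  qed
  have den: "2 * \<alpha> * (\<bar>r\<bar> * (sqrt ?q1 * sqrt ?q2)) = 2 * sqrt (\<kappa> * \<mu>) * sqrt ((1 - ?u) * (?u - \<kappa>))"
  proof -
    have "\<alpha> * \<alpha> * (r\<^sup>2 * (?q1 * ?q2)) = \<kappa> * \<mu> * ((r * A * ?q1) * (r * ?q2))"
      using pos unfolding \<kappa>\<mu> by (simp add: A_def power2_eq_square)
    then have "sqrt (\<alpha> * \<alpha> * (r\<^sup>2 * (?q1 * ?q2))) = sqrt (\<kappa> * \<mu> * ((1 - ?u) * (?u - \<kappa>)))"
      unfolding quad_edge_coord by simp
    then show ?thesis using pos by (simp add: real_sqrt_mult)
  qed
  have "?n / (sqrt ?q1 * sqrt ?q2) = sgn r * ?S / (2 * \<alpha> * (\<bar>r\<bar> * (sqrt ?q1 * sqrt ?q2)))"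
  proof -
    have "sgn r * r = \<bar>r\<bar>" by (simp add: abs_sgn mult.commute)
    then have "sgn r * ?S = (2 * \<alpha> * \<bar>r\<bar>) * ?n"
      unfolding S[symmetric] \<open>sgn r * r = \<bar>r\<bar>\<close>[symmetric] by (simp add: mult_ac)
    moreover have "2 * \<alpha> * \<bar>r\<bar> \<noteq> 0" using pos r_nonzero by simp
    moreover have "n / w = K * n / (K * w)" if "K \<noteq> 0" for n w K :: real using that by simp
    ultimately have "?n / (sqrt ?q1 * sqrt ?q2) = sgn r * ?S / (2 * \<alpha> * \<bar>r\<bar> * (sqrt ?q1 * sqrt ?q2))"
      by metis
    then show ?thesis by (simp only: mult.assoc)
  qed
  also have "sgn r = sgn \<gamma>"
    using r_p_sign(1) by (auto simp: sgn_if zero_less_mult_iff)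
  finally show ?thesis
    unfolding angle_sum_def arccos_ext_add[OF q inner_ratio_pos rad_pos] den by simp
qed

lemma angle_sum_bounds: "0 \<le> angle_sum t" "0 < t \<Longrightarrow> t < c + 1 \<Longrightarrow> angle_sum t \<le> pi"
  using arccos_ext_bounds angle_sum_eq by (auto simp: angle_sum_def)

text \<open>
  The two quotients in parentheses are the derivatives of the two angles with respect to
  \<open>\<phi>\<close>. So \<open>edge_integrand\<close> is what integration by parts leaves
  over from \<open>u\<^sup>m\<close> times the density.
\<close>

lemma edge_integrand_antiderivative:
  assumes C: "\<bar>edge_coord t\<bar> < 1" and t: "0 < t" "t < c + 1"
  defines "\<phi> \<equiv> arccos (edge_coord t)" and "u \<equiv> exp (- \<gamma> * t)"
  shows "edge_integrand m \<phi> =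
    (u ^ m - 1) * (inner_ratio * (edge_coord t - inner_ratio) / quad inner_ratio (edge_coord t)) +
    (u ^ m - \<kappa> ^ m) * (rad * (edge_coord t + rad) / quad rad (- edge_coord t))"
proof -
  let ?C = "edge_coord t"
  have cos: "cos \<phi> = ?C" using C by (simp add: \<phi>_def abs_less_iff)
  have V: "V \<phi> = u" unfolding V_def cos edge_coord_eq u_def by simp
  have q: "quad inner_ratio ?C \<noteq> 0" "quad rad (- ?C) \<noteq> 0" using quad_pos t by force+
  have 1: "(u ^ m - 1) * (inner_ratio * (?C - inner_ratio) / quad inner_ratio ?C) =
      r * (\<Sum>j<m. u ^ j * (rad\<^sup>2 / A - rad * ?C))"
  proof -
    have "u ^ m - 1 = - (r * A * quad inner_ratio ?C) * (\<Sum>j<m. u ^ j)"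
      unfolding power_diff_1_eq quad_edge_coord(1) u_def by simp
    then have "(u ^ m - 1) * (inner_ratio * (?C - inner_ratio) / quad inner_ratio ?C) =
        r * ((\<Sum>j<m. u ^ j) * (A * inner_ratio * (inner_ratio - ?C)))"
    proof -
      have "- (r * A * v) * P * (i * (x - i) / v) = r * (P * (A * i * (i - x)))" if "v \<noteq> 0" for v P i x
        using that by (simp add: field_simps)
      then show ?thesis unfolding \<open>u ^ m - 1 = _\<close> using q(1) by blast
    qed
    also have "A * inner_ratio * (inner_ratio - ?C) = rad\<^sup>2 / A - rad * ?C"
      using pos(5) by (simp add: inner_ratio_def field_simps power2_eq_square)
    finally show ?thesis by (simp add: sum_distrib_right)
  qed
  have 2: "(u ^ m - \<kappa> ^ m) * (rad * (?C + rad) / quad rad (- ?C)) =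
      r * (\<Sum>j<m. \<kappa> ^ (m - Suc j) * (u ^ j * (rad\<^sup>2 + rad * ?C)))"
  proof -
    have "u ^ m - \<kappa> ^ m = (r * quad rad (- ?C)) * (\<Sum>j<m. \<kappa> ^ (m - Suc j) * u ^ j)"
      unfolding power_diff_sumr2 quad_edge_coord(2) u_def by simp
    then have X: "(u ^ m - \<kappa> ^ m) * (rad * (?C + rad) / quad rad (- ?C)) =
        r * ((\<Sum>j<m. \<kappa> ^ (m - Suc j) * u ^ j) * (rad * (?C + rad)))"
      using q(2) by simp
    have "rad\<^sup>2 + rad * ?C = rad * (?C + rad)"
      by (simp add: algebra_simps power2_eq_square)
    then show ?thesis by (simp only: X sum_distrib_right mult.assoc)
  qed
  show ?thesis
    unfolding 1 2 edge_integrand_def cos V by (simp add: sum.distrib distrib_left)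
qed

text \<open>
  Integration by parts: with the angles \<open>\<theta>\<^sub>1\<close>,
  \<open>\<theta>\<^sub>2\<close> and \<open>u = exp (- \<gamma> t)\<close>, the function
  \<open>(u\<^sup>m - 1) \<theta>\<^sub>1 + (u\<^sup>m - \<kappa>\<^sup>m) \<theta>\<^sub>2 - H
  \<phi>\<close>, where \<open>H\<close> is a primitive of \<open>edge_integrand\<close>, is a
  primitive of \<open>- \<gamma> m u\<^sup>m (\<theta>\<^sub>1 + \<theta>\<^sub>2)\<close>. The
  angle \<open>\<theta>\<^sub>1\<close> need not have a limit value at \<open>t = 0\<close>,
  where \<open>u = 1\<close>, nor \<open>\<theta>\<^sub>2\<close> at \<open>t = c + 1\<close>,
  where \<open>u = \<kappa>\<close>; the constants \<open>1\<close> and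
  \<open>\<kappa>\<^sup>m\<close> are chosen so that this does not matter.
\<close>

theorem density_moment:
  assumes m: "0 < m"
  shows "((\<lambda>t. exp (- \<gamma> * t) ^ m * (angle_sum t / pi)) has_integral moment m) {0..c + 1}"
proof -
  let ?u = "\<lambda>t. exp (- \<gamma> * t)"
  let ?\<theta>1 = "\<lambda>t. arccos_ext (edge_cos inner_ratio (edge_coord t))"
  let ?\<theta>2 = "\<lambda>t. arccos_ext (edge_cos rad (- edge_coord t))"
  let ?\<Phi> = "\<lambda>t. arccos_ext (edge_coord t)"
  define H where "H \<phi> = integral {0..\<phi>} (edge_integrand m)" for \<phi>
  define G where "G t = ((?u t ^ m - 1) * ?\<theta>1 t + (?u t ^ m - \<kappa> ^ m) * ?\<theta>2 t) - H (?\<Phi> t)" for t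
  let ?L = "c + 1"
  have L: "0 < ?L" using c_pos by simp
  have cont_e: "continuous_on S (edge_integrand m)" for S
    unfolding edge_integrand_def[abs_def] V_def using pos(5) by (intro continuous_intros) auto
  have H: "(H has_vector_derivative edge_integrand m \<phi>) (at \<phi> within {0..pi})" if "\<phi> \<in> {0..pi}" for \<phi>
    unfolding H_def by (rule integral_has_vector_derivative[OF cont_e that])
  have contH: "continuous_on {0..pi} H"
    unfolding H_def by (rule indefinite_integral_continuous_1[OF integrable_continuous_real[OF cont_e]])
  have \<theta>_bd: "\<bar>arccos_ext y\<bar> \<le> pi" for y using arccos_ext_bounds[of y] by simp
  have cont: "continuous_on {0..?L} G"
  proof -
    have 1: "continuous_on {0..?L} (\<lambda>t. (?u t ^ m - 1) * ?\<theta>1 t)"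
      by (rule continuous_on_mult_bounded_zero[where a = 0 and B = pi])
        (auto intro!: continuous_intros \<theta>_bd continuous_on_subset[OF continuous_angles(1)])
    have 2: "continuous_on {0..?L} (\<lambda>t. (?u t ^ m - \<kappa> ^ m) * ?\<theta>2 t)"
      by (rule continuous_on_mult_bounded_zero[where a = ?L and B = pi])
        (auto intro!: continuous_intros \<theta>_bd continuous_on_subset[OF continuous_angles(2)] simp: \<kappa>_exp)
    have 3: "continuous_on {0..?L} (\<lambda>t. H (?\<Phi> t))"
      by (rule continuous_on_compose2[OF contH]) (auto intro!: continuous_intros arccos_ext_bounds)
    show ?thesis unfolding G_def[abs_def] by (intro continuous_on_diff continuous_on_add 1 2 3)
  qed
  have coord0: "1 \<le> edge_coord 0"
  proof -
    have "r * A * quad inner_ratio (edge_coord 0) = 0" unfolding quad_edge_coord by simp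
    then have "quad inner_ratio (edge_coord 0) = 0" using r_nonzero pos by simp
    then have "2 * inner_ratio * (edge_coord 0 - 1) = (inner_ratio - 1)\<^sup>2"
      by (simp add: quad_def algebra_simps power2_eq_square)
    then have "0 \<le> 2 * inner_ratio * (edge_coord 0 - 1)" by simp
    then show ?thesis using inner_ratio_pos by (simp add: zero_le_mult_iff)
  qed
  have coordL: "edge_coord ?L \<le> -1"
  proof -
    have "r * quad rad (- edge_coord ?L) = 0" unfolding quad_edge_coord \<kappa>_exp by simp
    then have "quad rad (- edge_coord ?L) = 0" using r_nonzero by simp
    then have "2 * rad * (- edge_coord ?L - 1) = (rad - 1)\<^sup>2"
      by (simp add: quad_def algebra_simps power2_eq_square)
    then have "0 \<le> 2 * rad * (- edge_coord ?L - 1)" by simp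
    then show ?thesis using rad_pos by (simp add: zero_le_mult_iff)
  qed
  have "?\<theta>2 0 = 0" using edge_angle_outer(1)[OF quad_pos(2) rad_pos] L coord0 by simp
  then have G0: "G 0 = 0" using coord0 by (simp add: G_def H_def arccos_ext_ge_1)
  have "?\<theta>1 ?L = 0" using edge_angle_outer(1)[OF quad_pos(1) inner_ratio_pos] L coordL by simp
  then have GL: "G ?L = - integral {0..pi} (edge_integrand m)"
    using coordL by (simp add: G_def H_def arccos_ext_le_m1 \<kappa>_exp)
  have dC: "(edge_coord has_real_derivative - \<gamma> * ?u t / (2 * r * rad)) (at t)" for t
    unfolding edge_coord_def[abs_def] using r_nonzero rad_pos by (auto intro!: derivative_eq_intros)
  have du: "((\<lambda>t. ?u t ^ m - b) has_real_derivative - (\<gamma> * real m) * ?u t ^ m) (at t)" for t b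
  proof -
    have "((\<lambda>t. exp (- \<gamma> * real m * t) - b) has_real_derivative - (\<gamma> * real m) * exp (- \<gamma> * real m * t)) (at t)"
      by (auto intro!: derivative_eq_intros)
    moreover have "exp (- \<gamma> * real m * t) = ?u t ^ m" for t
      by (simp add: exp_of_nat_mult[symmetric] mult_ac)
    ultimately show ?thesis by simp
  qed
  have fin: "finite {t. \<bar>edge_coord t\<bar> = 1}"
  proof -
    have "inj edge_coord"
      using r_nonzero rad_pos \<gamma>_nonzero by (auto intro!: injI simp: edge_coord_def)
    then have "finite (edge_coord -` {1, -1})" by (intro finite_vimageI) auto
    moreover have "{t. \<bar>edge_coord t\<bar> = 1} \<subseteq> edge_coord -` {1, -1}" by auto
    ultimately show ?thesis by (rule finite_subset[rotated])
  qed
  have deriv: "(G has_vector_derivative (- (\<gamma> * real m) * (?u t ^ m * angle_sum t))) (at t)"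
    if t: "t \<in> {0<..<?L} - {t. \<bar>edge_coord t\<bar> = 1}" for t
  proof -
    let ?C = "edge_coord t" and ?C' = "- \<gamma> * ?u t / (2 * r * rad)"
    have q: "0 < quad inner_ratio ?C" "0 < quad rad (- ?C)" using quad_pos t by auto
    have comb: "(G has_real_derivative (- (\<gamma> * real m) * ?u t ^ m * ?\<theta>1 t + d1 * (?u t ^ m - 1)) +
        (- (\<gamma> * real m) * ?u t ^ m * ?\<theta>2 t + d2 * (?u t ^ m - \<kappa> ^ m)) - dh) (at t)"
      if "(?\<theta>1 has_real_derivative d1) (at t)" "(?\<theta>2 has_real_derivative d2) (at t)"
        "((\<lambda>t. H (?\<Phi> t)) has_real_derivative dh) (at t)" for d1 d2 dh
      unfolding G_def[abs_def] by (intro DERIV_diff DERIV_add DERIV_mult du that)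
    have "(G has_real_derivative (- (\<gamma> * real m) * (?u t ^ m * angle_sum t))) (at t)"
    proof (cases "\<bar>?C\<bar> < 1")
      case True
      let ?s = "sqrt (1 - ?C\<^sup>2)"
      have s: "0 < ?s" using True by (simp add: abs_square_less_1)
      have d1: "(?\<theta>1 has_real_derivative - (inner_ratio * (?C - inner_ratio) / quad inner_ratio ?C / ?s) * ?C') (at t)"
        by (rule DERIV_chain2[OF edge_angle_derivative[OF q(1) inner_ratio_pos True] dC])
      have "\<bar>- ?C\<bar> < 1" using True by simp
      have d2: "(?\<theta>2 has_real_derivative - (rad * (?C + rad) / quad rad (- ?C) / ?s) * ?C') (at t)"
      proof -
        have "l * (- x - l) = - (l * (x + l))" for l x :: real by (simp add: algebra_simps)
        then show ?thesis
          using DERIV_chain2[OF edge_angle_derivative[OF q(2) rad_pos \<open>\<bar>- ?C\<bar> < 1\<close>] DERIV_minus[OF dC]] by simp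
      qed
      have cC: "isCont edge_coord t" using DERIV_isCont[OF dC] .
      then have "\<forall>\<^sub>F x in nhds t. \<bar>edge_coord x\<bar> < 1"
        using True order_tendstoD(2)[of "\<lambda>x. \<bar>edge_coord x\<bar>" "\<bar>?C\<bar>" "at t" 1] tendsto_rabs
        by (auto simp: isCont_def eventually_nhds_conv_at)
      then have ev: "\<forall>\<^sub>F x in nhds t. H (?\<Phi> x) = H (arccos (edge_coord x))"
        by eventually_elim (simp add: arccos_ext_eq)
      have "arccos ?C \<in> {0<..<pi}" using arccos_lt_bounded[of ?C] True by (auto simp: abs_less_iff)
      then have "(H has_real_derivative edge_integrand m (arccos ?C)) (at (arccos ?C))"
        using H[of "arccos ?C"] at_within_interior[of "arccos ?C" "{0..pi}"]
        unfolding has_real_derivative_iff_has_vector_derivative by (auto simp: interior_atLeastAtMost_real)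
      moreover have "((\<lambda>x. arccos (edge_coord x)) has_real_derivative inverse (- ?s) * ?C') (at t)"
        by (rule DERIV_chain2[OF DERIV_arccos dC]) (use True in \<open>auto simp: abs_less_iff\<close>)
      ultimately have "((\<lambda>x. H (arccos (edge_coord x))) has_real_derivative
          edge_integrand m (arccos ?C) * (inverse (- ?s) * ?C')) (at t)"
        by (rule DERIV_chain2)
      with DERIV_cong_ev[OF refl ev refl]
      have dh: "((\<lambda>x. H (?\<Phi> x)) has_real_derivative edge_integrand m (arccos ?C) * (inverse (- ?s) * ?C')) (at t)"
        by simp
      have "(- (\<gamma> * real m) * ?u t ^ m * ?\<theta>1 t + (- (inner_ratio * (?C - inner_ratio) / quad inner_ratio ?C / ?s) * ?C') * (?u t ^ m - 1)) +
        (- (\<gamma> * real m) * ?u t ^ m * ?\<theta>2 t + (- (rad * (?C + rad) / quad rad (- ?C) / ?s) * ?C') * (?u t ^ m - \<kappa> ^ m)) -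
        edge_integrand m (arccos ?C) * (inverse (- ?s) * ?C') = - (\<gamma> * real m) * (?u t ^ m * angle_sum t)"
      proof -
        have e: "edge_integrand m (arccos ?C) =
          (?u t ^ m - 1) * (inner_ratio * (?C - inner_ratio) / quad inner_ratio ?C) +
          (?u t ^ m - \<kappa> ^ m) * (rad * (?C + rad) / quad rad (- ?C))"
          using edge_integrand_antiderivative[OF True, of m] t by simp
        (* The derivative of H cancels the terms in which the angles are differentiated. *)
        have alg: "(g * U * T1 + (- (X / s) * C') * P1) + (g * U * T2 + (- (Y / s) * C') * P2) -
            (P1 * X + P2 * Y) * (inverse (- s) * C') = g * (U * (T1 + T2))"
          for g U T1 T2 X Y s C' P1 P2 :: real
          by (simp add: divide_inverse algebra_simps)
        show ?thesis unfolding e angle_sum_def by (rule alg)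
      qed
      with comb[OF d1 d2 dh] show ?thesis by simp
    next
      case False
      then have C: "1 < \<bar>?C\<bar>" using t by auto
      then have C2: "0 < ?C\<^sup>2 - 1" using abs_ge_1_iff_square(2)[of ?C] by simp
      have cC: "isCont edge_coord t" using DERIV_isCont[OF dC] .
      have "isCont (\<lambda>t. edge_cos inner_ratio (edge_coord t)) t" "isCont (\<lambda>t. edge_cos rad (- edge_coord t)) t"
        unfolding edge_cos_def quad_def using q cC by (auto intro!: continuous_intros simp: quad_def)
      moreover have "1 < \<bar>edge_cos inner_ratio ?C\<bar>" "1 < \<bar>edge_cos rad (- ?C)\<bar>"
        unfolding abs_ge_1_iff_square(2) edge_cos_square[OF q(1)] edge_cos_square[OF q(2)]
        using q C2 inner_ratio_pos rad_pos by simp_all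
      ultimately have d1: "(?\<theta>1 has_real_derivative 0) (at t)" and d2: "(?\<theta>2 has_real_derivative 0) (at t)"
        by (auto intro: arccos_ext_has_derivative_0)
      have "\<forall>\<^sub>F x in nhds t. 1 < \<bar>edge_coord x\<bar>"
        using C cC order_tendstoD(1)[of "\<lambda>x. \<bar>edge_coord x\<bar>" "\<bar>?C\<bar>" "at t" 1] tendsto_rabs
        by (auto simp: isCont_def eventually_nhds_conv_at)
      moreover have "\<forall>\<^sub>F x in nhds t. 0 < edge_coord x * ?C"
      proof -
        have "((\<lambda>x. edge_coord x * ?C) \<longlongrightarrow> ?C * ?C) (at t)"
          using cC by (intro tendsto_mult tendsto_const) (simp add: isCont_def)
        moreover have "0 < ?C * ?C" using C by (cases "0 < ?C") (auto simp: zero_less_mult_iff)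
        ultimately show ?thesis
          using order_tendstoD(1) by (auto simp: eventually_nhds_conv_at)
      qed
      ultimately have ev: "\<forall>\<^sub>F x in nhds t. H (?\<Phi> x) = H (?\<Phi> t)"
      proof eventually_elim
        case (elim x)
        then show ?case using C
          by (cases "0 < ?C") (auto simp: zero_less_mult_iff arccos_ext_ge_1 arccos_ext_le_m1)
      qed
      have dh: "((\<lambda>x. H (?\<Phi> x)) has_real_derivative 0) (at t)"
        using DERIV_cong_ev[OF refl ev refl] by simp
      from comb[OF d1 d2 dh] show ?thesis by (simp add: angle_sum_def algebra_simps)
    qed
    then show ?thesis by (simp only: has_real_derivative_iff_has_vector_derivative)
  qed
  have "((\<lambda>t. - (\<gamma> * real m) * (?u t ^ m * angle_sum t)) has_integral (G ?L - G 0)) {0..?L}"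
    by (rule fundamental_theorem_of_calculus_interior_strong[OF fin _ deriv cont]) (use L in auto)
  from has_integral_mult_right[OF this, of "- 1 / (\<gamma> * real m * pi)"]
  show ?thesis
    unfolding G0 GL moment_def using \<gamma>_nonzero m by (simp add: field_simps)
qed

end

lemma sqrt_divide_self: "0 < v \<Longrightarrow> sqrt v / v = 1 / sqrt v"
  by (simp add: real_div_sqrt divide_eq_eq eq_divide_eq)

lemma sgn_minus_half_quotient:
  "sgn (- g) * (a / 2) * (b / (w / v)) = - sgn g * (a * b * v) / (2 * w)" for g a b w v :: real
  by (simp add: sgn_minus)

text \<open>
  Here \<open>y j = q ^ j\<close>, so \<open>\<mu> = 1\<close> and \<open>\<nu> =
  \<beta>\<close>; the first term of the numerator in \<open>angle_sum_eq\<close> vanishes.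
\<close>

lemma rho_A_angle_sum:
  assumes "0 < c" "\<gamma> \<noteq> 0" "0 < t" "t < c + 1"
  shows "rho_A c \<gamma> t = limit_parameters.angle_sum c \<gamma> 1 t / pi"
proof -
  interpret limit_parameters c \<gamma> 1 using assms by unfold_locales auto
  let ?s = "exp (- \<gamma> * t / 2)"
  let ?u = "exp (- \<gamma> * t)"
  let ?W = "sqrt ((1 - ?u) * (?u - \<kappa>))"
  have u: "?u = ?s * ?s" by (simp flip: exp_add)
  have e: "exp (\<gamma> * t) = 1 / ?u" "exp (\<gamma> * (c + 1 - t)) = ?u / \<kappa>" "exp (\<gamma> - \<gamma> * t / 2) = ?s / \<alpha>"
    "exp (\<gamma> * (c - 1)) = \<alpha> / \<beta>"
    by (simp_all add: \<kappa>_exp \<alpha>_def \<beta>_def field_simps flip: exp_add)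
  have "(1 - exp (\<gamma> * t)) * (1 - exp (\<gamma> * (c + 1 - t))) = ((1 - ?u) * (?u - \<kappa>)) / (?s * ?s * \<kappa>)"
  proof -
    have "(1 - 1 / v) * (1 - v / \<kappa>) = ((1 - v) * (v - \<kappa>)) / (v * \<kappa>)" if "v \<noteq> 0" for v
      using that pos(3) by (simp add: field_simps)
    then show ?thesis unfolding e(1,2) u[symmetric] using exp_not_eq_zero by blast
  qed
  then have sq: "sqrt ((1 - exp (\<gamma> * t)) * (1 - exp (\<gamma> * (c + 1 - t)))) = ?W / (?s * sqrt \<kappa>)"
    by (simp add: real_sqrt_divide real_sqrt_mult)
  have "sgn (- \<gamma>) * (exp (\<gamma> - \<gamma> * t / 2) / 2) *
     ((1 - exp (\<gamma> * (c - 1))) / sqrt ((1 - exp (\<gamma> * t)) * (1 - exp (\<gamma> * (c + 1 - t))))) =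
     sgn \<gamma> * (\<kappa> * (1 - 1) - ?u * (\<nu> - \<alpha>)) / (2 * sqrt (\<kappa> * 1) * ?W)"
  proof -
    have W: "0 < sqrt \<kappa>" "\<kappa> = sqrt \<kappa> * sqrt \<kappa>" using pos by auto
    have "?s / \<alpha> * (1 - \<alpha> / \<beta>) * (?s * sqrt \<kappa>) = ?u * (\<beta> - \<alpha>) * sqrt \<kappa> / \<kappa>"
      unfolding u \<kappa>_def using pos by (simp add: field_simps)
    also have "\<dots> = ?u * (\<beta> - \<alpha>) / sqrt \<kappa>" using sqrt_divide_self[OF pos(3)] by (metis times_divide_eq_right mult.right_neutral)
    finally have *: "?s / \<alpha> * (1 - \<alpha> / \<beta>) * (?s * sqrt \<kappa>) = ?u * (\<beta> - \<alpha>) / sqrt \<kappa>" .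
    have "sgn (- \<gamma>) * (?s / \<alpha> / 2) * ((1 - \<alpha> / \<beta>) / (?W / (?s * sqrt \<kappa>))) =
        - sgn \<gamma> * (?u * (\<beta> - \<alpha>) / sqrt \<kappa>) / (2 * ?W)"
      by (simp only: sgn_minus_half_quotient *)
    moreover have "- g * (u * v / k) / (2 * w) = g * (\<kappa> * (1 - 1) - u * v) / (2 * k * w)" for g u v k w
      by (simp add: mult_ac)
    ultimately show ?thesis unfolding sq unfolding e by (simp only: \<nu>_def mult_1_right)
  qed
  then show ?thesis
    unfolding rho_A_def angle_sum_eq[OF assms(3,4)] by simp
qed

text \<open>
  Here \<open>\<mu>\<close> is the limit \<open>exp (\<gamma> c)\<close> of \<open>q\<^bsup>1 -
  k\<^esup>\<close>, so \<open>\<nu> = 1\<close>.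
\<close>

lemma rho_B_angle_sum:
  assumes "0 < c" "\<gamma> \<noteq> 0" "0 < t" "t < c + 1"
  shows "rho_B c \<gamma> t = limit_parameters.angle_sum c \<gamma> (exp (\<gamma> * c)) t / pi"
proof -
  interpret limit_parameters c \<gamma> "exp (\<gamma> * c)" using assms by unfold_locales auto
  let ?s = "exp (- \<gamma> * t / 2)" and ?b = "exp (- \<gamma> * c / 2)"
  let ?u = "exp (- \<gamma> * t)"
  let ?W = "sqrt ((1 - ?u) * (?u - \<kappa>))"
  have u: "?u = ?s * ?s" by (simp flip: exp_add)
  have b: "\<beta> = ?b * ?b" by (simp add: \<beta>_def flip: exp_add)
  have mu: "exp (\<gamma> * c) = 1 / \<beta>" by (simp add: \<beta>_def exp_minus field_simps)
  have nu: "\<nu> = 1" by (simp add: \<nu>_def \<beta>_def flip: exp_add)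
  have e: "exp (\<gamma> * t) = 1 / ?u" "exp (\<gamma> * (c + 1 - t)) = ?u / \<kappa>" "exp (\<gamma> / 2 * (t - c)) = ?b / ?s"
    "exp (\<gamma> * (c - t)) = ?u / \<beta>"
    by (simp_all add: \<kappa>_exp \<beta>_def field_simps flip: exp_add)
  have "(1 - exp (\<gamma> * t)) * (1 - exp (\<gamma> * (c + 1 - t))) = ((1 - ?u) * (?u - \<kappa>)) / (?s * ?s * \<kappa>)"
  proof -
    have "(1 - 1 / v) * (1 - v / \<kappa>) = ((1 - v) * (v - \<kappa>)) / (v * \<kappa>)" if "v \<noteq> 0" for v
      using that pos(3) by (simp add: field_simps)
    then show ?thesis unfolding e(1,2) u[symmetric] using exp_not_eq_zero by blast
  qed
  then have sq: "sqrt ((1 - exp (\<gamma> * t)) * (1 - exp (\<gamma> * (c + 1 - t)))) = ?W / (?s * sqrt \<kappa>)"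
    by (simp add: real_sqrt_divide real_sqrt_mult)
  have "sgn (- \<gamma>) * (exp (\<gamma> / 2 * (t - c)) / 2) *
     ((1 - exp (\<gamma> * c) - exp (\<gamma> * (c - t)) + exp (\<gamma> * (c + 1 - t))) /
      sqrt ((1 - exp (\<gamma> * t)) * (1 - exp (\<gamma> * (c + 1 - t))))) =
     sgn \<gamma> * (\<kappa> * (exp (\<gamma> * c) - 1) - ?u * (\<nu> - \<alpha>)) / (2 * sqrt (\<kappa> * exp (\<gamma> * c)) * ?W)"
  proof -
    let ?N = "1 - 1 / \<beta> - ?u / \<beta> + ?u / \<kappa>" and ?S = "\<kappa> * (1 / \<beta> - 1) - ?u * (1 - \<alpha>)"
    have a: "0 < sqrt \<alpha>" "\<alpha> = sqrt \<alpha> * sqrt \<alpha>" using pos by auto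
    have k: "\<kappa> * (1 / \<beta>) = \<alpha>" using pos by (simp add: \<kappa>_def)
    have sk: "sqrt \<kappa> = sqrt \<alpha> * ?b" unfolding \<kappa>_def b by (simp add: real_sqrt_mult)
    have "?b / ?s * ?N * (?s * sqrt \<kappa>) = \<beta> * ?N * sqrt \<alpha>"
      unfolding sk b by simp
    also have "\<beta> * ?N = - ?S / \<alpha>"
      unfolding \<kappa>_def using pos by (simp add: field_simps)
    also have "- ?S / \<alpha> * sqrt \<alpha> = - ?S / sqrt \<alpha>"
      using sqrt_divide_self[OF pos(1)] by (metis times_divide_eq_right times_divide_eq_left mult.right_neutral)
    finally have *: "?b / ?s * ?N * (?s * sqrt \<kappa>) = - ?S / sqrt \<alpha>" .
    have "sgn (- \<gamma>) * (?b / ?s / 2) * (?N / (?W / (?s * sqrt \<kappa>))) =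
        - sgn \<gamma> * (- ?S / sqrt \<alpha>) / (2 * ?W)"
      by (simp only: sgn_minus_half_quotient *)
    moreover have "- g * (- v / k) / (2 * w) = g * v / (2 * k * w)" for g v k w :: real
      by (simp add: mult_ac)
    ultimately show ?thesis unfolding sq unfolding nu unfolding e mu unfolding k by (simp only:)
  qed
  then show ?thesis
    unfolding rho_B_def angle_sum_eq[OF assms(3,4)] by simp
qed

section \<open>Convergence to the limit shape\<close>

context schur_pair
begin

lemma expect_mono:
  assumes "\<And>S. f S \<le> g S"
  shows "expect f \<le> expect g"
  unfolding expect_def using assms diagram_weight_nonneg by (intro sum_mono mult_left_mono) auto

lemma expect_sum: "expect (\<lambda>S. \<Sum>i\<in>I. f i S) = (\<Sum>i\<in>I. expect (f i))"
  unfolding expect_def sum_distrib_left by (rule sum.swap)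

lemma chebyshev:
  assumes \<eta>: "0 < \<eta>"
    and P: "\<And>\<nu>. \<nu> \<in> young_rect n k \<Longrightarrow> P \<nu> \<Longrightarrow> \<eta> \<le> \<bar>f (particles n \<nu>)\<bar>"
  shows "measure (diagram_measure n k x y) {\<nu> \<in> space (diagram_measure n k x y). P \<nu>} \<le> expect (\<lambda>S. (f S)\<^sup>2) / \<eta>\<^sup>2"
proof -
  let ?w = "diagram_weight n k x y"
  let ?A = "{\<nu> \<in> young_rect n k. P \<nu>}"
  have "measure (diagram_measure n k x y) {\<nu> \<in> space (diagram_measure n k x y). P \<nu>} = (\<Sum>\<nu>\<in>?A. ?w \<nu>)"
    unfolding diagram_measure_def space_point_measure
    by (subst measure_point_measure_finite_if) (auto simp: finite_young_rect diagram_weight_nonneg)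
  also have "\<dots> \<le> (\<Sum>\<nu>\<in>?A. ?w \<nu> * ((f (particles n \<nu>))\<^sup>2 / \<eta>\<^sup>2))"
  proof (rule sum_mono)
    fix \<nu> assume \<nu>: "\<nu> \<in> ?A"
    then have "\<bar>\<eta>\<bar> \<le> \<bar>f (particles n \<nu>)\<bar>" using P \<eta> by auto
    then have "\<eta>\<^sup>2 \<le> (f (particles n \<nu>))\<^sup>2" by (simp only: abs_le_square_iff)
    then have "1 \<le> (f (particles n \<nu>))\<^sup>2 / \<eta>\<^sup>2" using \<eta> by simp
    from mult_left_mono[OF this, of "?w \<nu>"] show "?w \<nu> \<le> ?w \<nu> * ((f (particles n \<nu>))\<^sup>2 / \<eta>\<^sup>2)"
      using diagram_weight_nonneg \<nu> by simp
  qed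
  also have "\<dots> \<le> (\<Sum>\<nu>\<in>young_rect n k. ?w \<nu> * ((f (particles n \<nu>))\<^sup>2 / \<eta>\<^sup>2))"
    by (rule sum_mono2) (auto simp: finite_young_rect diagram_weight_nonneg intro!: mult_nonneg_nonneg)
  also have "\<dots> = expect (\<lambda>S. (f S)\<^sup>2) / \<eta>\<^sup>2"
    by (simp add: expect_def sum_divide_distrib)
  finally show ?thesis .
qed

end

text \<open>
  Bias and variance of a normalized power sum around a number \<open>M\<close>. By
  \<open>q_expect_square_le\<close> the variance is itself a mean of a power sum, divided by
  \<open>n\<close>.
\<close>

lemma (in q_pair) expect_square_deviation_le:
  defines "Y \<equiv> \<lambda>m S. (\<Sum>a\<in>S. (q ^ m) ^ a) / real n"
  shows "expect (\<lambda>S. (Y m S - M)\<^sup>2) \<le> (expect (Y m) - M)\<^sup>2 + expect (Y (2 * m)) / real n"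
proof -
  let ?P = "\<lambda>S. \<Sum>a\<in>S. (q ^ m) ^ a"
  have E: "expect (\<lambda>S. f S / real n) = expect f / real n" for f
    using expect_scale[of "1 / real n" f] by simp
  have "expect (\<lambda>S. (Y m S - M)\<^sup>2) = expect (\<lambda>S. (Y m S)\<^sup>2 + ((- 2 * M) * Y m S + M\<^sup>2))"
    by (simp add: power2_diff algebra_simps)
  also have "\<dots> = expect (\<lambda>S. (Y m S)\<^sup>2) + ((- 2 * M) * expect (Y m) + M\<^sup>2)"
    by (simp only: expect_add expect_scale expect_const)
  also have "expect (\<lambda>S. (Y m S)\<^sup>2) = expect (\<lambda>S. (?P S)\<^sup>2) / (real n)\<^sup>2"
    unfolding Y_def power_divide using expect_scale[of "1 / (real n)\<^sup>2" "\<lambda>S. (?P S)\<^sup>2"] by simp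
  also have "expect (\<lambda>S. (?P S)\<^sup>2) / (real n)\<^sup>2 \<le> (expect (\<lambda>S. \<Sum>a\<in>S. ((q ^ m)\<^sup>2) ^ a) + (expect ?P)\<^sup>2) / (real n)\<^sup>2"
    using q_expect_square_le[of "q ^ m"] q_pos by (intro divide_right_mono) auto
  also have "\<dots> = expect (Y (2 * m)) / real n + (expect (Y m))\<^sup>2"
  proof -
    have "(q ^ m)\<^sup>2 = q ^ (2 * m)" by (simp add: power_mult power2_eq_square power_mult_distrib)
    then show ?thesis unfolding Y_def E by (simp add: add_divide_distrib power_divide power2_eq_square)
  qed
  finally have "expect (\<lambda>S. (Y m S - M)\<^sup>2) \<le>
      expect (Y (2 * m)) / real n + (expect (Y m))\<^sup>2 + ((- 2 * M) * expect (Y m) + M\<^sup>2)" by simp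
  moreover have "(expect (Y m) - M)\<^sup>2 = (expect (Y m))\<^sup>2 + ((- 2 * M) * expect (Y m) + M\<^sup>2)"
    by (simp add: power2_diff)
  ultimately show ?thesis by linarith
qed

lemma deriv_upper_boundary:
  assumes n: "0 < n" and x: "0 < x" "\<And>j::nat. x \<noteq> real j / real n"
  shows "deriv (upper_boundary n \<nu>) x = boundary_slope n \<nu> x"
proof -
  define j where "j = nat \<lfloor>x * real n\<rfloor>"
  have "real j = real_of_int \<lfloor>x * real n\<rfloor>" using x n by (simp add: j_def)
  then have j: "real j \<le> x * real n" "x * real n < real j + 1" by linarith+
  have "x * real n \<noteq> real j" using x(2)[of j] n by (auto simp: field_simps)
  then have x': "real j / real n < x" "x < (real j + 1) / real n"
    using j n by (auto simp: field_simps)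
  let ?s = "if j \<in> particles n \<nu> then -1 else 1 :: real"
  have "((\<lambda>x. upper_boundary n \<nu> (real j / real n) + ?s * (x - real j / real n)) has_real_derivative ?s) (at x)"
    by (auto intro!: derivative_eq_intros)
  then have "(upper_boundary n \<nu> has_real_derivative ?s) (at x)"
  proof (rule has_field_derivative_transform_within_open[where S = "{real j / real n<..<(real j + 1) / real n}"])
    fix x' assume "x' \<in> {real j / real n<..<(real j + 1) / real n}"
    then show "upper_boundary n \<nu> (real j / real n) + ?s * (x' - real j / real n) = upper_boundary n \<nu> x'"
      using upper_boundary_step[OF n, of j x' \<nu>] by simp
  qed (use x' in auto)
  then have "deriv (upper_boundary n \<nu>) x = ?s" by (rule DERIV_imp_deriv)
  then show ?thesis using boundary_slope_on[OF n, of j x \<nu>] x' by simp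
qed

text \<open>
  Extension by \<open>0\<close>, so that integrals over cells that reach beyond the interval
  need no case distinction.
\<close>

definition cutoff :: "real \<Rightarrow> (real \<Rightarrow> real) \<Rightarrow> real \<Rightarrow> real" where
  "cutoff L g t = (if 0 < t \<and> t < L then g t else 0)"

lemma continuous_cutoff:
  assumes g: "continuous_on {0<..<L} g" and K: "compactly_supported_on {0<..<L} g"
  shows "continuous_on UNIV (cutoff L g)"
proof -
  obtain C where C: "compact C" "C \<subseteq> {0<..<L}" "\<And>x. x \<in> {0<..<L} - C \<Longrightarrow> g x = 0"
    using K unfolding compactly_supported_on_def by blast
  have "continuous_on {0<..<L} (cutoff L g)"
    using g by (rule continuous_on_eq) (auto simp: cutoff_def)
  moreover have "continuous_on (- C) (cutoff L g)"
  proof -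
    have "cutoff L g x = 0" if "x \<in> - C" for x using C(3)[of x] that by (auto simp: cutoff_def)
    then show ?thesis by (subst continuous_on_cong[OF refl, of _ _ "\<lambda>_. 0"]) auto
  qed
  ultimately have "continuous_on ({0<..<L} \<union> - C) (cutoff L g)"
    using C(1) by (intro continuous_on_open_Un) (auto simp: compact_imp_closed)
  moreover have "{0<..<L} \<union> - C = UNIV" using C(2) by auto
  ultimately show ?thesis by simp
qed

lemma cutoff_outside: "(\<lambda>x. if x \<in> {0..L} then cutoff L g x else 0) = cutoff L g"
  by (auto simp: cutoff_def)

lemma integrable_cutoff:
  assumes "continuous_on UNIV (cutoff L g)"
  shows "integrable lborel (cutoff L g)" "(cutoff L g has_integral (LINT x|lborel. cutoff L g x)) {0..L}"
proof -
  have "integrable lborel (\<lambda>x. indicator {0..L} x *\<^sub>R cutoff L g x)"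
    using assms by (intro borel_integrable_compact) (auto intro: continuous_on_subset)
  moreover have eq: "(\<lambda>x. indicator {0..L} x *\<^sub>R cutoff L g x) = cutoff L g"
    by (auto simp: cutoff_def indicator_def)
  ultimately show int: "integrable lborel (cutoff L g)" by simp
  then have "(cutoff L g has_integral (LINT x|lborel. cutoff L g x)) UNIV"
    by (rule has_integral_integral_lborel)
  then show "(cutoff L g has_integral (LINT x|lborel. cutoff L g x)) {0..L}"
    using has_integral_restrict_UNIV[of "{0..L}" "cutoff L g"]
      cutoff_outside by simp
qed

lemma boundary_slope_indicator:
  assumes n: "0 < n"
  shows "boundary_slope n \<nu> x = 1 - 2 * (\<Sum>a\<in>particles n \<nu>. indicator {real a / real n..<(real a + 1) / real n} x)"
proof -
  let ?I = "\<lambda>a. indicator {real a / real n..<(real a + 1) / real n} x :: real"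
  have fin: "finite (particles n \<nu>)" by (simp add: particles_def)
  show ?thesis
  proof (cases "\<exists>a\<in>particles n \<nu>. real a / real n \<le> x \<and> x < (real a + 1) / real n")
    case True
    then obtain a where a: "a \<in> particles n \<nu>" "real a / real n \<le> x" "x < (real a + 1) / real n" by blast
    have "?I b = 0" if "b \<in> particles n \<nu> - {a}" for b
    proof -
      have "\<not> (real b / real n \<le> x \<and> x < (real b + 1) / real n)"
      proof
        assume "real b / real n \<le> x \<and> x < (real b + 1) / real n"
        then have "real a < real b + 1" "real b < real a + 1" using a n by (simp_all add: field_simps)
        then show False using that by auto
      qed
      then show ?thesis by (simp add: indicator_def)
    qed
    then have "(\<Sum>b\<in>particles n \<nu>. ?I b) = ?I a"
      using a(1) fin by (simp add: sum.remove)
    then show ?thesis using True a by (auto simp: boundary_slope_def)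
  next
    case False
    then have "(\<Sum>b\<in>particles n \<nu>. ?I b) = 0" by (intro sum.neutral) (auto simp: indicator_def)
    moreover have "boundary_slope n \<nu> x = 1" using False unfolding boundary_slope_def by (rule if_not_P)
    ultimately show ?thesis by simp
  qed
qed

text \<open>
  Each particle lowers the slope from \<open>1\<close> to \<open>- 1\<close> on its cell. The
  boundary has corners only at the countably many points \<open>j / n\<close>.
\<close>

lemma integral_deriv_upper_boundary:
  assumes n: "0 < n" and int: "integrable lborel (cutoff L g)"
  shows "(LBINT x:{0<..<L}. g x * deriv (upper_boundary n \<nu>) x) = (LINT x|lborel. cutoff L g x) -
    2 * (\<Sum>a\<in>particles n \<nu>. LINT x|lborel. indicator {real a / real n..<(real a + 1) / real n} x * cutoff L g x)"
proof -
  let ?I = "\<lambda>a x. indicator {real a / real n..<(real a + 1) / real n} x :: real"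
  have intI: "integrable lborel (\<lambda>x. ?I a x * cutoff L g x)" for a
    using integrable_mult_indicator[OF _ int, of "{real a / real n..<(real a + 1) / real n}"] by simp
  have "(LBINT x:{0<..<L}. g x * deriv (upper_boundary n \<nu>) x) =
      (LINT x|lborel. cutoff L g x - 2 * (\<Sum>a\<in>particles n \<nu>. ?I a x * cutoff L g x))"
    unfolding set_lebesgue_integral_def
  proof (rule integral_discrete_difference[where X = "range (\<lambda>j::nat. real j / real n)"])
    fix x :: real assume "x \<notin> range (\<lambda>j::nat. real j / real n)"
    then have x: "\<And>j::nat. x \<noteq> real j / real n" by auto
    show "indicator {0<..<L} x *\<^sub>R (g x * deriv (upper_boundary n \<nu>) x) =
       cutoff L g x - 2 * (\<Sum>a\<in>particles n \<nu>. ?I a x * cutoff L g x)"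
    proof (cases "0 < x \<and> x < L")
      case True
      then show ?thesis
        using deriv_upper_boundary[OF n, of x \<nu>] x
        by (simp add: boundary_slope_indicator[OF n] cutoff_def right_diff_distrib sum_distrib_left mult_ac)
    qed (auto simp: cutoff_def)
  qed auto
  also have "\<dots> = (LINT x|lborel. cutoff L g x) - (LINT x|lborel. 2 * (\<Sum>a\<in>particles n \<nu>. ?I a x * cutoff L g x))"
    by (rule Bochner_Integration.integral_diff) (use int intI in auto)
  also have "(LINT x|lborel. 2 * (\<Sum>a\<in>particles n \<nu>. ?I a x * cutoff L g x)) =
      2 * (\<Sum>a\<in>particles n \<nu>. LINT x|lborel. ?I a x * cutoff L g x)"
    using intI by (simp add: Bochner_Integration.integral_sum)
  finally show ?thesis .
qed

lemma cell_integral_bound: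
  fixes f :: "real \<Rightarrow> real"
  assumes int: "integrable lborel f" and h: "0 \<le> h" and B: "\<And>t. l \<le> t \<Longrightarrow> t < l + h \<Longrightarrow> \<bar>f t - v\<bar> \<le> B"
  shows "\<bar>(LINT x|lborel. indicator {l..<l + h} x * f x) - h * v\<bar> \<le> h * B"
proof -
  let ?I = "\<lambda>x. indicator {l..<l + h} x :: real"
  have intI: "integrable lborel (\<lambda>x. ?I x * f x)"
    using integrable_mult_indicator[OF _ int, of "{l..<l + h}"] by simp
  have intc: "integrable lborel (\<lambda>x. ?I x * w)" for w
    using h by (intro integrable_mult_left integrable_real_indicator) auto
  have c: "(LINT x|lborel. ?I x * w) = h * w" for w using h by simp
  have intd: "integrable lborel (\<lambda>x. ?I x * f x - ?I x * v)"
    by (intro Bochner_Integration.integrable_diff intI intc)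
  have "\<bar>LINT x|lborel. ?I x * f x - ?I x * v\<bar> \<le> (LINT x|lborel. \<bar>?I x * f x - ?I x * v\<bar>)"
    using integral_norm_bound[of lborel "\<lambda>x. ?I x * f x - ?I x * v"] by simp
  also have "\<dots> \<le> (LINT x|lborel. ?I x * B)"
  proof (rule integral_mono)
    show "\<bar>?I x * f x - ?I x * v\<bar> \<le> ?I x * B" for x
      using B[of x] by (auto simp: indicator_def)
  qed (use intd intc in auto)
  finally have "\<bar>LINT x|lborel. ?I x * f x - ?I x * v\<bar> \<le> h * B" unfolding c .
  moreover have "(LINT x|lborel. ?I x * f x - ?I x * v) = (LINT x|lborel. ?I x * f x) - h * v"
    unfolding Bochner_Integration.integral_diff[OF intI intc] c ..
  ultimately show ?thesis by simp
qed

text \<open>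
  The bound makes the density integrable up to the end points of the interval, where it need not
  be continuous.
\<close>

lemma deriv_limit_shape:
  assumes \<rho>: "continuous_on {0<..<L} \<rho>" and B: "\<And>t. 0 < t \<Longrightarrow> t < L \<Longrightarrow> \<bar>\<rho> t\<bar> \<le> B" and x: "0 < x" "x < L"
  shows "deriv (limit_shape \<rho>) x = 1 - 2 * \<rho> x"
proof -
  let ?f = "\<lambda>t. 1 - 2 * \<rho> t"
  have cf: "continuous_on {0<..<L} ?f" by (intro continuous_intros \<rho>)
  have "set_integrable lborel {0<..<L} ?f"
    unfolding set_integrable_def
  proof (rule integrableI_bounded_set[where A = "{0<..<L}" and B = "1 + 2 * B"])
    show "(\<lambda>x. indicator {0<..<L} x *\<^sub>R ?f x) \<in> borel_measurable lborel"
      using borel_measurable_continuous_on_indicator[OF _ cf] by simp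
    show "AE x in lborel. x \<in> {0<..<L} \<longrightarrow> norm (indicator {0<..<L} x *\<^sub>R ?f x) \<le> 1 + 2 * B"
      using B by (intro AE_I2) (auto simp: abs_le_iff, (smt (verit))+)
  qed (use x in \<open>auto simp: indicator_def\<close>)
  then have "?f integrable_on {0<..<L}" by (rule set_borel_integral_eq_integral(1))
  then have int: "?f integrable_on {0..L}" by (simp only: integrable_on_Icc_iff_Ioo)
  have op: "at x within {0..L} = at x" using x by (intro at_within_interior) simp
  have "isCont ?f x" using cf x by (simp add: continuous_on_eq_continuous_at)
  then have "((\<lambda>u. integral {0..u} ?f) has_vector_derivative ?f x) (at x within ({0..L} - {}))"
    using int x op by (intro integral_has_vector_derivative_continuous_at) auto
  then have "((\<lambda>u. integral {0..u} ?f) has_real_derivative ?f x) (at x)"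
    unfolding has_real_derivative_iff_has_vector_derivative using op by simp
  then have "((\<lambda>u. 1 + integral {0..u} ?f) has_real_derivative 0 + ?f x) (at x)"
    by (intro DERIV_add DERIV_const)
  then show ?thesis
    unfolding limit_shape_def[abs_def] by (simp add: DERIV_imp_deriv)
qed

lemma integral_deriv_limit_shape:
  assumes \<rho>: "continuous_on {0<..<L} \<rho>" "\<And>t. 0 < t \<Longrightarrow> t < L \<Longrightarrow> \<bar>\<rho> t\<bar> \<le> B"
    and int: "integrable lborel (cutoff L g)" "integrable lborel (cutoff L (\<lambda>t. g t * \<rho> t))"
  shows "(LBINT x:{0<..<L}. g x * deriv (limit_shape \<rho>) x) =
    (LINT x|lborel. cutoff L g x) - 2 * (LINT x|lborel. cutoff L (\<lambda>t. g t * \<rho> t) x)"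
proof -
  have "(LBINT x:{0<..<L}. g x * deriv (limit_shape \<rho>) x) =
      (LINT x|lborel. cutoff L g x - 2 * cutoff L (\<lambda>t. g t * \<rho> t) x)"
    unfolding set_lebesgue_integral_def
  proof (rule Bochner_Integration.integral_cong[OF refl])
    fix x show "indicator {0<..<L} x *\<^sub>R (g x * deriv (limit_shape \<rho>) x) =
        cutoff L g x - 2 * cutoff L (\<lambda>t. g t * \<rho> t) x"
    proof (cases "0 < x \<and> x < L")
      case True
      then have d: "deriv (limit_shape \<rho>) x = 1 - 2 * \<rho> x" using deriv_limit_shape[OF \<rho>, of x] by blast
      show ?thesis unfolding d using True by (simp add: cutoff_def algebra_simps)
    qed (auto simp: cutoff_def)
  qed
  also have "\<dots> = (LINT x|lborel. cutoff L g x) - 2 * (LINT x|lborel. cutoff L (\<lambda>t. g t * \<rho> t) x)"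
    using int by (subst Bochner_Integration.integral_diff) auto
  finally show ?thesis .
qed

lemma q_asymptotics:
  fixes \<gamma> c :: real and k :: "nat \<Rightarrow> nat"
  assumes \<gamma>: "\<gamma> \<noteq> 0" and k: "(\<lambda>n. real (k n) / real n) \<longlonglongrightarrow> c"
  defines "q \<equiv> \<lambda>n. 1 - \<gamma> / real n"
  shows "q \<longlonglongrightarrow> 1" "\<forall>\<^sub>F n in sequentially. 0 < q n \<and> q n \<noteq> 1" "(\<lambda>n. q n ^ n) \<longlonglongrightarrow> exp (- \<gamma>)"
    "(\<lambda>n. q n ^ k n) \<longlonglongrightarrow> exp (- \<gamma> * c)" "(\<lambda>n. real n * ln (q n)) \<longlonglongrightarrow> - \<gamma>"
    "(\<lambda>n. real n * (q n ^ m - 1)) \<longlonglongrightarrow> - \<gamma> * real m"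
proof -
  have inf: "(\<lambda>n. \<gamma> / real n) \<longlonglongrightarrow> 0" by (rule lim_const_over_n)
  show q1: "q \<longlonglongrightarrow> 1" unfolding q_def using tendsto_diff[OF tendsto_const inf, of 1] by simp
  have pos: "\<forall>\<^sub>F n in sequentially. 0 < q n" using order_tendstoD(1)[OF q1, of 0] by simp
  have n0: "\<forall>\<^sub>F n in sequentially. 0 < n" by (rule eventually_gt_at_top)
  show "\<forall>\<^sub>F n in sequentially. 0 < q n \<and> q n \<noteq> 1"
    using pos n0 by eventually_elim (use \<gamma> in \<open>auto simp: q_def\<close>)
  show qn: "(\<lambda>n. q n ^ n) \<longlonglongrightarrow> exp (- \<gamma>)"
    using tendsto_exp_limit_sequentially[of "- \<gamma>"] by (simp add: q_def)
  then have "(\<lambda>n. ln (q n ^ n)) \<longlonglongrightarrow> ln (exp (- \<gamma>))" by (intro tendsto_ln) auto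
  moreover have "\<forall>\<^sub>F n in sequentially. ln (q n ^ n) = real n * ln (q n)"
    using pos by eventually_elim (simp add: ln_realpow)
  ultimately show ln: "(\<lambda>n. real n * ln (q n)) \<longlonglongrightarrow> - \<gamma>"
    using Lim_transform_eventually by fastforce
  have "(\<lambda>n. exp ((real n * ln (q n)) * (real (k n) / real n))) \<longlonglongrightarrow> exp (- \<gamma> * c)"
    by (intro tendsto_intros ln k)
  moreover have "\<forall>\<^sub>F n in sequentially. exp ((real n * ln (q n)) * (real (k n) / real n)) = q n ^ k n"
    using pos n0 by eventually_elim (simp add: exp_of_nat_mult mult.commute)
  ultimately show "(\<lambda>n. q n ^ k n) \<longlonglongrightarrow> exp (- \<gamma> * c)"
    by (rule Lim_transform_eventually)
  have "(\<lambda>n. - \<gamma> * (\<Sum>i<m. q n ^ i)) \<longlonglongrightarrow> - \<gamma> * (\<Sum>i<m. 1 ^ i)"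
    by (intro tendsto_intros q1)
  moreover have "\<forall>\<^sub>F n in sequentially. - \<gamma> * (\<Sum>i<m. q n ^ i) = real n * (q n ^ m - 1)"
    using n0 by eventually_elim (simp add: power_diff_1_eq q_def)
  ultimately show "(\<lambda>n. real n * (q n ^ m - 1)) \<longlonglongrightarrow> - \<gamma> * real m"
    using Lim_transform_eventually by fastforce
qed

text \<open>
  The moments are known for positive exponents only, so the approximating polynomial in \<open>u
  = exp (- \<gamma> t)\<close> must have no constant term: Weierstrass approximation is applied
  to \<open>h / u\<close>.
\<close>

lemma geometric_test_function_approx:
  fixes h :: "real \<Rightarrow> real"
  assumes h: "continuous_on UNIV h" and \<gamma>: "\<gamma> \<noteq> 0" and \<delta>: "0 < \<delta>"
  obtains a :: "nat \<Rightarrow> real" and d where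
    "\<And>t. 0 \<le> t \<Longrightarrow> t \<le> T \<Longrightarrow> \<bar>h t - (\<Sum>i\<le>d. a i * exp (- \<gamma> * t) ^ Suc i)\<bar> \<le> \<delta>"
proof -
  let ?B = "exp (\<bar>\<gamma>\<bar> * T)"
  let ?I = "{inverse ?B..?B}"
  have \<delta>B: "0 < \<delta> / ?B" using \<delta> by simp
  have cont: "continuous_on ?I (\<lambda>u. h (- ln u / \<gamma>) / u)"
  proof -
    have pos: "0 < u" if "u \<in> ?I" for u
    proof -
      have "0 < inverse ?B" "inverse ?B \<le> u" using that by auto
      then show ?thesis by (rule less_le_trans)
    qed
    have pos': "\<forall>u\<in>?I. u \<noteq> 0" using pos by (metis less_irrefl)
    have "continuous_on ?I (\<lambda>u. - ln u / \<gamma>)"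
      by (intro continuous_on_divide continuous_on_minus continuous_on_ln continuous_on_id continuous_on_const)
        (use pos' \<gamma> in auto)
    then have "continuous_on ?I (\<lambda>u. h (- ln u / \<gamma>))"
      by (rule continuous_on_compose2[OF h]) simp
    then show ?thesis by (rule continuous_on_divide[OF _ continuous_on_id pos'])
  qed
  obtain g where g: "real_polynomial_function g" "\<And>u. u \<in> ?I \<Longrightarrow> \<bar>h (- ln u / \<gamma>) / u - g u\<bar> < \<delta> / ?B"
    by (rule Stone_Weierstrass_real_polynomial_function[OF compact_Icc cont \<delta>B]) blast
  obtain a d where ad: "g = (\<lambda>u. \<Sum>i\<le>d. a i * u ^ i)" using g(1) real_polynomial_function_iff_sum by blast
  have "\<bar>h t - (\<Sum>i\<le>d. a i * exp (- \<gamma> * t) ^ Suc i)\<bar> \<le> \<delta>" if t: "0 \<le> t" "t \<le> T" for t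
  proof -
    let ?u = "exp (- \<gamma> * t)"
    have "\<bar>\<gamma> * t\<bar> \<le> \<bar>\<gamma>\<bar> * T" using t by (simp add: abs_mult mult_left_mono)
    then have u: "?u \<le> ?B" "inverse ?B \<le> ?u" by (auto simp: abs_le_iff simp flip: exp_minus)
    have "- ln ?u / \<gamma> = t" using \<gamma> by simp
    then have "\<bar>h t / ?u - g ?u\<bar> \<le> \<delta> / ?B" using g(2)[of ?u] u by auto
    then have "?u * \<bar>h t / ?u - g ?u\<bar> \<le> ?B * (\<delta> / ?B)" using u by (intro mult_mono) auto
    moreover have "?u * \<bar>h t / ?u - g ?u\<bar> = \<bar>?u * (h t / ?u - g ?u)\<bar>" by (simp add: abs_mult)
    moreover have "?u * (h t / ?u - g ?u) = h t - (\<Sum>i\<le>d. a i * ?u ^ Suc i)"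
      by (simp add: ad right_diff_distrib sum_distrib_left mult_ac)
    ultimately show ?thesis by simp
  qed
  then show thesis by (rule that)
qed

text \<open>
  The pairing of a test function with the slope is, up to small errors, a linear combination of
  normalized power sums \<open>Y n m\<close>, whose means converge to the moments of the density
  and whose variances tend to \<open>0\<close>.
\<close>

theorem (in limit_parameters) q_pair_limit_shape:
  fixes k :: "nat \<Rightarrow> nat" and M :: "nat \<Rightarrow> real" and x y :: "nat \<Rightarrow> nat \<Rightarrow> real" and \<rho> :: "real \<Rightarrow> real"
  assumes k: "(\<lambda>n. real (k n) / real n) \<longlonglongrightarrow> c" and M: "M \<longlonglongrightarrow> \<mu>"
    and Q: "\<forall>\<^sub>F n in sequentially. q_pair n (k n) (1 - \<gamma> / real n) (M n) (e n) (x n) (y n)"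
    and \<rho>: "\<And>t. 0 < t \<Longrightarrow> t < c + 1 \<Longrightarrow> \<rho> t = angle_sum t / pi"
  shows "has_limit_shape (\<lambda>n. diagram_measure n (k n) (x n) (y n)) (c + 1) (limit_shape \<rho>)"
proof -
  define q where "q n = 1 - \<gamma> / real n" for n
  let ?L = "c + 1"
  have L: "0 < ?L" using c_pos by simp
  note qa = q_asymptotics[OF \<gamma>_nonzero k, folded q_def]
  have Q: "\<forall>\<^sub>F n in sequentially. q_pair n (k n) (q n) (M n) (e n) (x n) (y n)"
    using Q by (simp add: q_def)
  let ?E = "\<lambda>n. schur_pair.expect n (k n) (x n) (y n)"
  define Y where "Y n m S = (\<Sum>a\<in>S. (q n ^ m) ^ a) / real n" for n m S
  have mean: "(\<lambda>n. ?E n (Y n m)) \<longlonglongrightarrow> moment m" if m: "0 < m" for m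
  proof (rule Lim_transform_eventually[OF moment_limit[OF m qa(1) _ qa(3)[folded \<alpha>_def] qa(4)[folded \<beta>_def] M qa(6)]])
    show "\<forall>\<^sub>F n in sequentially. q n \<noteq> 1" using qa(2) by eventually_elim simp
    have "\<forall>\<^sub>F n in sequentially. m \<le> n" by (rule eventually_ge_at_top)
    with Q show "\<forall>\<^sub>F n in sequentially. q n ^ (m * (n + k n)) / (q n ^ m - 1) *
         (\<Sum>l<m. moment_summand m (q n) (q n ^ k n) (M n) (q n ^ n * (q n ^ l / q n ^ m)) /
            (\<Prod>l'\<in>{..<m} - {l}. q n ^ n * (q n ^ l / q n ^ m) - q n ^ n * (q n ^ l' / q n ^ m))) / real n = ?E n (Y n m)"
    proof eventually_elim
      case (elim n)
      interpret q_pair n "k n" "q n" "M n" "e n" "x n" "y n" by (rule elim(1))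
      show ?case
        unfolding expect_geometric_moment[OF m elim(2), symmetric]
        using expect_scale[of "1 / real n" "\<lambda>S. \<Sum>a\<in>S. (q n ^ m) ^ a"] by (simp add: Y_def[abs_def])
    qed
  qed
  have dev: "(\<lambda>n. ?E n (\<lambda>S. (Y n m S - moment m)\<^sup>2)) \<longlonglongrightarrow> 0" if m: "0 < m" for m
  proof (rule tendsto_sandwich)
    show "\<forall>\<^sub>F n in sequentially. 0 \<le> ?E n (\<lambda>S. (Y n m S - moment m)\<^sup>2)"
      using Q
    proof eventually_elim
      case (elim n)
      interpret q_pair n "k n" "q n" "M n" "e n" "x n" "y n" by (rule elim)
      show ?case using expect_mono[of "\<lambda>_. 0" "\<lambda>S. (Y n m S - moment m)\<^sup>2"] expect_const[of 0] by simp
    qed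
    show "\<forall>\<^sub>F n in sequentially. ?E n (\<lambda>S. (Y n m S - moment m)\<^sup>2) \<le>
        (?E n (Y n m) - moment m)\<^sup>2 + ?E n (Y n (2 * m)) / real n"
      using Q
    proof eventually_elim
      case (elim n)
      interpret q_pair n "k n" "q n" "M n" "e n" "x n" "y n" by (rule elim)
      show ?case using expect_square_deviation_le[of m "moment m"] by (simp add: Y_def[abs_def])
    qed
    have "(\<lambda>n. ?E n (Y n (2 * m)) * (1 / real n)) \<longlonglongrightarrow> moment (2 * m) * 0"
      using m by (intro tendsto_mult mean lim_const_over_n) auto
    moreover have "(\<lambda>n. (?E n (Y n m) - moment m)\<^sup>2) \<longlonglongrightarrow> (moment m - moment m)\<^sup>2"
      by (intro tendsto_intros mean m)
    ultimately show "(\<lambda>n. (?E n (Y n m) - moment m)\<^sup>2 + ?E n (Y n (2 * m)) / real n) \<longlonglongrightarrow> 0"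
      using tendsto_add[of "\<lambda>n. (?E n (Y n m) - moment m)\<^sup>2" 0 sequentially "\<lambda>n. ?E n (Y n (2 * m)) / real n" 0] by simp
  qed (rule tendsto_const)
  have \<rho>_bd: "\<bar>\<rho> t\<bar> \<le> 1" if "0 < t" "t < ?L" for t
    using angle_sum_bounds(1)[of t] angle_sum_bounds(2)[OF that] \<rho>[OF that] by simp
  have \<rho>_cont: "continuous_on {0<..<?L} \<rho>"
  proof -
    have "continuous_on {0<..<?L} (\<lambda>t. angle_sum t / pi)" by (intro continuous_intros continuous_angle_sum) simp
    then show ?thesis by (rule continuous_on_eq) (use \<rho> in auto)
  qed
  show ?thesis
    unfolding has_limit_shape_def
  proof (intro allI impI)
    fix g :: "real \<Rightarrow> real" and \<epsilon> :: real
    assume g: "continuous_on {0<..<?L} g \<and> compactly_supported_on {0<..<?L} g" and \<epsilon>: "0 < \<epsilon>"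
    let ?h = "cutoff ?L g"
    have h: "continuous_on UNIV ?h" using continuous_cutoff g by blast
    have h\<rho>: "continuous_on UNIV (cutoff ?L (\<lambda>t. g t * \<rho> t))"
    proof (rule continuous_cutoff)
      show "continuous_on {0<..<?L} (\<lambda>t. g t * \<rho> t)" using g \<rho>_cont by (intro continuous_intros) auto
      show "compactly_supported_on {0<..<?L} (\<lambda>t. g t * \<rho> t)"
        using g unfolding compactly_supported_on_def by (metis mult_zero_left)
    qed
    note int = integrable_cutoff[OF h] and int\<rho> = integrable_cutoff[OF h\<rho>]
    let ?J = "LINT x|lborel. cutoff ?L (\<lambda>t. g t * \<rho> t) x"
    (* For finite n the particles may reach slightly beyond c + 1; the approximation is therefore
       required on a longer interval. *)
    let ?T = "?L + 1"
    (* The errors below add up to 2 * (2 * \<delta> + 2 * \<delta> * (c + 1)), which is \<epsilon>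
       / 4 for this choice. *)
    define \<delta> where "\<delta> = \<epsilon> / (16 * (1 + ?L))"
    have \<delta>: "0 < \<delta>" using \<epsilon> L by (simp add: \<delta>_def)
    obtain a d where approx: "\<And>t. 0 \<le> t \<Longrightarrow> t \<le> ?T \<Longrightarrow> \<bar>?h t - (\<Sum>i\<le>d. a i * exp (- \<gamma> * t) ^ Suc i)\<bar> \<le> \<delta>"
      using geometric_test_function_approx[OF h \<gamma>_nonzero \<delta>] by blast
    have "uniformly_continuous_on {0..?T + 1} ?h"
      by (rule compact_uniformly_continuous[OF continuous_on_subset[OF h]]) auto
    then obtain w where w: "0 < w" "\<And>s t. s \<in> {0..?T + 1} \<Longrightarrow> t \<in> {0..?T + 1} \<Longrightarrow> \<bar>s - t\<bar> < w \<Longrightarrow> \<bar>?h s - ?h t\<bar> < \<delta>"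
      using \<delta> unfolding uniformly_continuous_on_def dist_real_def by (metis abs_minus_commute)
    have third: "\<bar>(\<Sum>i\<le>d. a i * moment (Suc i)) - ?J\<bar> \<le> 2 * \<delta> * ?L"
    proof -
      have "((\<lambda>t. \<Sum>i\<le>d. a i * (exp (- \<gamma> * t) ^ Suc i * (angle_sum t / pi))) has_integral (\<Sum>i\<le>d. a i * moment (Suc i))) {0..?L}"
        by (intro has_integral_sum has_integral_mult_right density_moment) auto
      from has_integral_diff[OF this int\<rho>(2)]
      have I: "((\<lambda>t. (\<Sum>i\<le>d. a i * (exp (- \<gamma> * t) ^ Suc i * (angle_sum t / pi))) - cutoff ?L (\<lambda>t. g t * \<rho> t) t)
         has_integral (\<Sum>i\<le>d. a i * moment (Suc i)) - ?J) {0..?L}" .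
      have "norm ((\<Sum>i\<le>d. a i * moment (Suc i)) - ?J) \<le> (2 * \<delta>) * measure lborel {0..?L}"
      proof (rule has_integral_bound_real[OF _ finite.emptyI I])
        fix t assume "t \<in> {0..?L} - {}"
        then have t: "t \<in> {0..?L}" by simp
        have "cutoff ?L (\<lambda>t. g t * \<rho> t) t = ?h t * (angle_sum t / pi)"
          using \<rho>[of t] by (auto simp: cutoff_def)
        then have "(\<Sum>i\<le>d. a i * (exp (- \<gamma> * t) ^ Suc i * (angle_sum t / pi))) - cutoff ?L (\<lambda>t. g t * \<rho> t) t =
           ((\<Sum>i\<le>d. a i * exp (- \<gamma> * t) ^ Suc i) - ?h t) * (angle_sum t / pi)"
          by (simp only: left_diff_distrib sum_distrib_right mult.assoc)
        moreover have "\<bar>(\<Sum>i\<le>d. a i * exp (- \<gamma> * t) ^ Suc i) - ?h t\<bar> \<le> \<delta>"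
          using approx[of t] t by (simp add: abs_minus_commute)
        (* The bound 1 holds in the interior only; two angles of at most pi give 2 everywhere. *)
        moreover have "\<bar>angle_sum t / pi\<bar> \<le> 2"
          using arccos_ext_bounds[of "edge_cos inner_ratio (edge_coord t)"] arccos_ext_bounds[of "edge_cos rad (- edge_coord t)"]
          by (simp add: angle_sum_def divide_le_eq)
        ultimately show "norm ((\<Sum>i\<le>d. a i * (exp (- \<gamma> * t) ^ Suc i * (angle_sum t / pi))) - cutoff ?L (\<lambda>t. g t * \<rho> t) t) \<le> 2 * \<delta>"
          using mult_mono[of "\<bar>(\<Sum>i\<le>d. a i * exp (- \<gamma> * t) ^ Suc i) - ?h t\<bar>" \<delta> "\<bar>angle_sum t / pi\<bar>" 2] \<delta>
          by (simp add: abs_mult)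
      qed (use \<delta> in simp)
      then show ?thesis using L by simp
    qed
    (* The particle at b contributes powers of q^b = exp (- \<gamma> * s) with s = \<sigma> n * b
       / n, and \<sigma> n tends to 1, so s is close to the position b / n of its cell. *)
    define \<sigma> where "\<sigma> n = real n * ln (q n) / - \<gamma>" for n
    have \<sigma>1: "\<sigma> \<longlonglongrightarrow> 1"
      using tendsto_divide[OF qa(5) tendsto_const[of "- \<gamma>"]] \<gamma>_nonzero by (simp add: \<sigma>_def[abs_def])
    have len: "(\<lambda>n. (real n + real (k n)) / real n) \<longlonglongrightarrow> ?L"
    proof (rule Lim_transform_eventually)
      show "(\<lambda>n. real (k n) / real n + 1) \<longlonglongrightarrow> ?L" by (intro tendsto_intros k)
      show "\<forall>\<^sub>F n in sequentially. real (k n) / real n + 1 = (real n + real (k n)) / real n"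
        using eventually_gt_at_top[of 0] by eventually_elim (simp add: add_divide_distrib)
    qed
    have ev1: "\<forall>\<^sub>F n in sequentially. (real n + real (k n)) / real n * \<sigma> n < ?T"
      using order_tendstoD(2)[OF tendsto_mult[OF len \<sigma>1], of ?T] by simp
    have ev2: "\<forall>\<^sub>F n in sequentially. (real n + real (k n)) / real n < ?T"
      using order_tendstoD(2)[OF len, of ?T] by simp
    have ev3: "\<forall>\<^sub>F n in sequentially. (real n + real (k n)) / real n * \<bar>\<sigma> n - 1\<bar> + 1 / real n < w"
    proof -
      have "(\<lambda>n. (real n + real (k n)) / real n * \<bar>\<sigma> n - 1\<bar> + 1 / real n) \<longlonglongrightarrow> ?L * \<bar>1 - 1\<bar> + 0"
        by (intro tendsto_intros len \<sigma>1 lim_const_over_n)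
      from order_tendstoD(2)[OF this, of w] show ?thesis using w(1) by simp
    qed
    have ev4: "\<forall>\<^sub>F n in sequentially. 0 < \<sigma> n" using order_tendstoD(1)[OF \<sigma>1, of 0] by simp
    define D where "D n \<nu> = (LBINT x:{0<..<?L}. g x * deriv (upper_boundary n \<nu>) x) -
       (LBINT x:{0<..<?L}. g x * deriv (limit_shape \<rho>) x)" for n \<nu>
    define Z where "Z n S = (\<Sum>i\<le>d. a i * (Y n (Suc i) S - moment (Suc i)))" for n S
    have bound: "\<forall>\<^sub>F n in sequentially. \<forall>\<nu>\<in>young_rect n (k n). \<bar>D n \<nu>\<bar> \<le> \<epsilon> / 2 + 2 * \<bar>Z n (particles n \<nu>)\<bar>"
      using ev1 ev2 ev3 ev4 qa(2) eventually_gt_at_top[of 0]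
    proof eventually_elim
      case (elim n)
      have n: "0 < n" "0 < real n" using elim(6) by auto
      show ?case
      proof
        fix \<nu> assume \<nu>: "\<nu> \<in> young_rect n (k n)"
        let ?S = "particles n \<nu>"
        let ?P = "\<lambda>u. \<Sum>i\<le>d. a i * u ^ Suc i"
        let ?I = "\<lambda>b. LINT x|lborel. indicator {real b / real n..<(real b + 1) / real n} x * ?h x"
        have anti: "antimono \<nu>" using \<nu> by (simp add: young_rect_def)
        have inj: "inj_on (particle n \<nu>) {..<n}"
          by (rule linorder_inj_onI') (use particle_strict[OF anti] in \<open>auto simp: less_imp_neq[THEN not_sym]\<close>)
        have card: "card ?S = n" "finite ?S" using inj by (simp_all add: particles_eq card_image)
        have cell: "\<bar>?I b - 1 / real n * ?P (q n ^ b)\<bar> \<le> 1 / real n * (2 * \<delta>)" if b: "b \<in> ?S" for b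
        proof -
          have bn: "b < n + k n" using b particle_less[OF \<nu>] by (auto simp: particles_eq)
          let ?t = "real b / real n" and ?s = "real b / real n * \<sigma> n"
          have t: "0 \<le> ?t" "?t \<le> (real n + real (k n)) / real n" using bn n by (auto simp: divide_right_mono)
          have "?s \<le> (real n + real (k n)) / real n * \<sigma> n" using t elim(4) by (intro mult_right_mono) auto
          then have s: "0 \<le> ?s" "?s \<le> ?T" using elim(1,4) by auto
          have qb: "q n ^ b = exp (- \<gamma> * ?s)"
          proof -
            have "- \<gamma> * ?s = real b * ln (q n)" using \<gamma>_nonzero n by (simp add: \<sigma>_def)
            then show ?thesis using elim(5) by (simp add: exp_of_nat_mult)
          qed
          have st: "\<bar>?s - ?t\<bar> \<le> (real n + real (k n)) / real n * \<bar>\<sigma> n - 1\<bar>"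
          proof -
            have "?s - ?t = ?t * (\<sigma> n - 1)" by (simp add: right_diff_distrib)
            then have "\<bar>?s - ?t\<bar> = ?t * \<bar>\<sigma> n - 1\<bar>" using t(1) by (simp only: abs_mult abs_of_nonneg)
            also have "\<dots> \<le> (real n + real (k n)) / real n * \<bar>\<sigma> n - 1\<bar>"
              by (rule mult_right_mono[OF t(2) abs_ge_zero])
            finally show ?thesis .
          qed
          have eq: "(real b + 1) / real n = ?t + 1 / real n" by (simp add: add_divide_distrib)
          show ?thesis
            unfolding eq
          proof (rule cell_integral_bound[OF int(1)])
            fix t assume t': "?t \<le> t" "t < ?t + 1 / real n"
            have n1: "1 / real n \<le> 1" using n by simp
            have "0 \<le> t" by (rule order.trans[OF t(1) t'(1)])
            moreover have "t \<le> ?T + 1" using t(2) t'(2) elim(2) n1 by linarith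
            ultimately have "t \<in> {0..?T + 1}" by simp
            moreover have "?s \<in> {0..?T + 1}" using s by auto
            moreover have "\<bar>t - ?s\<bar> < w" using st t' elim(3) by (smt (verit))
            ultimately have "\<bar>?h t - ?h ?s\<bar> < \<delta>" by (intro w(2))
            moreover have "\<bar>?h ?s - ?P (q n ^ b)\<bar> \<le> \<delta>" unfolding qb by (rule approx[OF s])
            ultimately show "\<bar>?h t - ?P (q n ^ b)\<bar> \<le> 2 * \<delta>" by linarith
          qed simp
        qed
        have first: "\<bar>(\<Sum>b\<in>?S. ?I b) - (\<Sum>b\<in>?S. 1 / real n * ?P (q n ^ b))\<bar> \<le> 2 * \<delta>"
        proof -
          have "\<bar>(\<Sum>b\<in>?S. ?I b) - (\<Sum>b\<in>?S. 1 / real n * ?P (q n ^ b))\<bar> \<le> (\<Sum>b\<in>?S. \<bar>?I b - 1 / real n * ?P (q n ^ b)\<bar>)"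
            unfolding sum_subtractf[symmetric] by (rule sum_abs)
          also have "\<dots> \<le> (\<Sum>b\<in>?S. 1 / real n * (2 * \<delta>))" by (rule sum_mono[OF cell])
          also have "\<dots> = 2 * \<delta>" using card n by simp
          finally show ?thesis .
        qed
        have second: "(\<Sum>b\<in>?S. 1 / real n * ?P (q n ^ b)) = Z n ?S + (\<Sum>i\<le>d. a i * moment (Suc i))"
        proof -
          have pw: "(q n ^ b) ^ Suc i = (q n ^ Suc i) ^ b" for b i
            by (simp only: power_mult[symmetric] mult.commute)
          have "(\<Sum>b\<in>?S. 1 / real n * ?P (q n ^ b)) = (\<Sum>b\<in>?S. \<Sum>i\<le>d. a i * ((q n ^ Suc i) ^ b / real n))"
            by (intro sum.cong refl) (simp add: sum_divide_distrib pw del: power_Suc)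
          also have "\<dots> = (\<Sum>i\<le>d. \<Sum>b\<in>?S. a i * ((q n ^ Suc i) ^ b / real n))" by (rule sum.swap)
          also have "\<dots> = (\<Sum>i\<le>d. a i * Y n (Suc i) ?S)"
            unfolding Y_def by (simp only: sum_distrib_left sum_divide_distrib)
          finally show ?thesis by (simp add: Z_def right_diff_distrib sum_subtractf)
        qed
        have D: "D n \<nu> = 2 * (?J - (\<Sum>b\<in>?S. ?I b))"
        proof -
          have "(LBINT x:{0<..<?L}. g x * deriv (limit_shape \<rho>) x) = (LINT x|lborel. ?h x) - 2 * ?J"
            by (rule integral_deriv_limit_shape[OF \<rho>_cont \<rho>_bd int(1) int\<rho>(1)])
          then show ?thesis
            unfolding D_def integral_deriv_upper_boundary[OF n(1) int(1)] by simp
        qed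
        have "\<bar>?J - (\<Sum>b\<in>?S. ?I b)\<bar> \<le> 2 * \<delta> + 2 * \<delta> * ?L + \<bar>Z n ?S\<bar>"
          using first third unfolding second by linarith
        then have "\<bar>D n \<nu>\<bar> \<le> 2 * (2 * \<delta> + 2 * \<delta> * ?L + \<bar>Z n ?S\<bar>)"
          unfolding D by (simp add: abs_mult)
        also have "\<dots> = 4 * (\<delta> * (1 + ?L)) + 2 * \<bar>Z n ?S\<bar>" by (simp add: algebra_simps)
        also have "\<delta> * (1 + ?L) = \<epsilon> / 16"
        proof -
          have "e / (16 * X) * X = e / 16" if "X \<noteq> 0" for e X :: real using that by simp
          moreover have "1 + ?L \<noteq> 0" using L by linarith
          ultimately show ?thesis unfolding \<delta>_def by blast
        qed
        finally show "\<bar>D n \<nu>\<bar> \<le> \<epsilon> / 2 + 2 * \<bar>Z n ?S\<bar>" using \<epsilon> by simp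
      qed
    qed
    let ?Pr = "\<lambda>n. measure (diagram_measure n (k n) (x n) (y n)) {\<nu> \<in> space (diagram_measure n (k n) (x n) (y n)). \<epsilon> < \<bar>D n \<nu>\<bar>}"
    let ?R = "\<lambda>n. (\<Sum>i\<le>d. (a i)\<^sup>2 * ?E n (\<lambda>S. (Y n (Suc i) S - moment (Suc i))\<^sup>2)) * real (Suc d) / (\<epsilon> / 4)\<^sup>2"
    have "?Pr \<longlonglongrightarrow> 0"
    proof (rule tendsto_sandwich[where f = "\<lambda>_. 0" and h = ?R])
      have "?R \<longlonglongrightarrow> (\<Sum>i\<le>d. (a i)\<^sup>2 * 0) * real (Suc d) / (\<epsilon> / 4)\<^sup>2"
        using \<epsilon> by (intro tendsto_intros dev) auto
      then show "?R \<longlonglongrightarrow> 0" by simp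
      show "\<forall>\<^sub>F n in sequentially. ?Pr n \<le> ?R n"
        using Q bound
      proof eventually_elim
        case (elim n)
        interpret q_pair n "k n" "q n" "M n" "e n" "x n" "y n" by (rule elim(1))
        have "?Pr n \<le> expect (\<lambda>S. (Z n S)\<^sup>2) / (\<epsilon> / 4)\<^sup>2"
        proof (rule chebyshev)
          fix \<nu> assume "\<nu> \<in> young_rect n (k n)" "\<epsilon> < \<bar>D n \<nu>\<bar>"
          (* From \<epsilon> < \<bar>D\<bar> \<le> \<epsilon> / 2 + 2 * \<bar>Z\<bar>. *)
          then show "\<epsilon> / 4 \<le> \<bar>Z n (particles n \<nu>)\<bar>" using elim(2) by fastforce
        qed (use \<epsilon> in simp)
        also have "expect (\<lambda>S. (Z n S)\<^sup>2) \<le> expect (\<lambda>S. real (Suc d) * (\<Sum>i\<le>d. (a i)\<^sup>2 * (Y n (Suc i) S - moment (Suc i))\<^sup>2))"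
        proof (rule expect_mono)
          fix S show "(Z n S)\<^sup>2 \<le> real (Suc d) * (\<Sum>i\<le>d. (a i)\<^sup>2 * (Y n (Suc i) S - moment (Suc i))\<^sup>2)"
            using sum_squared_le_sum_of_squares[of "\<lambda>i. a i * (Y n (Suc i) S - moment (Suc i))" "{..d}"]
            by (simp add: Z_def power_mult_distrib mult.commute)
        qed
        also have "\<dots> = (\<Sum>i\<le>d. (a i)\<^sup>2 * expect (\<lambda>S. (Y n (Suc i) S - moment (Suc i))\<^sup>2)) * real (Suc d)"
          by (simp only: expect_scale expect_sum mult.commute)
        finally show ?case by (simp add: divide_right_mono)
      qed
    qed auto
    then show "(\<lambda>n. measure (diagram_measure n (k n) (x n) (y n)) {\<nu> \<in> space (diagram_measure n (k n) (x n) (y n)).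
        \<epsilon> < \<bar>(LBINT x:{0<..<?L}. g x * deriv (upper_boundary n \<nu>) x) -
            (LBINT x:{0<..<?L}. g x * deriv (limit_shape \<rho>) x)\<bar>}) \<longlonglongrightarrow> 0"
      unfolding D_def .
  qed
qed

text \<open>
  For the first measure the second progression starts at \<open>\<mu> = 1\<close>. For the
  second it is read backwards, starting at \<open>q\<^bsup>1 - k\<^esup>\<close>, which tends to
  \<open>exp (\<gamma> c)\<close>.
\<close>

theorem corollary1:
  fixes c \<gamma> :: real and k :: "nat \<Rightarrow> nat"
  assumes "c > 0" and "\<gamma> \<noteq> 0"
    and "filterlim k at_top sequentially"
    and "(\<lambda>n. real (k n) / real n) \<longlonglongrightarrow> c"
  shows "has_limit_shape (\<lambda>n. measure_A (1 - \<gamma> / real n) n (k n)) (c + 1) (limit_shape (rho_A c \<gamma>))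
       \<and> has_limit_shape (\<lambda>n. measure_B (1 - \<gamma> / real n) n (k n)) (c + 1) (limit_shape (rho_B c \<gamma>))"
proof
  let ?q = "\<lambda>n. 1 - \<gamma> / real n"
  note qa = q_asymptotics[OF assms(2,4)]
  have n0: "\<forall>\<^sub>F n in sequentially. (0::nat) < n" by (rule eventually_gt_at_top)
  show "has_limit_shape (\<lambda>n. measure_A (?q n) n (k n)) (c + 1) (limit_shape (rho_A c \<gamma>))"
  proof -
    interpret A: limit_parameters c \<gamma> 1 using assms by unfold_locales auto
    have "\<forall>\<^sub>F n in sequentially. q_pair n (k n) (?q n) 1 (\<lambda>j. j) (\<lambda>i. ?q n ^ i) (\<lambda>j. ?q n ^ j)"
      using qa(2) n0 by eventually_elim (auto simp: q_pair_def bij_betw_def)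
    from A.q_pair_limit_shape[OF assms(4) tendsto_const this rho_A_angle_sum[OF assms(1,2)]]
    show ?thesis by (simp add: measure_A_def)
  qed
  show "has_limit_shape (\<lambda>n. measure_B (?q n) n (k n)) (c + 1) (limit_shape (rho_B c \<gamma>))"
  proof -
    interpret B: limit_parameters c \<gamma> "exp (\<gamma> * c)" using assms by unfold_locales auto
    let ?M = "\<lambda>n. ?q n / ?q n ^ k n"
    have "?M \<longlonglongrightarrow> 1 / exp (- \<gamma> * c)" by (intro tendsto_intros qa) auto
    then have M: "?M \<longlonglongrightarrow> exp (\<gamma> * c)" by (simp add: exp_minus field_simps)
    (* The inverse powers of q, read backwards, are q^(1 - k) times the powers of q. *)
    have bij: "bij_betw (\<lambda>j. m - Suc j) {..<m} {..<m}" for m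
      by (rule bij_betw_byWitness[where f' = "\<lambda>j. m - Suc j"]) auto
    have "\<forall>\<^sub>F n in sequentially. q_pair n (k n) (?q n) (?M n) (\<lambda>j. k n - Suc j) (\<lambda>i. ?q n ^ i) (\<lambda>j. inverse (?q n) ^ j)"
      using qa(2) n0
    proof eventually_elim
      case (elim n)
      have "inverse (?q n) ^ j = ?M n * ?q n ^ (k n - Suc j)" if "j < k n" for j
      proof -
        have "?q n ^ k n = ?q n * ?q n ^ (k n - Suc j) * ?q n ^ j"
          using that by (simp flip: power_Suc power_add)
        then show ?thesis using elim by (simp add: field_simps)
      qed
      then show ?case using elim bij by (simp add: q_pair_def)
    qed
    from B.q_pair_limit_shape[OF assms(4) M this rho_B_angle_sum[OF assms(1,2)]]
    show ?thesis by (simp add: measure_B_def)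
  qed
qed

end
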